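(* Let $g\colon U\to V$ be a morphism of Lie algebras over a field of characteristic $0$ and $T=U\oplus V$. There is a cochain complex isomorphism $$\pi=(\pi^*,\pi^*,\tilde\pi^* )\colon(\Lambda^*(U,V),\delta)\xrightarrow{\ \cong\ }(\Lambda^*(U,V),\Delta),\qquad \pi^n=\mathrm{Id},\quad\tilde\pi^n=(-1)^{n-1}\mathrm{Id},$$ i.e. $\pi(x_U,x_V,x_g)=(x_U,x_V,(-1)^{n-1}x_g)$ on $\Lambda^n(U,V)$. Combined with the identification $(C^*_{\mathbf{Lie}_{B\to W}}(T;T),\delta_{\mathbf{Lie}_{B\to W}})\cong(\Lambda^{*+1}(U,V),\delta)$, $\theta\leftrightarrow(\theta_U,\theta_V,\theta_g)$, this gives an isomorphism of cochain complexes $$(C^*_{\mathbf{Lie}_{B\to W}}(T;T),\delta_{\mathbf{Lie}_{B\to W}})\xrightarrow{\ \cong\ }(\Lambda^{*+1}(U,V),\Delta).$$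
   Context: $\mathbf k$ is a field of characteristic $0$; $(U,\mu_U)$, $(V,\mu_V)$ are Lie algebras over $\mathbf k$ with brackets $\mu_U,\mu_V$, and $g\colon U\to V$ is a Lie algebra morphism. $T=U\oplus V$ is two-colored with $T_B=U$, $T_W=V$; $\mathrm{End}_T$ is its 2-colored endomorphism PROP (multilinear maps between tensor products of $U$'s and $V$'s). **Minimal model.** $\mathbf{Lie}_{B\to W}$ is the 2-colored operad whose algebras are morphisms of Lie algebras. Its minimal model is $(\mathsf F(E),\partial)$, the free 2-colored PROP on the 2-colored $\Sigma$-bimodule $E$ with skew-symmetric generators $\mu_n\colon B^{\otimes n}\to B$ of degree $n-2$ ($n\ge2$), $\nu_n\colon W^{\otimes n}\to W$ of degree $n-2$ ($n\ge2$), $f_n\colon B^{\otimes n}\to W$ of degree $n-1$ ($n\ge1$), and $$\partial(\mu_n)=\sum_{\substack{i+j=n+1\\ i,j\ge2}}(-1)^{j(i-1)}\sum_{\sigma\in S_{j,i-1}}\mathrm{sgn}(\sigma)\,\mu_i\circ(\mu_j\otimes\mathrm{Id}^{\otimes i-1})\circ\sigma,$$ $\partial(\nu_n)$ is given by the same formula with $\nu$ in place of $\mu$, and $$\begin{aligned}\partial(f_n)={}&\sum_{l=2}^n\sum_{\substack{r_1+\cdots+r_l=n\\ r_1\le\cdots\le r_l}}(-1)^{\frac{l(l-1)}2+\sum_{i=1}^{l-1}r_i(l-i)}\sum_{\sigma\in S^<_{r_1,\ldots,r_l}}\mathrm{sgn}(\sigma)\,\nu_l(f_{r_1}\otimes\cdots\otimes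 f_{r_l})\circ\sigma\\&-\sum_{\substack{i+j=n+1\\ i\ge1,j\ge2}}(-1)^{j(i-1)}\sum_{\sigma\in S_{j,i-1}}\mathrm{sgn}(\sigma)\,f_i\circ(\mu_j\otimes\mathrm{Id}^{\otimes i-1})\circ\sigma.\end{aligned}$$ Here $S_{j,i-1}$ is the set of $(j,i-1)$-unshuffles ($\sigma(1)<\cdots<\sigma(j)$, $\sigma(j+1)<\cdots<\sigma(j+i-1)$), $S^<_{r_1,\ldots,r_l}$ ($r_1\le\cdots\le r_l$) is the set of $(r_1,\ldots,r_l)$-unshuffles with $\sigma(r_1+\cdots+r_{i-1}+1)<\sigma(r_1+\cdots+r_i+1)$ whenever $r_i=r_{i+1}$, and $(F\circ\sigma)(x_1,\ldots,x_n)=F(x_{\sigma(1)},\ldots,x_{\sigma(n)})$. The morphism $g$ corresponds to $\beta\colon\mathsf F(E)\to\mathrm{End}_T$ with $\beta(\mu_2)=\mu_U$, $\beta(\nu_2)=\mu_V$, $\beta(f_1)=g$, and $\beta=0$ on all other generators. **Deformation complex.** $C^*_{\mathbf{Lie}_{B\to W}}(T;T)=\,\uparrow\mathrm{Der}(\mathsf F(E),\mathrm{End}_T)^{-*}\cong\,\uparrow\mathrm{Hom}_\Sigma(E,\mathrm{End}_T)^{-*}$ ($\uparrow$ suspension, $-*$ reversed grading; derivations are with respect to $\beta$): $\theta\in C^p$ is a color-preserving equivariant linear map $E\to\mathrm{End}_T$ supported on generators of degree $p-1$, and is identified with $(\theta_U,\theta_V,\theta_g):=(\theta(\mu_{p+1}),\theta(\nu_{p+1}),\theta(f_p))\in\Lambda^{p+1}(U,V)$,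 where, for $n\ge1$, $$\Lambda^n(U,V)=\mathrm{Hom}(U^{\wedge n},U)\oplus\mathrm{Hom}(V^{\wedge n},V)\oplus\mathrm{Hom}(U^{\wedge n-1},V).$$ This is the linear isomorphism $C^p_{\mathbf{Lie}_{B\to W}}(T;T)\cong\Lambda^{p+1}(U,V)$ used here. The differential $\delta_{\mathbf{Lie}_{B\to W}}=l_1$ is induced by $\theta\mapsto\theta\partial$: $l_1(\theta)(\xi)$, for a generator $\xi$, is the sum over all terms of $\partial(\xi)$ and all vertices $v$ of that term of the composite in $\mathrm{End}_T$ obtained by applying $\theta$ to the decoration of $v$ and $\beta$ to the other decorations (no signs other than the coefficients in $\partial(\xi)$). $\delta$ is the differential on the graded module $\Lambda^{*}(U,V)$ induced by $\delta_{\mathbf{Lie}_{B\to W}}$ through this identification; it is given on $\Lambda^n(U,V)$ by $\delta(\theta_U,\theta_V,\theta_g)=(b\theta_U,\ b\theta_V,\ -b\theta_g+\theta_Vg^{\otimes n}-g\theta_U)$. **S-cohomology complex.** $\Delta^n(x_U,x_V,x_g)=\big(bx_U,\ bx_V,\ (-1)^{n-1}gx_U-(-1)^{n-1}x_Vg^{\otimes n}+bx_g\big)$ for $(x_U,x_V,x_g)\in\Lambda^n(U,V)$. In both formulas $b$ is the Chevalley–Eilenberg differential with the sign convention $$(b\varphi)(x_1,\ldots,x_{n+1})=\sum_{s}(-1)^s\,x_s\cdot\varphi(x_1,\ldots,\widehat{x_s},\ldots,x_{n+1})+\sum_{s<t}(-1)^{s+t-1}\varphi([x_s,x_t],x_1,\ldots,\widehat{x_s},\ldots,\widehat{x_t},\ldots,x_{n+1})$$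 ($U$, $V$ are adjoint modules over themselves and $V$ is a $U$-module via $g$).
   Formalization: The isomorphisms of C^* with Λ^{*+1}(U,V) are stated in degrees p ≥ 1 only: C^0 = 0 because no generator has degree −1, while Λ^1(U,V) is nonzero unless U = V = 0, so the claim fails at p = 0. *)

theory Defs
  imports
    Complex_Main
    "HOL-Library.Function_Algebras"
    "HOL-Library.Product_Plus"
    "HOL-Library.Poly_Mapping"
    "HOL-Combinatorics.Permutations"
begin

section \<open>Lie algebras and their morphisms\<close>

locale lie_algebra = vector_space scale
  for scale :: "'k::field \<Rightarrow> 'a::ab_group_add \<Rightarrow> 'a" +
  fixes bracket :: "'a \<Rightarrow> 'a \<Rightarrow> 'a"
  assumes bracket_linear_left: "Vector_Spaces.linear scale scale (\<lambda>x. bracket x y)"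
    and bracket_linear_right: "Vector_Spaces.linear scale scale (\<lambda>y. bracket x y)"
    and bracket_self: "bracket x x = 0"
    and jacobi: "bracket x (bracket y z) + bracket y (bracket z x) + bracket z (bracket x y) = 0"

locale lie_algebra_morphism =
  U: lie_algebra sU brU + V: lie_algebra sV brV
  for sU :: "'k::field \<Rightarrow> 'u::ab_group_add \<Rightarrow> 'u" and brU
    and sV :: "'k \<Rightarrow> 'v::ab_group_add \<Rightarrow> 'v" and brV +
  fixes g :: "'u \<Rightarrow> 'v"
  assumes g_linear: "Vector_Spaces.linear sU sV g"
    and g_bracket: "g (brU x y) = brV (g x) (g y)"

section \<open>Cochain complexes\<close>

text \<open>A complex is a family of subspaces \<open>X n\<close>, \<open>n \<ge> lo\<close>, of one vector space
  (carried by a type), with differentials \<open>d n\<close> from \<open>X n\<close> to \<open>X (n + 1)\<close>.\<close>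

definition linear_between ::
  "('k \<Rightarrow> 'a::ab_group_add \<Rightarrow> 'a) \<Rightarrow> 'a set \<Rightarrow> ('k \<Rightarrow> 'b::ab_group_add \<Rightarrow> 'b) \<Rightarrow> 'b set
    \<Rightarrow> ('a \<Rightarrow> 'b) \<Rightarrow> bool" where
  "linear_between s X s' Y f \<longleftrightarrow>
     (\<forall>x\<in>X. f x \<in> Y) \<and>
     (\<forall>x\<in>X. \<forall>y\<in>X. f (x + y) = f x + f y) \<and>
     (\<forall>c. \<forall>x\<in>X. f (s c x) = s' c (f x))"

locale cochain_complex = vector_space scale
  for scale :: "'k::field \<Rightarrow> 'a::ab_group_add \<Rightarrow> 'a" +
  fixes lo :: nat and X :: "nat \<Rightarrow> 'a set" and d :: "nat \<Rightarrow> 'a \<Rightarrow> 'a"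
  assumes subspace: "n \<ge> lo \<Longrightarrow> subspace (X n)"
    and d_linear: "n \<ge> lo \<Longrightarrow> linear_between scale (X n) scale (X (n + 1)) (d n)"
    and d_squared: "n \<ge> lo \<Longrightarrow> x \<in> X n \<Longrightarrow> d (n + 1) (d n x) = 0"

locale cochain_complex_iso =
  X: cochain_complex s lo X d + Y: cochain_complex s' lo Y d'
  for lo :: nat
    and s :: "'k::field \<Rightarrow> 'a::ab_group_add \<Rightarrow> 'a" and X d
    and s' :: "'k \<Rightarrow> 'b::ab_group_add \<Rightarrow> 'b" and Y d' +
  fixes \<phi> :: "nat \<Rightarrow> 'a \<Rightarrow> 'b"
  assumes iso_linear: "n \<ge> lo \<Longrightarrow> linear_between s (X n) s' (Y n) (\<phi> n)"
    and iso_bij: "n \<ge> lo \<Longrightarrow> bij_betw (\<phi> n) (X n) (Y n)"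
    and iso_commute: "n \<ge> lo \<Longrightarrow> x \<in> X n \<Longrightarrow> \<phi> (n + 1) (d n x) = d' n (\<phi> n x)"

section \<open>The graded module \<open>\<Lambda>\<^sup>*(U,V)\<close>\<close>

text \<open>A map of \<open>n\<close> arguments is a function on lists that is \<open>0\<close> on lists of length other
  than \<open>n\<close>. Linear maps out of the \<open>n\<close>-th exterior power are alternating \<open>n\<close>-linear maps;
  for \<open>n = 0\<close> these are the elements of the target.\<close>

definition Hom_wedge ::
  "('k::field \<Rightarrow> 'a::ab_group_add \<Rightarrow> 'a) \<Rightarrow> ('k \<Rightarrow> 'b::ab_group_add \<Rightarrow> 'b) \<Rightarrow> nat
    \<Rightarrow> ('a list \<Rightarrow> 'b) set" where
  "Hom_wedge s s' n = {\<phi>.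
     (\<forall>xs. length xs \<noteq> n \<longrightarrow> \<phi> xs = 0) \<and>
     (\<forall>xs i. length xs = n \<longrightarrow> i < n \<longrightarrow> Vector_Spaces.linear s s' (\<lambda>x. \<phi> (xs[i := x]))) \<and>
     (\<forall>xs i j. length xs = n \<longrightarrow> i < j \<longrightarrow> j < n \<longrightarrow> xs ! i = xs ! j \<longrightarrow> \<phi> xs = 0)}"

type_synonym ('u, 'v) cochain = "('u list \<Rightarrow> 'u) \<times> ('v list \<Rightarrow> 'v) \<times> ('u list \<Rightarrow> 'v)"

definition Lam ::
  "('k::field \<Rightarrow> 'u::ab_group_add \<Rightarrow> 'u) \<Rightarrow> ('k \<Rightarrow> 'v::ab_group_add \<Rightarrow> 'v) \<Rightarrow> nat
    \<Rightarrow> ('u, 'v) cochain set" where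
  "Lam sU sV n = Hom_wedge sU sU n \<times> Hom_wedge sV sV n \<times> Hom_wedge sU sV (n - 1)"

definition scale_Lam ::
  "('k \<Rightarrow> 'u \<Rightarrow> 'u) \<Rightarrow> ('k \<Rightarrow> 'v \<Rightarrow> 'v) \<Rightarrow> 'k \<Rightarrow> ('u, 'v) cochain \<Rightarrow> ('u, 'v) cochain" where
  "scale_Lam sU sV c = (\<lambda>(xU, xV, xg).
     (\<lambda>us. sU c (xU us), \<lambda>vs. sV c (xV vs), \<lambda>us. sV c (xg us)))"

text \<open>The Chevalley--Eilenberg differential for the bracket \<open>br\<close> and the action \<open>act\<close>. The
  indices \<open>s\<close>, \<open>t\<close> count arguments from 1, list positions from 0.\<close>

definition CE ::
  "('k::field \<Rightarrow> 'm::ab_group_add \<Rightarrow> 'm) \<Rightarrow> ('a \<Rightarrow> 'a \<Rightarrow> 'a) \<Rightarrow> ('a \<Rightarrow> 'm \<Rightarrow> 'm)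
    \<Rightarrow> ('a list \<Rightarrow> 'm) \<Rightarrow> 'a list \<Rightarrow> 'm" where
  "CE sM br act \<phi> xs =
     (\<Sum>s\<in>{1..length xs}. sM ((-1) ^ s) (act (xs ! (s - 1)) (\<phi> (nths xs (- {s - 1}))))) +
     (\<Sum>s\<in>{1..length xs}. \<Sum>t\<in>{s<..length xs}.
        sM ((-1) ^ (s + t - 1))
          (\<phi> (br (xs ! (s - 1)) (xs ! (t - 1)) # nths xs (- {s - 1, t - 1}))))"

definition delta ::
  "('k::field \<Rightarrow> 'u::ab_group_add \<Rightarrow> 'u) \<Rightarrow> ('u \<Rightarrow> 'u \<Rightarrow> 'u)
    \<Rightarrow> ('k \<Rightarrow> 'v::ab_group_add \<Rightarrow> 'v) \<Rightarrow> ('v \<Rightarrow> 'v \<Rightarrow> 'v) \<Rightarrow> ('u \<Rightarrow> 'v)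
    \<Rightarrow> nat \<Rightarrow> ('u, 'v) cochain \<Rightarrow> ('u, 'v) cochain" where
  "delta sU brU sV brV g n = (\<lambda>(xU, xV, xg).
     (CE sU brU brU xU,
      CE sV brV brV xV,
      \<lambda>us. - CE sV brU (\<lambda>u v. brV (g u) v) xg us + xV (map g us) - g (xU us)))"

definition Delta ::
  "('k::field \<Rightarrow> 'u::ab_group_add \<Rightarrow> 'u) \<Rightarrow> ('u \<Rightarrow> 'u \<Rightarrow> 'u)
    \<Rightarrow> ('k \<Rightarrow> 'v::ab_group_add \<Rightarrow> 'v) \<Rightarrow> ('v \<Rightarrow> 'v \<Rightarrow> 'v) \<Rightarrow> ('u \<Rightarrow> 'v)
    \<Rightarrow> nat \<Rightarrow> ('u, 'v) cochain \<Rightarrow> ('u, 'v) cochain" where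
  "Delta sU brU sV brV g n = (\<lambda>(xU, xV, xg).
     (CE sU brU brU xU,
      CE sV brV brV xV,
      \<lambda>us. sV ((-1) ^ (n - 1)) (g (xU us)) - sV ((-1) ^ (n - 1)) (xV (map g us))
            + CE sV brU (\<lambda>u v. brV (g u) v) xg us))"

definition pi_map ::
  "('k::field \<Rightarrow> 'v::ab_group_add \<Rightarrow> 'v) \<Rightarrow> nat \<Rightarrow> ('u, 'v) cochain \<Rightarrow> ('u, 'v) cochain" where
  "pi_map sV n = (\<lambda>(xU, xV, xg). (xU, xV, \<lambda>us. sV ((-1) ^ (n - 1)) (xg us)))"

section \<open>The minimal model of \<open>Lie\<^sub>B\<^sub>\<rightarrow>\<^sub>W\<close>\<close>

datatype colour = Black | White

datatype gen = Mu nat | Nu nat | F nat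

text \<open>\<open>Mu n\<close>, \<open>Nu n\<close>, \<open>F n\<close> with indices outside the stated ranges are not generators.\<close>

definition generators :: "gen set" where
  "generators = {Mu n | n. n \<ge> 2} \<union> {Nu n | n. n \<ge> 2} \<union> {F n | n. n \<ge> 1}"

primrec deg :: "gen \<Rightarrow> int" where
  "deg (Mu n) = int n - 2"
| "deg (Nu n) = int n - 2"
| "deg (F n) = int n - 1"

primrec in_colours :: "gen \<Rightarrow> colour list" where
  "in_colours (Mu n) = replicate n Black"
| "in_colours (Nu n) = replicate n White"
| "in_colours (F n) = replicate n Black"

primrec out_colour :: "gen \<Rightarrow> colour" where
  "out_colour (Mu n) = Black"
| "out_colour (Nu n) = White"
| "out_colour (F n) = White"

abbreviation arity :: "gen \<Rightarrow> nat" where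
  "arity \<xi> \<equiv> length (in_colours \<xi>)"

text \<open>Composites of generators in the free PROP (all values of the differential have a single
  output) are trees decorated by generators; the leaf \<open>Leaf k\<close> stands for the \<open>k\<close>-th input,
  counted from 0. Precomposing with \<open>\<sigma>\<close>, where
  \<open>(F \<circ> \<sigma>)(x\<^sub>0, \<dots>) = F(x\<^bsub>\<sigma>(0)\<^esub>, \<dots>)\<close>, replaces the label \<open>k\<close> by \<open>\<sigma> k\<close>. Formal linear
  combinations are finitely supported functions on trees.\<close>

datatype tree = Leaf nat | Node gen "tree list"

definition leaves :: "(nat \<Rightarrow> nat) \<Rightarrow> nat \<Rightarrow> nat \<Rightarrow> tree list" where
  "leaves \<sigma> a b = map (\<lambda>k. Leaf (\<sigma> k)) [a..<b]"

text \<open>For block sizes \<open>rs = [r\<^sub>1, \<dots>, r\<^sub>l]\<close>, \<open>block_start rs i\<close> is the first position of the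
  block with (0-based) number \<open>i\<close>.\<close>

definition block_start :: "nat list \<Rightarrow> nat \<Rightarrow> nat" where
  "block_start rs i = sum_list (take i rs)"

definition unshuffles :: "nat list \<Rightarrow> (nat \<Rightarrow> nat) set" where
  "unshuffles rs = {\<sigma>. \<sigma> permutes {..<sum_list rs} \<and>
     (\<forall>i<length rs. strict_mono_on {block_start rs i..<block_start rs (i + 1)} \<sigma>)}"

definition ordered_unshuffles :: "nat list \<Rightarrow> (nat \<Rightarrow> nat) set" where
  "ordered_unshuffles rs = {\<sigma> \<in> unshuffles rs.
     \<forall>i. i + 1 < length rs \<longrightarrow> rs ! i = rs ! (i + 1)
       \<longrightarrow> \<sigma> (block_start rs i) < \<sigma> (block_start rs (i + 1))}"

definition ordered_partitions :: "nat \<Rightarrow> nat \<Rightarrow> nat list set" where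
  "ordered_partitions n l =
     {rs. length rs = l \<and> (\<forall>r\<in>set rs. r \<ge> 1) \<and> sorted rs \<and> sum_list rs = n}"

text \<open>\<open>insertion_tree \<xi> \<zeta> i j \<sigma>\<close> is \<open>\<xi> \<circ> (\<zeta> \<otimes> Id\<^bsup>i-1\<^esup>) \<circ> \<sigma>\<close> for \<open>\<xi>\<close> of arity \<open>i\<close> and
  \<open>\<zeta>\<close> of arity \<open>j\<close>; \<open>bloom_tree rs \<sigma>\<close> is \<open>\<nu>\<^sub>l(f\<^bsub>r\<^sub>1\<^esub> \<otimes> \<dots> \<otimes> f\<^bsub>r\<^sub>l\<^esub>) \<circ> \<sigma>\<close>.\<close>

definition insertion_tree :: "gen \<Rightarrow> gen \<Rightarrow> nat \<Rightarrow> nat \<Rightarrow> (nat \<Rightarrow> nat) \<Rightarrow> tree" where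
  "insertion_tree \<xi> \<zeta> i j \<sigma> = Node \<xi> (Node \<zeta> (leaves \<sigma> 0 j) # leaves \<sigma> j (j + (i - 1)))"

definition bloom_tree :: "nat list \<Rightarrow> (nat \<Rightarrow> nat) \<Rightarrow> tree" where
  "bloom_tree rs \<sigma> = Node (Nu (length rs))
     (map (\<lambda>m. Node (F (rs ! m)) (leaves \<sigma> (block_start rs m) (block_start rs (m + 1))))
       [0..<length rs])"

primrec boundary :: "gen \<Rightarrow> (tree \<Rightarrow>\<^sub>0 'k::field)" where
  "boundary (Mu n) =
     (\<Sum>(i, j)\<in>{(i, j). i + j = n + 1 \<and> i \<ge> 2 \<and> j \<ge> 2}. \<Sum>\<sigma>\<in>unshuffles [j, i - 1].
        Poly_Mapping.single (insertion_tree (Mu i) (Mu j) i j \<sigma>)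
          ((-1) ^ (j * (i - 1)) * of_int (sign \<sigma>)))"
| "boundary (Nu n) =
     (\<Sum>(i, j)\<in>{(i, j). i + j = n + 1 \<and> i \<ge> 2 \<and> j \<ge> 2}. \<Sum>\<sigma>\<in>unshuffles [j, i - 1].
        Poly_Mapping.single (insertion_tree (Nu i) (Nu j) i j \<sigma>)
          ((-1) ^ (j * (i - 1)) * of_int (sign \<sigma>)))"
| "boundary (F n) =
     (\<Sum>l\<in>{2..n}. \<Sum>rs\<in>ordered_partitions n l. \<Sum>\<sigma>\<in>ordered_unshuffles rs.
        Poly_Mapping.single (bloom_tree rs \<sigma>)
          ((-1) ^ (l * (l - 1) div 2 + (\<Sum>i\<in>{1..l - 1}. rs ! (i - 1) * (l - i)))
            * of_int (sign \<sigma>)))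
     - (\<Sum>(i, j)\<in>{(i, j). i + j = n + 1 \<and> i \<ge> 1 \<and> j \<ge> 2}. \<Sum>\<sigma>\<in>unshuffles [j, i - 1].
        Poly_Mapping.single (insertion_tree (F i) (Mu j) i j \<sigma>)
          ((-1) ^ (j * (i - 1)) * of_int (sign \<sigma>)))"

section \<open>The endomorphism PROP of \<open>T = U \<oplus> V\<close>\<close>

text \<open>Elements of \<open>T\<close> are pairs. An element of \<open>End_T\<close> with inputs coloured \<open>cs\<close> and one output
  of colour \<open>d\<close> is a multilinear map from the product of the \<open>T\<^bsub>c\<^esub>\<close>, \<open>c\<close> in \<open>cs\<close>, to \<open>T\<^bsub>d\<^esub>\<close>,
  extended by \<open>0\<close> to all other lists. Components with several outputs are not needed,
  since every generator has one output.\<close>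

type_synonym ('u, 'v) op = "('u \<times> 'v) list \<Rightarrow> 'u \<times> 'v"

primrec T_part :: "colour \<Rightarrow> ('u::zero \<times> 'v::zero) set" where
  "T_part Black = UNIV \<times> {0}"
| "T_part White = {0} \<times> UNIV"

definition scale_T :: "('k \<Rightarrow> 'u \<Rightarrow> 'u) \<Rightarrow> ('k \<Rightarrow> 'v \<Rightarrow> 'v) \<Rightarrow> 'k \<Rightarrow> 'u \<times> 'v \<Rightarrow> 'u \<times> 'v" where
  "scale_T sU sV c = (\<lambda>(u, v). (sU c u, sV c v))"

definition coloured :: "colour list \<Rightarrow> ('u::zero \<times> 'v::zero) list \<Rightarrow> bool" where
  "coloured cs xs \<longleftrightarrow> list_all2 (\<lambda>c x. x \<in> T_part c) cs xs"

definition End_T ::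
  "('k::field \<Rightarrow> 'u::ab_group_add \<Rightarrow> 'u) \<Rightarrow> ('k \<Rightarrow> 'v::ab_group_add \<Rightarrow> 'v)
    \<Rightarrow> colour list \<Rightarrow> colour \<Rightarrow> ('u, 'v) op set" where
  "End_T sU sV cs d = {t.
     (\<forall>xs. \<not> coloured cs xs \<longrightarrow> t xs = 0) \<and>
     (\<forall>xs. coloured cs xs \<longrightarrow> t xs \<in> T_part d) \<and>
     (\<forall>xs i. coloured cs xs \<longrightarrow> i < length cs \<longrightarrow>
        linear_between (scale_T sU sV) (T_part (cs ! i)) (scale_T sU sV) (T_part d)
          (\<lambda>x. t (xs[i := x])))}"

text \<open>The composite in \<open>End_T\<close> described by a tree: the vertex at position \<open>v\<close>, with
  decoration \<open>\<xi>\<close>, contributes the operation \<open>D v \<xi>\<close>. A position lists the indices of the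
  children followed from the root.\<close>

lemma size_nth_less [termination_simp]: "i < length ts \<Longrightarrow> size (ts ! i) < Suc (size_list size ts)"
  using size_list_estimation'[of "ts ! i" ts "size (ts ! i)" size] by simp

lemma size_nth_le [termination_simp]: "i < length ts \<Longrightarrow> size (ts ! i) \<le> Suc (size_list size ts)"
  using size_nth_less less_imp_le by blast

fun vertices :: "tree \<Rightarrow> nat list set" where
  "vertices (Leaf k) = {}"
| "vertices (Node \<xi> ts) = insert [] (\<Union>i\<in>set [0..<length ts]. (#) i ` vertices (ts ! i))"

fun composite :: "(nat list \<Rightarrow> gen \<Rightarrow> ('u, 'v) op) \<Rightarrow> tree \<Rightarrow> ('u, 'v) op" where
  "composite D (Leaf k) xs = xs ! k"
| "composite D (Node \<xi> ts) xs =
     D [] \<xi> (map (\<lambda>i. composite (\<lambda>v. D (i # v)) (ts ! i) xs) [0..<length ts])"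

text \<open>The morphism from the minimal model to \<open>End_T\<close> that encodes \<open>g\<close>.\<close>

definition beta ::
  "('u::ab_group_add \<Rightarrow> 'u \<Rightarrow> 'u) \<Rightarrow> ('v::ab_group_add \<Rightarrow> 'v \<Rightarrow> 'v) \<Rightarrow> ('u \<Rightarrow> 'v)
    \<Rightarrow> gen \<Rightarrow> ('u, 'v) op" where
  "beta brU brV g \<xi> xs =
     (if coloured (in_colours \<xi>) xs then
        (if \<xi> = Mu 2 then (brU (fst (xs ! 0)) (fst (xs ! 1)), 0)
         else if \<xi> = Nu 2 then (0, brV (snd (xs ! 0)) (snd (xs ! 1)))
         else if \<xi> = F 1 then (0, g (fst (xs ! 0)))
         else 0)
      else 0)"

section \<open>The deformation complex\<close>

text \<open>The bimodule \<open>E\<close> has the generators as a basis and \<open>\<xi> \<cdot> \<sigma> = sgn \<sigma> \<xi>\<close>, so an equivariant linear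
  map from \<open>E\<close> to \<open>End_T\<close> is given by its values \<open>\<theta> \<xi>\<close> on generators, subject to
  \<open>\<theta> \<xi> \<circ> \<sigma> = sgn \<sigma> \<theta> \<xi>\<close>. There is no generator of degree \<open>-1\<close>, so the degree \<open>0\<close> part vanishes,
  whereas \<open>\<Lambda>\<^sup>1\<close> does not: the identification with \<open>\<Lambda>\<^bsup>p+1\<^esup>\<close> starts at \<open>p = 1\<close>.\<close>

definition C_Lie ::
  "('k::field \<Rightarrow> 'u::ab_group_add \<Rightarrow> 'u) \<Rightarrow> ('k \<Rightarrow> 'v::ab_group_add \<Rightarrow> 'v)
    \<Rightarrow> nat \<Rightarrow> (gen \<Rightarrow> ('u, 'v) op) set" where
  "C_Lie sU sV p = {\<theta>.
     (\<forall>\<xi>. \<theta> \<xi> \<in> End_T sU sV (in_colours \<xi>) (out_colour \<xi>)) \<and>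
     (\<forall>\<xi> \<sigma> xs. \<sigma> permutes {..<arity \<xi>} \<longrightarrow> length xs = arity \<xi> \<longrightarrow>
        \<theta> \<xi> (permute_list \<sigma> xs) = scale_T sU sV (of_int (sign \<sigma>)) (\<theta> \<xi> xs)) \<and>
     (\<forall>\<xi>. \<xi> \<notin> generators \<or> deg \<xi> \<noteq> int p - 1 \<longrightarrow> \<theta> \<xi> = 0)}"

lemma C_Lie_0:
  assumes "vector_space sU" "vector_space sV"
  shows "C_Lie sU sV 0 = {0}"
proof -
  interpret U: vector_space sU by fact
  interpret V: vector_space sV by fact
  have T0: "0 \<in> T_part d" for d
    by (cases d) (auto simp: zero_prod_def)
  have s0: "scale_T sU sV c 0 = 0" for c
    by (simp add: scale_T_def zero_prod_def)
  have "deg \<xi> \<noteq> -1" if "\<xi> \<in> generators" for \<xi>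
    using that by (auto simp: generators_def)
  then have "\<theta> = 0" if "\<theta> \<in> C_Lie sU sV 0" for \<theta>
    using that by (intro ext) (auto simp: C_Lie_def)
  moreover have "0 \<in> C_Lie sU sV 0"
    by (auto simp: C_Lie_def End_T_def linear_between_def T0 s0)
  ultimately show ?thesis by blast
qed

definition scale_C ::
  "('k \<Rightarrow> 'u \<Rightarrow> 'u) \<Rightarrow> ('k \<Rightarrow> 'v \<Rightarrow> 'v) \<Rightarrow> 'k \<Rightarrow> (gen \<Rightarrow> ('u, 'v) op) \<Rightarrow> gen \<Rightarrow> ('u, 'v) op" where
  "scale_C sU sV c \<theta> = (\<lambda>\<xi> xs. scale_T sU sV c (\<theta> \<xi> xs))"

definition delta_Lie ::
  "('k::field \<Rightarrow> 'u::ab_group_add \<Rightarrow> 'u) \<Rightarrow> ('u \<Rightarrow> 'u \<Rightarrow> 'u)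
    \<Rightarrow> ('k \<Rightarrow> 'v::ab_group_add \<Rightarrow> 'v) \<Rightarrow> ('v \<Rightarrow> 'v \<Rightarrow> 'v) \<Rightarrow> ('u \<Rightarrow> 'v)
    \<Rightarrow> nat \<Rightarrow> (gen \<Rightarrow> ('u, 'v) op) \<Rightarrow> gen \<Rightarrow> ('u, 'v) op" where
  "delta_Lie sU brU sV brV g p \<theta> \<xi> xs =
     (if coloured (in_colours \<xi>) xs then
        (\<Sum>t\<in>Poly_Mapping.keys (boundary \<xi> :: tree \<Rightarrow>\<^sub>0 'k).
           scale_T sU sV (Poly_Mapping.lookup (boundary \<xi>) t)
             (\<Sum>v\<in>vertices t.
                composite (\<lambda>w. if w = v then \<theta> else beta brU brV g) t xs))
      else 0)"

definition identification ::
  "nat \<Rightarrow> (gen \<Rightarrow> ('u::zero, 'v::zero) op) \<Rightarrow> ('u, 'v) cochain" where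
  "identification p \<theta> =
     (\<lambda>us. fst (\<theta> (Mu (p + 1)) (map (\<lambda>u. (u, 0)) us)),
      \<lambda>vs. snd (\<theta> (Nu (p + 1)) (map (\<lambda>v. (0, v)) vs)),
      \<lambda>us. snd (\<theta> (F p) (map (\<lambda>u. (u, 0)) us)))"

end

theory Submission
  imports Defs
begin

text \<open>Write \<open>\<iota>\<^sub>x \<phi> = \<phi>(x, \<dots>)\<close>. With the present signs Cartan's formula reads
  \<open>\<iota>\<^sub>x b + b \<iota>\<^sub>x = - L\<^sub>x\<close> for alternating maps; it gives, by induction on the arguments, that \<open>b\<close>
  preserves alternating maps, commutes with \<open>L\<^sub>x\<close>, and squares to zero.

  The identification is a bijection because equivariance under the symmetric group means, in
  characteristic \<open>0\<close>, that the operations are alternating. In a cochain \<open>\<theta>\<close> of degree \<open>p\<close> only the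
  generators of degree \<open>p - 1\<close> survive, and \<open>\<beta>\<close> survives only on the two binary brackets and on
  \<open>f\<^sub>1\<close>. So the only terms of the boundary that contribute are those with one factor of either kind:
  for insertions the unshuffles of types \<open>(2, q - 1)\<close>, \<open>(q, 1)\<close> and \<open>(q, 0)\<close>, for the terms with
  \<open>\<nu>\<^sub>l\<close> at the root the partitions \<open>(1, \<dots>, 1)\<close> and \<open>(1, p)\<close>. The sign of an unshuffle depends
  only on the sum of the elements of its first block, which turns these terms into the two sums of
  \<open>b\<close>, the map \<open>\<theta>\<^sub>V g\<^sup>\<otimes>\<^sup>n\<close> and the map \<open>g \<theta>\<^sub>U\<close>. Finally \<open>\<delta>\<close> and \<open>\<Delta>\<close> are conjugate by the
  signs in \<open>\<pi>\<close>.\<close>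

section \<open>Alternating maps and the Chevalley--Eilenberg differential\<close>

text \<open>Linearity of \<open>delta_Lie\<close> and its vanishing square are never extracted from
  the sums over trees: an injective linear map that intertwines it with \<open>delta\<close> pulls
  both properties back, so that only \<open>delta\<close> is treated directly. The delicate degree
  is p = 1. There \<theta> and \<beta> live on the same generators \<open>Mu 2\<close>,
  \<open>Nu 2\<close>, \<open>F 1\<close>, so a single tree can contribute through two vertices. In
  particular the partition \<open>[1, 1]\<close> has only one ordered unshuffle, and the two
  summands of the action term come from its two children; for p > 1 they come from the unshuffles of
  type (1, p), each with one contributing vertex. In the component of \<open>F\<close> the two
  halves of b have different origins: the action terms come from trees with root
  \<open>Nu 2\<close>, the bracket terms from trees with root \<open>F p\<close>, which the boundary
  subtracts. Both arrive with the opposite of the sign in \<open>CE\<close>, whence the -b in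
  \<open>delta\<close>.\<close>

lemma nths_Cons_delete:
  "nths (y # ys) (- {0}) = ys" "nths (y # ys) (- {Suc i}) = y # nths ys (- {i})"
  "nths (y # ys) (- {0, Suc i}) = nths ys (- {i})"
  "nths (y # ys) (- {Suc i, Suc j}) = y # nths ys (- {i, j})"
proof -
  have "{j. Suc j \<in> - {0}} = UNIV" "{j. Suc j \<in> - {Suc i}} = - {i}"
    "{j. Suc j \<in> - {0, Suc i}} = - {i}" "{k. Suc k \<in> - {Suc i, Suc j}} = - {i, j}" by auto
  then show "nths (y # ys) (- {0}) = ys" "nths (y # ys) (- {Suc i}) = y # nths ys (- {i})"
    "nths (y # ys) (- {0, Suc i}) = nths ys (- {i})"
    "nths (y # ys) (- {Suc i, Suc j}) = y # nths ys (- {i, j})"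
    by (simp_all add: nths_Cons nths_all[of ys UNIV])
qed

text \<open>\<open>Hom_wedge\<close> in curried form: contraction with the first argument stays
  inside the notion, as inductions over the arguments require. Asking for vanishing on equal
  neighbours at the head is enough, since the recursion repeats the demand for every tail.\<close>

primrec alternating ::
  "('k::field \<Rightarrow> 'a::ab_group_add \<Rightarrow> 'a) \<Rightarrow> ('k \<Rightarrow> 'b::ab_group_add \<Rightarrow> 'b) \<Rightarrow> nat
    \<Rightarrow> ('a list \<Rightarrow> 'b) \<Rightarrow> bool" where
  "alternating s s' 0 \<phi> \<longleftrightarrow> (\<forall>xs. xs \<noteq> [] \<longrightarrow> \<phi> xs = 0)"
| "alternating s s' (Suc n) \<phi> \<longleftrightarrow> \<phi> [] = 0 \<and>
     (\<forall>ys. Vector_Spaces.linear s s' (\<lambda>x. \<phi> (x # ys))) \<and>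
     (\<forall>x ys. \<phi> (x # x # ys) = 0) \<and> (\<forall>x. alternating s s' n (\<lambda>ys. \<phi> (x # ys)))"

section \<open>Multilinear algebra of alternating maps\<close>

locale two_vector_spaces = A: vector_space sA + M: vector_space sM
  for sA :: "'k::field \<Rightarrow> 'a::ab_group_add \<Rightarrow> 'a" and sM :: "'k \<Rightarrow> 'm::ab_group_add \<Rightarrow> 'm"
begin

lemma linearI:
  assumes "\<And>x y. f (x + y) = f x + f y" "\<And>c x. f (sA c x) = sM c (f x)"
  shows "Vector_Spaces.linear sA sM f"
  using assms by unfold_locales auto

lemma linearD:
  assumes "Vector_Spaces.linear sA sM f"
  shows "f (x + y) = f x + f y" "f (sA c x) = sM c (f x)" "f 0 = 0" "f (- x) = - f x"
    "f (x - y) = f x - f y"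
proof -
  interpret f: Vector_Spaces.linear sA sM f by fact
  show "f (x + y) = f x + f y" "f (sA c x) = sM c (f x)" "f 0 = 0" "f (- x) = - f x"
    "f (x - y) = f x - f y"
    by (simp_all add: f.add f.scale f.zero f.neg f.diff)
qed

lemma linear_zero_fun: "Vector_Spaces.linear sA sM (\<lambda>x. 0)"
  by (rule linearI) simp_all

lemma linear_add_fun:
  assumes "Vector_Spaces.linear sA sM f" "Vector_Spaces.linear sA sM h"
  shows "Vector_Spaces.linear sA sM (\<lambda>x. f x + h x)"
  by (rule linearI) (simp_all add: linearD[OF assms(1)] linearD[OF assms(2)] M.scale_right_distrib)

lemma linear_scale_fun:
  assumes "Vector_Spaces.linear sA sM f"
  shows "Vector_Spaces.linear sA sM (\<lambda>x. sM c (f x))"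
  by (rule linearI) (simp_all add: linearD[OF assms] M.scale_right_distrib mult.commute)

lemma linear_uminus_fun:
  assumes "Vector_Spaces.linear sA sM f"
  shows "Vector_Spaces.linear sA sM (\<lambda>x. - f x)"
  using linear_scale_fun[OF assms, of "-1"] by simp

abbreviation "alt \<equiv> alternating sA sM"

lemma alt_zero [simp]: "alt n (\<lambda>xs. 0)"
  by (induction n) (auto intro!: linear_zero_fun)

lemma alt_add: "alt n \<phi> \<Longrightarrow> alt n \<psi> \<Longrightarrow> alt n (\<lambda>xs. \<phi> xs + \<psi> xs)"
  by (induction n arbitrary: \<phi> \<psi>) (auto intro!: linear_add_fun)

lemma alt_scale: "alt n \<phi> \<Longrightarrow> alt n (\<lambda>xs. sM c (\<phi> xs))"
  by (induction n arbitrary: \<phi>) (auto intro!: linear_scale_fun)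

lemma alt_uminus: "alt n \<phi> \<Longrightarrow> alt n (\<lambda>xs. - \<phi> xs)"
  using alt_scale[of n \<phi> "-1"] by simp

lemma alt_diff: "alt n \<phi> \<Longrightarrow> alt n \<psi> \<Longrightarrow> alt n (\<lambda>xs. \<phi> xs - \<psi> xs)"
  using alt_add[OF _ alt_uminus] by simp

lemma alt_length: "alt n \<phi> \<Longrightarrow> length xs \<noteq> n \<Longrightarrow> \<phi> xs = 0"
proof (induction n arbitrary: \<phi> xs)
  case (Suc n)
  show ?case
  proof (cases xs)
    case (Cons y ys)
    then show ?thesis using Suc.IH[of "\<lambda>ys. \<phi> (y # ys)" ys] Suc.prems by simp
  qed (use Suc.prems in simp)
qed simp

lemma alt_Cons: "alt n \<phi> \<Longrightarrow> alt (n - 1) (\<lambda>ys. \<phi> (x # ys))"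
  by (cases n) auto

lemma alt_linear_hd: "alt n \<phi> \<Longrightarrow> Vector_Spaces.linear sA sM (\<lambda>x. \<phi> (x # ys))"
  by (cases n) (auto intro!: linearI)

lemma alt_hd_eq: "alt n \<phi> \<Longrightarrow> \<phi> (x # x # ys) = 0"
  by (cases n) auto

text \<open>Polarization: in the expansion at two equal arguments x + y the diagonal terms
  vanish.\<close>

lemma alt_swap_hd:
  assumes "alt n \<phi>"
  shows "\<phi> (x # y # ys) = - \<phi> (y # x # ys)"
proof -
  note lin = linearD(1)[OF alt_linear_hd[OF assms]]
    linearD(1)[OF alt_linear_hd[OF alt_Cons[OF assms]]]
  have "\<phi> ((x + y) # (x + y) # ys)
      = (\<phi> (x # x # ys) + \<phi> (y # x # ys)) + (\<phi> (x # y # ys) + \<phi> (y # y # ys))"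
    by (simp only: lin)
  then show ?thesis by (simp add: alt_hd_eq[OF assms] eq_neg_iff_add_eq_0 add.commute)
qed

text \<open>Moving the entry at position i to the front takes i neighbour swaps. This converts the
  bracket terms of \<open>CE\<close>, which put the bracket first, into terms that replace an
  argument in place.\<close>

lemma alt_update:
  "alt n \<phi> \<Longrightarrow> i < length ys \<Longrightarrow> \<phi> (ys[i := z]) = sM ((-1) ^ i) (\<phi> (z # nths ys (- {i})))"
proof (induction i arbitrary: n \<phi> ys)
  case 0
  then show ?case by (cases ys) (simp_all add: nths_Cons_delete)
next
  case (Suc i)
  then obtain y zs where ys: "ys = y # zs" "i < length zs" by (cases ys) auto
  have "\<phi> (y # zs[i := z]) = sM ((-1) ^ i) (\<phi> (y # z # nths zs (- {i})))"
    using Suc.IH[OF alt_Cons[OF Suc.prems(1)] ys(2)] .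
  then show ?case
    by (simp add: ys nths_Cons_delete alt_swap_hd[OF Suc.prems(1), of y])
qed

lemma alt_linear_update:
  "alt n \<phi> \<Longrightarrow> i < length xs \<Longrightarrow> Vector_Spaces.linear sA sM (\<lambda>x. \<phi> (xs[i := x]))"
proof (induction xs arbitrary: i n \<phi>)
  case (Cons y ys)
  show ?case
  proof (cases i)
    case 0
    then show ?thesis using alt_linear_hd[OF Cons.prems(1)] by simp
  next
    case (Suc j)
    then show ?thesis using Cons.IH[OF alt_Cons[OF Cons.prems(1)], of j] Cons.prems(2) by simp
  qed
qed simp

lemma alt_repeated:
  "alt n \<phi> \<Longrightarrow> i < j \<Longrightarrow> j < length xs \<Longrightarrow> xs ! i = xs ! j \<Longrightarrow> \<phi> xs = 0"
proof (induction xs arbitrary: i j n \<phi>)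
  case (Cons y ys)
  obtain k where j: "j = Suc k" "k < length ys" using Cons.prems by (cases j) auto
  show ?case
  proof (cases i)
    case 0
    \<comment> \<open>Writing the repeated entry onto itself makes \<open>alt_update\<close>
      applicable, which brings it next to the y at the head.\<close>
    then have "ys[k := y] = ys" using Cons.prems j by (simp add: list_update_same_conv)
    then show ?thesis
      using alt_update[OF alt_Cons[OF Cons.prems(1)] j(2), of y y] alt_hd_eq[OF Cons.prems(1)]
      by simp
  next
    case (Suc l)
    then show ?thesis using Cons.IH[OF alt_Cons[OF Cons.prems(1)], of l k] Cons.prems j by simp
  qed
qed simp

text \<open>The bridge between the positional form, suited to equivariance under permutations, and
  the recursive form, suited to Cartan's formula.\<close>

lemma Hom_wedge_iff_alt: "\<phi> \<in> Hom_wedge sA sM n \<longleftrightarrow> alt n \<phi>"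
proof
  assume "alt n \<phi>"
  then show "\<phi> \<in> Hom_wedge sA sM n"
    by (auto simp: Hom_wedge_def alt_length intro: alt_linear_update alt_repeated)
next
  show "\<phi> \<in> Hom_wedge sA sM n \<Longrightarrow> alt n \<phi>"
  proof (induction n arbitrary: \<phi>)
    case 0
    then show ?case by (auto simp: Hom_wedge_def)
  next
    case (Suc n)
    have len: "\<phi> xs = 0" if "length xs \<noteq> Suc n" for xs
      using Suc.prems that by (auto simp: Hom_wedge_def)
    have lin: "Vector_Spaces.linear sA sM (\<lambda>x. \<phi> (xs[i := x]))"
      if "length xs = Suc n" "i < Suc n" for xs i
      using Suc.prems that by (auto simp: Hom_wedge_def)
    have rep: "\<phi> xs = 0" if "length xs = Suc n" "i < j" "j < Suc n" "xs ! i = xs ! j" for xs i j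
      using Suc.prems that by (auto simp: Hom_wedge_def)
    have "Vector_Spaces.linear sA sM (\<lambda>x. \<phi> (x # ys))" for ys
    proof (cases "length ys = n")
      case True
      then show ?thesis using lin[of "0 # ys" 0] by simp
    next
      case False
      then show ?thesis by (auto simp: len intro!: linearI)
    qed
    moreover have "\<phi> (x # x # ys) = 0" for x ys
      using len[of "x # x # ys"] rep[of "x # x # ys" 0 1] by fastforce
    moreover have "alt n (\<lambda>ys. \<phi> (x # ys))" for x
    proof (rule Suc.IH)
      show "(\<lambda>ys. \<phi> (x # ys)) \<in> Hom_wedge sA sM n"
        unfolding Hom_wedge_def
      proof (safe)
        fix xs :: "'a list" and i assume "i < length xs" "n = length xs"
        then show "Vector_Spaces.linear sA sM (\<lambda>y. \<phi> (x # xs[i := y]))"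
          using lin[of "x # xs" "Suc i"] by simp
      next
        fix xs :: "'a list" and i j assume "i < j" "j < length xs" "xs ! i = xs ! j" "n = length xs"
        then show "\<phi> (x # xs) = 0"
          using rep[of "x # xs" "Suc i" "Suc j"] by simp
      qed (simp add: len)
    qed
    ultimately show ?case by (simp add: len)
  qed
qed

text \<open>Transpositions generate the symmetric group, so it suffices to polarize in two
  positions.\<close>

lemma alt_permute:
  assumes "\<phi> \<in> Hom_wedge sA sM n" "\<sigma> permutes {..<n}" "length xs = n"
  shows "\<phi> (permute_list \<sigma> xs) = sM (of_int (sign \<sigma>)) (\<phi> xs)"
proof -
  have swap: "\<phi> (permute_list (transpose a b) xs) = - \<phi> xs"
    if ab: "a < n" "b < n" "a < b" and len: "length xs = n" for a b xs
  proof -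
    \<comment> \<open>All arguments except those at a and b are frozen; what remains is bilinear and
      zero on the diagonal, hence antisymmetric.\<close>
    define B where "B x y = \<phi> (xs[a := x, b := y])" for x y
    have lin2: "Vector_Spaces.linear sA sM (\<lambda>y. B x y)" for x
      using assms(1) ab len by (simp add: Hom_wedge_def B_def)
    have lin1: "Vector_Spaces.linear sA sM (\<lambda>x. B x y)" for y
    proof -
      have "B x y = \<phi> (xs[b := y, a := x])" for x
        using ab by (simp add: B_def list_update_swap)
      then show ?thesis
        using assms(1) ab len by (simp add: Hom_wedge_def)
    qed
    have diag: "B x x = 0" for x
      using assms(1) ab len by (auto simp: Hom_wedge_def B_def)
    have "B (x + y) (x + y) = B x x + B y x + (B x y + B y y)" for x y
      by (simp only: linearD(1)[OF lin1] linearD(1)[OF lin2])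
    then have "B x y + B y x = 0" for x y
      using diag by (metis add.commute add.left_neutral)
    then have anti: "B y x = - B x y" for x y
      by (metis add_eq_0_iff)
    have "permute_list (transpose a b) xs = xs[a := xs ! b, b := xs ! a]"
      using ab len by (intro nth_equalityI)
        (auto simp: permute_list_def nth_list_update transpose_def)
    then show ?thesis
      using anti[of "xs ! a" "xs ! b"] ab len by (simp add: B_def)
  qed
  have swap': "\<phi> (permute_list (transpose a b) xs) = - \<phi> xs"
    if "a < n" "b < n" "a \<noteq> b" "length xs = n" for a b xs
    using swap[of a b xs] swap[of b a xs] that by (cases "a < b") (auto simp: transpose_commute)
  show ?thesis using assms(2) finite_lessThan assms(3)
  proof (induction arbitrary: xs rule: permutes_induct)
    case id
    then show ?case by simp
  next
    case (swap a b p)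
    have "permutation p" using swap.hyps by (auto simp: permutation_permutes)
    then have sg: "sign (transpose a b \<circ> p) = - sign p"
      using swap.hyps by (simp add: sign_compose permutation_swap_id sign_swap_id)
    have pl: "permute_list (transpose a b \<circ> p) xs
        = permute_list p (permute_list (transpose a b) xs)"
      using swap by (intro permute_list_compose) auto
    show ?case
      unfolding sg pl
      using swap.IH[of "permute_list (transpose a b) xs"] swap'[of a b xs] swap.hyps swap.prems
      by simp
  qed
qed

end

section \<open>Cartan calculus with coefficients in a module\<close>

lemma (in lie_algebra) bracket_swap: "bracket x y = - bracket y x"
proof -
  interpret two_vector_spaces scale scale ..
  have "bracket (x + y) (x + y) = bracket x x + bracket y x + (bracket x y + bracket y y)"
    by (simp only: linearD[OF bracket_linear_left] linearD[OF bracket_linear_right])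
  then show ?thesis by (simp add: bracket_self eq_neg_iff_add_eq_0 add.commute)
qed

text \<open>One setting for the three coefficient modules: U and V with their adjoint actions, and V
  as a U-module through g.\<close>

locale lie_module = lie_algebra sA br + two_vector_spaces sA sM
  for sA :: "'k::field \<Rightarrow> 'a::ab_group_add \<Rightarrow> 'a" and br :: "'a \<Rightarrow> 'a \<Rightarrow> 'a"
    and sM :: "'k \<Rightarrow> 'm::ab_group_add \<Rightarrow> 'm" +
  fixes act :: "'a \<Rightarrow> 'm \<Rightarrow> 'm"
  assumes act_linear_left: "Vector_Spaces.linear sA sM (\<lambda>x. act x m)"
    and act_linear_right: "Vector_Spaces.linear sM sM (\<lambda>m. act x m)"
    and act_bracket: "act (br x y) m = act x (act y m) - act y (act x m)"
begin

interpretation AA: two_vector_spaces sA sA ..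
interpretation MM: two_vector_spaces sM sM ..

lemmas act_simps = linearD[OF act_linear_left] MM.linearD[OF act_linear_right]
lemmas br_simps = AA.linearD[OF bracket_linear_left] AA.linearD[OF bracket_linear_right]

abbreviation "d \<equiv> CE sM br act"

text \<open>With s = i + 1 and t = j + 1 the exponent s + t - 1 becomes i + j + 1.\<close>

lemma CE_0_based:
  "d \<phi> xs =
     (\<Sum>i<length xs. sM ((-1) ^ Suc i) (act (xs ! i) (\<phi> (nths xs (- {i}))))) +
     (\<Sum>i<length xs. \<Sum>j\<in>{i<..<length xs}.
        sM ((-1) ^ Suc (i + j)) (\<phi> (br (xs ! i) (xs ! j) # nths xs (- {i, j}))))"
proof -
  have shift: "(\<Sum>s\<in>{Suc a..length xs}. h s) = (\<Sum>i\<in>{a..<length xs}. h (Suc i))" for a and h :: "nat \<Rightarrow> 'm"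
    by (simp only: sum.shift_bounds_Suc_ivl flip: atLeastLessThanSuc_atLeastAtMost)
  have iv: "{s<..length xs} = {Suc s..length xs}" "{s<..<length xs} = {Suc s..<length xs}" for s by auto
  show ?thesis
    unfolding CE_def iv One_nat_def shift by (simp add: lessThan_atLeast0)
qed

lemma CE_Nil: "d \<phi> [] = 0"
  by (simp add: CE_0_based)

text \<open>The terms that involve x are split off. In the others the action terms change sign
  because one index shifts, and the bracket terms, whose two shifts cancel, change sign because x is
  moved in front of the bracket. Both therefore assemble to minus the differential of the
  contraction.\<close>

lemma CE_Cons:
  assumes "alt n \<phi>"
  shows "d \<phi> (x # ys) = - act x (\<phi> ys)
     + (\<Sum>j<length ys. \<phi> (ys[j := br x (ys ! j)])) - d (\<lambda>ys. \<phi> (x # ys)) ys"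
proof -
  have iv: "{0<..<Suc m} = Suc ` {..<m}" "{Suc i<..<Suc m} = Suc ` {i<..<m}" for i m
    by (auto simp: image_Suc_lessThan intro: Suc_less_SucD)
       (metis Suc_lessE Suc_less_eq greaterThanLessThan_iff image_eqI)
  have s1: "(\<Sum>j\<in>{0<..<Suc m}. h j) = (\<Sum>j<m. h (Suc j))"
    "(\<Sum>j\<in>{Suc i<..<Suc m}. h j) = (\<Sum>j\<in>{i<..<m}. h (Suc j))" for h :: "nat \<Rightarrow> 'm" and i m
    by (simp_all add: iv sum.reindex)
  show ?thesis
    unfolding CE_0_based length_Cons sum.lessThan_Suc_shift
    by (simp add: s1 nths_Cons_delete alt_update[OF assms] alt_swap_hd[OF assms, of _ x]
         sum_negf)
qed

text \<open>The Lie derivative \<open>L\<^sub>x\<close>, that is, the natural action of x on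
  multilinear maps into the module.\<close>

definition Lie :: "'a \<Rightarrow> ('a list \<Rightarrow> 'm) \<Rightarrow> 'a list \<Rightarrow> 'm" where
  "Lie x \<phi> ys = act x (\<phi> ys) - (\<Sum>i<length ys. \<phi> (ys[i := br x (ys ! i)]))"

lemma Cartan: "alt n \<phi> \<Longrightarrow> d \<phi> (x # ys) = - Lie x \<phi> ys - d (\<lambda>ys. \<phi> (x # ys)) ys"
  by (simp add: CE_Cons Lie_def)

lemma Lie_Nil: "Lie x \<phi> [] = act x (\<phi> [])"
  by (simp add: Lie_def)

text \<open>The commutator of the Lie derivative along x with contraction by y is contraction by the
  bracket of x and y.\<close>

lemma Lie_Cons: "Lie x \<phi> (y # ys) = Lie x (\<lambda>ys. \<phi> (y # ys)) ys - \<phi> (br x y # ys)"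
  by (simp only: Lie_def length_Cons sum.lessThan_Suc_shift) simp

lemma Lie_zero [simp]: "Lie x (\<lambda>xs. 0) ys = 0"
  by (simp add: Lie_def act_simps)

lemma Lie_add: "Lie x (\<lambda>xs. \<phi> xs + \<psi> xs) ys = Lie x \<phi> ys + Lie x \<psi> ys"
  by (simp add: Lie_def act_simps sum.distrib)

lemma Lie_scale: "Lie x (\<lambda>xs. sM c (\<phi> xs)) ys = sM c (Lie x \<phi> ys)"
  by (simp add: Lie_def act_simps M.scale_sum_right M.scale_right_diff_distrib)

lemma Lie_uminus: "Lie x (\<lambda>xs. - \<phi> xs) ys = - Lie x \<phi> ys"
  using Lie_scale[of x "-1"] by simp

lemma Lie_diff: "Lie x (\<lambda>xs. \<phi> xs - \<psi> xs) ys = Lie x \<phi> ys - Lie x \<psi> ys"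
  using Lie_add[of x \<phi> "\<lambda>xs. - \<psi> xs"] by (simp add: Lie_uminus)

lemma Lie_linear:
  assumes "alt n \<phi>"
  shows "Vector_Spaces.linear sA sM (\<lambda>x. Lie x \<phi> ys)"
proof -
  have lin: "Vector_Spaces.linear sA sM (\<lambda>x. \<phi> (ys[i := x]))" if "i < length ys" for i
    using alt_linear_update[OF assms that] .
  show ?thesis
    by (rule linearI) (simp_all add: Lie_def act_simps br_simps linearD[OF lin] sum.distrib
        M.scale_sum_right M.scale_right_diff_distrib)
qed

lemma Lie_alt: "alt n \<phi> \<Longrightarrow> alt n (Lie x \<phi>)"
proof (induction n arbitrary: \<phi>)
  case 0
  then show ?case by (auto simp: Lie_def act_simps)
next
  case (Suc n)
  note lin = linearD[OF alt_linear_hd[OF Suc.prems]]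
  have "alt n (\<lambda>ys. Lie x \<phi> (y # ys))" for y
    unfolding Lie_Cons using Suc.prems by (auto intro!: alt_diff Suc.IH)
  moreover have "Vector_Spaces.linear sA sM (\<lambda>y. Lie x \<phi> (y # ys))" for ys
    by (rule linearI)
      (simp_all add: Lie_Cons lin br_simps Lie_add Lie_scale M.scale_right_diff_distrib)
  moreover have "Lie x \<phi> (y # y # ys) = 0" for y ys
    using alt_swap_hd[OF Suc.prems, of y "br x y" ys]
    by (simp add: Lie_Cons alt_hd_eq[OF Suc.prems])
  ultimately show ?case using Suc.prems by (simp add: Lie_Nil act_simps)
qed

text \<open>Lie derivatives represent the Lie algebra. Peeling off one argument by
  \<open>Lie_Cons\<close> leaves the same claim for the contraction and correction terms that match
  by the Jacobi identity.\<close>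

lemma Lie_bracket:
  "alt n \<phi> \<Longrightarrow> Lie (br x y) \<phi> ys = Lie x (Lie y \<phi>) ys - Lie y (Lie x \<phi>) ys"
proof (induction ys arbitrary: n \<phi>)
  case Nil
  show ?case by (simp add: Lie_Nil act_bracket)
next
  case (Cons z zs)
  note lin = linearD[OF alt_linear_hd[OF Cons.prems]]
  have "br (br x y) z + br y (br x z) - br x (br y z) = - (br x (br y z) + br y (br z x) + br z (br x y))"
    using bracket_swap[of "br x y" z] bracket_swap[of x z] by (simp add: br_simps)
  then have "br (br x y) z = br x (br y z) - br y (br x z)"
    by (simp add: jacobi) (simp add: algebra_simps eq_diff_eq)
  then have "\<phi> (br (br x y) z # zs) = \<phi> (br x (br y z) # zs) - \<phi> (br y (br x z) # zs)"
    by (simp add: lin)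
  moreover have "Lie x (\<lambda>ys. Lie y \<phi> (z # ys)) zs =
      Lie x (Lie y (\<lambda>ys. \<phi> (z # ys))) zs - Lie x (\<lambda>ys. \<phi> (br y z # ys)) zs" for x y
    by (simp add: Lie_Cons Lie_diff)
  ultimately show ?case
    by (simp add: Lie_Cons[of _ _ z] Lie_diff Cons.IH[OF alt_Cons[OF Cons.prems]] Lie_Cons)
qed

lemma CE_zero [simp]: "d (\<lambda>xs. 0) ys = 0"
  by (simp add: CE_0_based act_simps)

lemma CE_add: "d (\<lambda>xs. \<phi> xs + \<psi> xs) ys = d \<phi> ys + d \<psi> ys"
  by (simp add: CE_0_based act_simps sum.distrib sum_subtractf sum_negf M.scale_right_distrib)

lemma CE_scale: "d (\<lambda>xs. sM c (\<phi> xs)) ys = sM c (d \<phi> ys)"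
  by (simp add: CE_0_based act_simps M.scale_sum_right M.scale_right_distrib mult.commute)

lemma CE_uminus: "d (\<lambda>xs. - \<phi> xs) ys = - d \<phi> ys"
  using CE_scale[of "-1"] by simp

lemma CE_diff: "d (\<lambda>xs. \<phi> xs - \<psi> xs) ys = d \<phi> ys - d \<psi> ys"
  using CE_add[of \<phi> "\<lambda>xs. - \<psi> xs"] by (simp add: CE_uminus)

lemma CE_alt: "alt n \<phi> \<Longrightarrow> alt (Suc n) (d \<phi>)"
proof (induction n arbitrary: \<phi>)
  case 0
  then have [simp]: "(\<lambda>ys. \<phi> (x # ys)) = (\<lambda>ys. 0)" for x by auto
  show ?case
    using Lie_alt[OF 0]
    by (auto simp: CE_Nil Cartan[OF 0] intro!: linear_uminus_fun Lie_linear[OF 0])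
next
  case (Suc n)
  note C = Cartan[OF Suc.prems]
  note lin = linearD[OF alt_linear_hd[OF Suc.prems]]
  have "alt (Suc n) (\<lambda>ys. d \<phi> (x # ys))" for x
    unfolding C using Suc.prems Suc.IH[of "\<lambda>ys. \<phi> (x # ys)"]
    by (intro alt_diff alt_uminus Lie_alt) auto
  moreover have "Vector_Spaces.linear sA sM (\<lambda>x. d \<phi> (x # ys))" for ys
    unfolding C by (rule linearI)
      (simp_all add: lin CE_add CE_scale linearD[OF Lie_linear[OF Suc.prems]] M.scale_right_diff_distrib)
  \<comment> \<open>Applying Cartan's formula twice gives the Lie derivative of the contraction by x
    with both signs; what is left contains \<open>br x x\<close> or a repeated argument.\<close>
  moreover have "d \<phi> (x # x # ys) = 0" for x ys
    using Cartan[OF alt_Cons[OF Suc.prems], of x x ys]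
    by (simp add: C Lie_Cons alt_hd_eq[OF Suc.prems] bracket_self lin)
  ultimately show ?case
    by (simp only: alternating.simps(2)[of _ _ "Suc n"]) (simp add: CE_Nil)
qed

text \<open>After contraction with y, Cartan's formula reduces the claim, up to the induction
  hypothesis, to equality of the commutator of \<open>Lie x\<close> and \<open>Lie y\<close> with
  \<open>Lie (br x y)\<close>.\<close>

lemma CE_Lie: "alt n \<phi> \<Longrightarrow> d (Lie x \<phi>) ys = Lie x (d \<phi>) ys"
proof (induction ys arbitrary: n \<phi>)
  case Nil
  show ?case by (simp add: CE_Nil Lie_Nil act_simps)
next
  case (Cons y ys)
  note C = Cartan[OF Cons.prems]
  note C' = Cartan[OF Lie_alt[OF Cons.prems]]
  have "Lie x (\<lambda>ys. d \<phi> (y # ys)) ys = - Lie x (Lie y \<phi>) ys - Lie x (d (\<lambda>ys. \<phi> (y # ys))) ys"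
    by (simp add: C Lie_diff Lie_uminus)
  moreover have "d (\<lambda>ys. Lie x \<phi> (y # ys)) ys = Lie x (d (\<lambda>ys. \<phi> (y # ys))) ys - d (\<lambda>ys. \<phi> (br x y # ys)) ys"
    by (simp add: Lie_Cons CE_diff Cons.IH[OF alt_Cons[OF Cons.prems]])
  ultimately show ?case
    by (simp add: Lie_Cons[of _ "d \<phi>"] C C' Lie_bracket[OF Cons.prems])
qed

text \<open>Contracted with y, the square of d is \<open>d (Lie y \<phi>) - Lie y (d \<phi>)\<close>
  plus the square applied to the contraction: the former is zero by \<open>CE_Lie\<close>, the
  latter by induction.\<close>

lemma CE_CE: "alt n \<phi> \<Longrightarrow> d (d \<phi>) ys = 0"
proof (induction ys arbitrary: n \<phi>)
  case Nil
  show ?case by (simp add: CE_Nil)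
next
  case (Cons y ys)
  have "d (\<lambda>ys. d \<phi> (y # ys)) ys = - d (Lie y \<phi>) ys - d (d (\<lambda>ys. \<phi> (y # ys))) ys"
    by (simp add: Cartan[OF Cons.prems] CE_diff CE_uminus)
  then show ?case
    by (simp add: Cartan[OF CE_alt[OF Cons.prems]] CE_Lie[OF Cons.prems]
        Cons.IH[OF alt_Cons[OF Cons.prems]])
qed

end

section \<open>Cochains of the deformation complex as alternating maps\<close>

text \<open>A concrete vector space standing for one colour of T: U for \<open>Black\<close>, V for
  \<open>White\<close>. Statements about operations can then be proved once and read off for each
  choice of input and output colour.\<close>

locale chart =
  U: vector_space sU + V: vector_space sV + S: vector_space s
  for sU :: "'k::field_char_0 \<Rightarrow> 'u::ab_group_add \<Rightarrow> 'u"
    and sV :: "'k \<Rightarrow> 'v::ab_group_add \<Rightarrow> 'v"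
    and s :: "'k \<Rightarrow> 'a::ab_group_add \<Rightarrow> 'a" +
  fixes c :: colour and emb :: "'a \<Rightarrow> 'u \<times> 'v" and proj :: "'u \<times> 'v \<Rightarrow> 'a"
  assumes range_emb: "T_part c = range emb"
    and proj_emb [simp]: "proj (emb x) = x"
    and emb_add: "emb (x + y) = emb x + emb y"
    and emb_scale: "emb (s k x) = scale_T sU sV k (emb x)"
    and proj_add: "proj (t + t') = proj t + proj t'"
    and proj_scale: "proj (scale_T sU sV k t) = s k (proj t)"
begin

lemma emb_in [simp]: "emb x \<in> T_part c"
  by (simp add: range_emb)

lemma emb_proj: "t \<in> T_part c \<Longrightarrow> emb (proj t) = t"
  by (auto simp: range_emb)

lemma emb_0 [simp]: "emb 0 = 0"
  using emb_add[of 0 0] by simp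

lemma proj_0 [simp]: "proj 0 = 0"
  using proj_emb[of 0] by simp

lemma coloured_iff: "coloured (replicate n c) xs \<longleftrightarrow> (\<exists>as. length as = n \<and> xs = map emb as)"
proof
  assume *: "coloured (replicate n c) xs"
  then have "x \<in> T_part c" if "x \<in> set xs" for x
    using that by (auto simp: coloured_def list_all2_conv_all_nth in_set_conv_nth)
  then have "xs = map emb (map proj xs)"
    by (simp add: emb_proj map_idI o_def)
  moreover have "length xs = n"
    using * by (auto simp: coloured_def dest: list_all2_lengthD)
  ultimately show "\<exists>as. length as = n \<and> xs = map emb as" by (metis length_map)
qed (auto simp: coloured_def list_all2_conv_all_nth)

lemma coloured_map_emb [simp]: "coloured (replicate n c) (map emb as) \<longleftrightarrow> length as = n"
  by (auto simp: coloured_iff) (metis length_map)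

lemma map_proj_emb [simp]: "map (proj \<circ> emb) as = as"
  by (simp add: o_def)

lemma vector_space_scale_T: "vector_space (scale_T sU sV)"
  by unfold_locales
    (auto simp: scale_T_def U.scale_right_distrib V.scale_right_distrib
      U.scale_left_distrib V.scale_left_distrib)

end

text \<open>The inverse direction of one component of the identification. The value 0 off correctly
  coloured lists is what \<open>End_T\<close> prescribes.\<close>

definition lift_op ::
  "nat \<Rightarrow> colour \<Rightarrow> ('u::zero \<times> 'v::zero \<Rightarrow> 'a) \<Rightarrow> ('b \<Rightarrow> 'u \<times> 'v) \<Rightarrow> ('a list \<Rightarrow> 'b)
    \<Rightarrow> ('u, 'v) op" where
  "lift_op n c proj emb \<phi> xs = (if coloured (replicate n c) xs then emb (\<phi> (map proj xs)) else 0)"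

lemma scale_T_0:
  assumes "vector_space sU" "vector_space sV"
  shows "scale_T sU sV k 0 = 0"
proof -
  interpret U: vector_space sU by fact
  interpret V: vector_space sV by fact
  show ?thesis by (simp add: scale_T_def zero_prod_def)
qed

locale two_charts =
  A: chart sU sV sA a embA projA + B: chart sU sV sB b embB projB
  for sU :: "'k::field_char_0 \<Rightarrow> 'u::ab_group_add \<Rightarrow> 'u"
    and sV :: "'k \<Rightarrow> 'v::ab_group_add \<Rightarrow> 'v"
    and sA :: "'k \<Rightarrow> 'a::ab_group_add \<Rightarrow> 'a" and a embA projA
    and sB :: "'k \<Rightarrow> 'b::ab_group_add \<Rightarrow> 'b" and b embB projB
begin

sublocale two_vector_spaces sA sB ..

lemma lift_op_map: "lift_op n a projA embB \<phi> (map embA as) = (if length as = n then embB (\<phi> as) else 0)"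
  by (simp add: lift_op_def)

lemma lift_op_End_T:
  assumes "\<phi> \<in> Hom_wedge sA sB n"
  shows "lift_op n a projA embB \<phi> \<in> End_T sU sV (replicate n a) b"
  unfolding End_T_def
proof (safe)
  fix xs :: "('u \<times> 'v) list" and i
  assume "coloured (replicate n a) xs" "i < length (replicate n a)"
  then obtain as where as: "length as = n" "xs = map embA as" "i < n"
    by (auto simp: A.coloured_iff)
  have eq: "lift_op n a projA embB \<phi> (xs[i := embA x]) = embB (\<phi> (as[i := x]))" for x
    using as by (simp add: lift_op_map flip: map_update)
  have lin: "Vector_Spaces.linear sA sB (\<lambda>x. \<phi> (as[i := x]))"
    using assms as by (auto simp: Hom_wedge_def)
  have "a = replicate n a ! i" using as by simp
  moreover have "linear_between (scale_T sU sV) (T_part a) (scale_T sU sV) (T_part b)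
      (\<lambda>x. lift_op n a projA embB \<phi> (xs[i := x]))"
    unfolding linear_between_def A.range_emb
    by (auto simp: eq linearD[OF lin] B.emb_add B.emb_scale simp flip: A.emb_add A.emb_scale)
  ultimately show "linear_between (scale_T sU sV) (T_part (replicate n a ! i)) (scale_T sU sV) (T_part b)
      (\<lambda>x. lift_op n a projA embB \<phi> (xs[i := x]))" by simp
qed (auto simp: lift_op_def)

lemma lift_op_permute:
  assumes "\<phi> \<in> Hom_wedge sA sB n" "\<sigma> permutes {..<n}" "length xs = n"
  shows "lift_op n a projA embB \<phi> (permute_list \<sigma> xs)
    = scale_T sU sV (of_int (sign \<sigma>)) (lift_op n a projA embB \<phi> xs)"
proof (cases "coloured (replicate n a) xs")
  case True
  then obtain as where as: "length as = n" "xs = map embA as"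
    by (auto simp: A.coloured_iff)
  have "permute_list \<sigma> (map embA as) = map embA (permute_list \<sigma> as)"
    using assms as by (simp add: permute_list_map)
  then show ?thesis
    using assms as by (simp add: lift_op_map alt_permute[OF assms(1,2)] B.emb_scale)
next
  case False
  \<comment> \<open>All inputs have the same colour, so being coloured depends only on the length
    and the set of entries, which a permutation preserves.\<close>
  have "\<not> coloured (replicate n a) (permute_list \<sigma> xs)"
  proof
    assume "coloured (replicate n a) (permute_list \<sigma> xs)"
    then obtain bs where bs: "permute_list \<sigma> xs = map embA bs" by (auto simp: A.coloured_iff)
    have "set xs = set (permute_list \<sigma> xs)" using assms by simp
    then have "set xs \<subseteq> T_part a" by (auto simp: bs)
    then have "coloured (replicate n a) xs"
      using assms(3) by (auto simp: coloured_def list_all2_conv_all_nth)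
    with False show False by simp
  qed
  then show ?thesis
    using False by (simp add: lift_op_def scale_T_0 A.U.vector_space_axioms A.V.vector_space_axioms)
qed

lemma End_T_map:
  assumes "t \<in> End_T sU sV (replicate n a) b"
  shows "t (map embA as) = embB (projB (t (map embA as)))"
proof (cases "length as = n")
  case True
  then have "t (map embA as) \<in> T_part b" using assms by (auto simp: End_T_def)
  then show ?thesis by (simp add: B.emb_proj)
next
  case False
  then have "t (map embA as) = 0" using assms by (auto simp: End_T_def)
  then show ?thesis by simp
qed

lemma lift_op_proj:
  assumes "t \<in> End_T sU sV (replicate n a) b"
  shows "lift_op n a projA embB (\<lambda>as. projB (t (map embA as))) = t"
proof
  fix xs
  show "lift_op n a projA embB (\<lambda>as. projB (t (map embA as))) xs = t xs"
  proof (cases "coloured (replicate n a) xs")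
    case True
    then show ?thesis
      using End_T_map[OF assms] by (auto simp: A.coloured_iff lift_op_map)
  next
    case False
    then show ?thesis using assms by (auto simp: lift_op_def End_T_def)
  qed
qed

text \<open>Characteristic 0 enters here: a transposition of two equal inputs fixes the list but has
  sign -1, so twice the value is zero.\<close>

lemma proj_in_Hom_wedge:
  assumes t: "t \<in> End_T sU sV (replicate n a) b"
    and perm: "\<And>\<sigma> xs. \<sigma> permutes {..<n} \<Longrightarrow> length xs = n \<Longrightarrow>
      t (permute_list \<sigma> xs) = scale_T sU sV (of_int (sign \<sigma>)) (t xs)"
  shows "(\<lambda>as. projB (t (map embA as))) \<in> Hom_wedge sA sB n"
  unfolding Hom_wedge_def
proof (safe)
  fix as :: "'a list" assume "length as \<noteq> n"
  then show "projB (t (map embA as)) = 0" using t by (auto simp: End_T_def)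
next
  fix as :: "'a list" and i assume as: "i < length as" "n = length as"
  then have "linear_between (scale_T sU sV) (T_part a) (scale_T sU sV) (T_part b)
      (\<lambda>x. t ((map embA as)[i := x]))"
    using t by (auto simp: End_T_def)
  then have "t ((map embA as)[i := embA x + embA y])
        = t ((map embA as)[i := embA x]) + t ((map embA as)[i := embA y])"
      "t ((map embA as)[i := scale_T sU sV k (embA x)])
        = scale_T sU sV k (t ((map embA as)[i := embA x]))" for x y k
    by (auto simp: linear_between_def)
  then show "Vector_Spaces.linear sA sB (\<lambda>x. projB (t (map embA (as[i := x]))))"
    by (intro linearI)
      (auto simp: map_update A.emb_add A.emb_scale B.proj_add B.proj_scale)
next
  fix as :: "'a list" and i j
  assume as: "i < j" "j < length as" "as ! i = as ! j" "n = length as"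
  define \<tau> where "\<tau> = transpose i j"
  have \<tau>: "\<tau> permutes {..<n}" unfolding \<tau>_def using as by (intro permutes_swap_id) auto
  have "permute_list \<tau> (map embA as) = map embA as"
    using as by (intro nth_equalityI) (auto simp: permute_list_def \<tau>_def transpose_def)
  moreover have "sign \<tau> = -1" using as by (simp add: \<tau>_def sign_swap_id)
  ultimately have "t (map embA as) = scale_T sU sV (-1) (t (map embA as))"
    using perm[OF \<tau>, of "map embA as"] as by simp
  then have "projB (t (map embA as)) = projB (scale_T sU sV (-1) (t (map embA as)))" by simp
  then have eq: "projB (t (map embA as)) = - projB (t (map embA as))"
    by (simp add: B.proj_scale)
  have "sB 2 (projB (t (map embA as))) = projB (t (map embA as)) + projB (t (map embA as))"
    by (metis B.S.scale_left_distrib B.S.scale_one one_add_one)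
  also have "\<dots> = 0" using eq by (metis add.right_inverse)
  finally show "projB (t (map embA as)) = 0" by simp
qed

lemma proj_lift_op:
  assumes "\<phi> \<in> Hom_wedge sA sB n"
  shows "(\<lambda>as. projB (lift_op n a projA embB \<phi> (map embA as))) = \<phi>"
  using assms by (auto simp: lift_op_map Hom_wedge_def)

end

text \<open>The inverse of \<open>identification p\<close>, which makes every computation with
  cochains one with explicit alternating maps.\<close>

definition lift_cochain :: "nat \<Rightarrow> ('u::zero, 'v::zero) cochain \<Rightarrow> gen \<Rightarrow> ('u, 'v) op" where
  "lift_cochain p = (\<lambda>(xU, xV, xg) \<xi>.
     if \<xi> = Mu (p + 1) then lift_op (p + 1) Black fst (\<lambda>u. (u, 0)) xU
     else if \<xi> = Nu (p + 1) then lift_op (p + 1) White snd (\<lambda>v. (0, v)) xV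
     else if \<xi> = F p then lift_op p Black fst (\<lambda>v. (0, v)) xg
     else 0)"

lemma black_chart:
  fixes sU :: "'k::field_char_0 \<Rightarrow> 'u::ab_group_add \<Rightarrow> 'u"
    and sV :: "'k \<Rightarrow> 'v::ab_group_add \<Rightarrow> 'v"
  assumes "vector_space sU" "vector_space sV"
  shows "chart sU sV sU Black (\<lambda>u. (u, 0)) fst"
proof -
  interpret U: vector_space sU by fact
  interpret V: vector_space sV by fact
  show ?thesis by unfold_locales (auto simp: scale_T_def)
qed

lemma white_chart:
  fixes sU :: "'k::field_char_0 \<Rightarrow> 'u::ab_group_add \<Rightarrow> 'u"
    and sV :: "'k \<Rightarrow> 'v::ab_group_add \<Rightarrow> 'v"
  assumes "vector_space sU" "vector_space sV"
  shows "chart sU sV sV White (\<lambda>v. (0, v)) snd"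
proof -
  interpret U: vector_space sU by fact
  interpret V: vector_space sV by fact
  show ?thesis by unfold_locales (auto simp: scale_T_def)
qed

locale U_V_spaces = U: vector_space sU + V: vector_space sV
  for sU :: "'k::field_char_0 \<Rightarrow> 'u::ab_group_add \<Rightarrow> 'u"
    and sV :: "'k \<Rightarrow> 'v::ab_group_add \<Rightarrow> 'v"
begin

sublocale Bl: chart sU sV sU Black "\<lambda>u. (u, 0)" fst
  by (rule black_chart) unfold_locales

sublocale Wh: chart sU sV sV White "\<lambda>v. (0, v)" snd
  by (rule white_chart) unfold_locales

sublocale UU: two_charts sU sV sU Black "\<lambda>u. (u, 0)" fst sU Black "\<lambda>u. (u, 0)" fst ..
sublocale VV: two_charts sU sV sV White "\<lambda>v. (0, v)" snd sV White "\<lambda>v. (0, v)" snd ..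
sublocale UV: two_charts sU sV sU Black "\<lambda>u. (u, 0)" fst sV White "\<lambda>v. (0, v)" snd ..

lemma C_LieD:
  assumes "\<theta> \<in> C_Lie sU sV p"
  shows "\<theta> (Mu n) \<in> End_T sU sV (replicate n Black) Black"
    "\<theta> (Nu n) \<in> End_T sU sV (replicate n White) White"
    "\<theta> (F n) \<in> End_T sU sV (replicate n Black) White"
    "\<And>\<sigma> xs. \<sigma> permutes {..<arity \<xi>} \<Longrightarrow> length xs = arity \<xi> \<Longrightarrow>
       \<theta> \<xi> (permute_list \<sigma> xs) = scale_T sU sV (of_int (sign \<sigma>)) (\<theta> \<xi> xs)"
    "\<xi> \<noteq> Mu (p + 1) \<Longrightarrow> \<xi> \<noteq> Nu (p + 1) \<Longrightarrow> \<xi> \<noteq> F p \<Longrightarrow> \<theta> \<xi> = 0"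
proof -
  have End: "\<theta> \<xi> \<in> End_T sU sV (in_colours \<xi>) (out_colour \<xi>)" for \<xi>
    using assms by (simp add: C_Lie_def)
  show "\<theta> (Mu n) \<in> End_T sU sV (replicate n Black) Black"
    "\<theta> (Nu n) \<in> End_T sU sV (replicate n White) White"
    "\<theta> (F n) \<in> End_T sU sV (replicate n Black) White"
    using End[of "Mu n"] End[of "Nu n"] End[of "F n"] by simp_all
  show "\<And>\<sigma> xs. \<sigma> permutes {..<arity \<xi>} \<Longrightarrow> length xs = arity \<xi> \<Longrightarrow>
       \<theta> \<xi> (permute_list \<sigma> xs) = scale_T sU sV (of_int (sign \<sigma>)) (\<theta> \<xi> xs)"
    using assms by (simp add: C_Lie_def)
  assume *: "\<xi> \<noteq> Mu (p + 1)" "\<xi> \<noteq> Nu (p + 1)" "\<xi> \<noteq> F p"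
  have "\<xi> \<notin> generators \<or> deg \<xi> \<noteq> int p - 1"
    using * by (cases \<xi>) (auto simp: generators_def)
  then show "\<theta> \<xi> = 0" using assms unfolding C_Lie_def by blast
qed

lemma identification_in_Lam:
  assumes "\<theta> \<in> C_Lie sU sV p"
  shows "identification p \<theta> \<in> Lam sU sV (p + 1)"
  unfolding identification_def Lam_def
  using UU.proj_in_Hom_wedge[OF C_LieD(1)[OF assms]] VV.proj_in_Hom_wedge[OF C_LieD(2)[OF assms]]
    UV.proj_in_Hom_wedge[OF C_LieD(3)[OF assms]]
    C_LieD(4)[OF assms, of _ "Mu (p + 1)"] C_LieD(4)[OF assms, of _ "Nu (p + 1)"]
    C_LieD(4)[OF assms, of _ "F p"]
  by (simp del: replicate_Suc)

lemma lift_identification: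
  assumes "\<theta> \<in> C_Lie sU sV p"
  shows "lift_cochain p (identification p \<theta>) = \<theta>"
  unfolding identification_def lift_cochain_def
  using UU.lift_op_proj[OF C_LieD(1)[OF assms]] VV.lift_op_proj[OF C_LieD(2)[OF assms]]
    UV.lift_op_proj[OF C_LieD(3)[OF assms]] C_LieD(5)[OF assms]
  by (auto simp: fun_eq_iff)

lemma identification_lift:
  assumes "x \<in> Lam sU sV (p + 1)"
  shows "identification p (lift_cochain p x) = x"
  using assms UU.proj_lift_op[of _ "p + 1"] VV.proj_lift_op[of _ "p + 1"] UV.proj_lift_op[of _ p]
  by (auto simp: identification_def lift_cochain_def Lam_def)

lemma zero_in_End_T: "0 \<in> End_T sU sV cs d"
proof -
  have "0 \<in> T_part d" by (cases d) (auto simp: zero_prod_def)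
  then show ?thesis
    by (auto simp: End_T_def linear_between_def scale_T_0 U.vector_space_axioms V.vector_space_axioms)
qed

text \<open>The bound on p ensures that \<open>Mu (p + 1)\<close>, \<open>Nu (p + 1)\<close> and
  \<open>F p\<close> are generators; for p = 0 none of them is.\<close>

lemma lift_in_C_Lie:
  assumes "x \<in> Lam sU sV (p + 1)" "p \<ge> 1"
  shows "lift_cochain p x \<in> C_Lie sU sV p"
proof -
  obtain xU xV xg where x: "x = (xU, xV, xg)" by (cases x)
  have H: "xU \<in> Hom_wedge sU sU (p + 1)" "xV \<in> Hom_wedge sV sV (p + 1)" "xg \<in> Hom_wedge sU sV p"
    using assms by (auto simp: Lam_def x)
  have "lift_cochain p x \<xi> \<in> End_T sU sV (in_colours \<xi>) (out_colour \<xi>)" for \<xi>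
    using UU.lift_op_End_T[OF H(1)] VV.lift_op_End_T[OF H(2)] UV.lift_op_End_T[OF H(3)]
    by (auto simp: lift_cochain_def x zero_in_End_T)
  moreover have "lift_cochain p x \<xi> (permute_list \<sigma> xs)
      = scale_T sU sV (of_int (sign \<sigma>)) (lift_cochain p x \<xi> xs)"
    if "\<sigma> permutes {..<arity \<xi>}" "length xs = arity \<xi>" for \<xi> \<sigma> xs
    using UU.lift_op_permute[OF H(1), of \<sigma> xs] VV.lift_op_permute[OF H(2), of \<sigma> xs]
      UV.lift_op_permute[OF H(3), of \<sigma> xs] that
    by (auto simp: lift_cochain_def x scale_T_0 U.vector_space_axioms V.vector_space_axioms)
  moreover have "lift_cochain p x \<xi> = 0" if "\<xi> \<notin> generators \<or> deg \<xi> \<noteq> int p - 1" for \<xi>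
    using that assms(2) by (auto simp: lift_cochain_def x generators_def)
  ultimately show ?thesis unfolding C_Lie_def by blast
qed

end

section \<open>Sums over unshuffles\<close>

lemma nths_eq_map_filter: "nths xs A = map ((!) xs) (filter (\<lambda>i. i \<in> A) [0..<length xs])"
proof (induction xs rule: rev_induct)
  case (snoc x xs)
  have "map ((!) (xs @ [x])) (filter (\<lambda>i. i \<in> A) [0..<length xs])
      = map ((!) xs) (filter (\<lambda>i. i \<in> A) [0..<length xs])"
    by (auto simp: nth_append)
  then show ?case by (simp add: snoc nths_append nth_append)
qed simp

section \<open>Two-block unshuffles as subsets of positions, and their signs\<close>

lemma unshuffles_pair:
  "\<sigma> \<in> unshuffles [a, b] \<longleftrightarrow> \<sigma> permutes {..<a + b} \<and>
     strict_mono_on {0..<a} \<sigma> \<and> strict_mono_on {a..<a + b} \<sigma>"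
proof -
  have "(\<forall>i<2. P i) \<longleftrightarrow> P 0 \<and> P 1" for P :: "nat \<Rightarrow> bool"
    by (auto simp: less_2_cases_iff)
  then show ?thesis by (simp add: unshuffles_def block_start_def numeral_2_eq_2)
qed

text \<open>A strictly increasing list is determined by its set of entries, so the image of the
  first block fixes both halves of the unshuffle.\<close>

lemma unshuffle_map:
  assumes "\<sigma> \<in> unshuffles [a, b]"
  shows "map \<sigma> [0..<a] = filter (\<lambda>i. i \<in> \<sigma> ` {..<a}) [0..<a + b]"
    and "map \<sigma> [a..<a + b] = filter (\<lambda>i. i \<notin> \<sigma> ` {..<a}) [0..<a + b]"
proof -
  have p: "\<sigma> permutes {..<a + b}" and mono: "strict_mono_on {0..<a} \<sigma>" "strict_mono_on {a..<a + b} \<sigma>"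
    using assms by (auto simp: unshuffles_pair)
  have sorted: "sorted_wrt (<) (map \<sigma> [k..<l])" if "strict_mono_on {k..<l} \<sigma>" for k l
  proof -
    have "sorted_wrt (\<lambda>i j. \<sigma> i < \<sigma> j) [k..<l]"
      by (rule sorted_wrt_mono_rel[OF _ sorted_wrt_upt])
        (use that in \<open>auto simp: strict_mono_on_def\<close>)
    then show ?thesis by (simp add: sorted_wrt_map)
  qed
  have s: "sorted_wrt (<) (filter P [0..<a + b])" for P
    by (intro sorted_wrt_filter) simp
  have "\<sigma> ` {..<a + b} = {..<a + b}" using p by (rule permutes_image)
  moreover have "{..<a + b} - {..<a} = {a..<a + b}" by auto
  ultimately have img: "\<sigma> ` {a..<a + b} = {..<a + b} - \<sigma> ` {..<a}" "\<sigma> ` {..<a} \<subseteq> {..<a + b}"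
    using image_set_diff[OF permutes_inj[OF p], of "{..<a + b}" "{..<a}"]
      image_mono[of "{..<a}" "{..<a + b}" \<sigma>] by simp_all
  show "map \<sigma> [0..<a] = filter (\<lambda>i. i \<in> \<sigma> ` {..<a}) [0..<a + b]"
  proof (rule strict_sorted_equal[OF s sorted[OF mono(1)]])
    show "set (map \<sigma> [0..<a]) = set (filter (\<lambda>i. i \<in> \<sigma> ` {..<a}) [0..<a + b])"
      using img(2) unfolding set_map set_filter set_upt lessThan_atLeast0[symmetric] by blast
  qed
  show "map \<sigma> [a..<a + b] = filter (\<lambda>i. i \<notin> \<sigma> ` {..<a}) [0..<a + b]"
  proof (rule strict_sorted_equal[OF s sorted[OF mono(2)]])
    show "set (map \<sigma> [a..<a + b]) = set (filter (\<lambda>i. i \<notin> \<sigma> ` {..<a}) [0..<a + b])"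
      unfolding set_map set_filter set_upt lessThan_atLeast0[symmetric] img(1) by blast
  qed
qed

lemma unshuffle_ext:
  assumes "\<sigma> permutes {..<n}" "\<tau> permutes {..<n}" "map \<sigma> [0..<n] = map \<tau> [0..<n]"
  shows "\<sigma> = \<tau>"
proof
  fix k show "\<sigma> k = \<tau> k"
    using assms by (cases "k < n") (auto simp: permutes_not_in)
qed

lemma bij_betw_unshuffles:
  "bij_betw (\<lambda>\<sigma>. \<sigma> ` {..<a}) (unshuffles [a, b]) {A. A \<subseteq> {..<a + b} \<and> card A = a}"
  unfolding bij_betw_def
proof
  show "inj_on (\<lambda>\<sigma>. \<sigma> ` {..<a}) (unshuffles [a, b])"
  proof (rule inj_onI)
    fix \<sigma> \<tau> assume *: "\<sigma> \<in> unshuffles [a, b]" "\<tau> \<in> unshuffles [a, b]" "\<sigma> ` {..<a} = \<tau> ` {..<a}"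
    have "[0..<a + b] = [0..<a] @ [a..<a + b]" by (rule upt_add_eq_append) simp
    then have "map \<sigma> [0..<a + b] = map \<tau> [0..<a + b]"
      using unshuffle_map[OF *(1)] unshuffle_map[OF *(2)] *(3) by (simp only: map_append)
    then show "\<sigma> = \<tau>"
      using *(1,2) unfolding unshuffles_pair by (blast intro: unshuffle_ext)
  qed
  show "(\<lambda>\<sigma>. \<sigma> ` {..<a}) ` unshuffles [a, b] = {A. A \<subseteq> {..<a + b} \<and> card A = a}"
  proof (intro equalityI subsetI)
    fix A assume "A \<in> (\<lambda>\<sigma>. \<sigma> ` {..<a}) ` unshuffles [a, b]"
    then obtain \<sigma> where "A = \<sigma> ` {..<a}" and p: "\<sigma> permutes {..<a + b}"
      by (auto simp: unshuffles_pair)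
    moreover have "card (\<sigma> ` {..<a}) = a"
      using inj_on_subset[OF permutes_inj[OF p], of "{..<a}"] by (simp add: card_image)
    moreover have "\<sigma> k < a + b" if "k < a" for k
      using permutes_in_image[OF p, of k] that by simp
    ultimately show "A \<in> {A. A \<subseteq> {..<a + b} \<and> card A = a}" by auto
  next
    fix A assume "A \<in> {A. A \<subseteq> {..<a + b} \<and> card A = a}"
    then have A: "A \<subseteq> {..<a + b}" "card A = a" by auto
    \<comment> \<open>The preimage of A lists A in increasing order and then its complement in
      increasing order.\<close>
    define ks where "ks = filter (\<lambda>i. i \<in> A) [0..<a + b]"
    define ls where "ls = filter (\<lambda>i. i \<notin> A) [0..<a + b]"
    define \<sigma> where "\<sigma> k = (if k < a + b then (ks @ ls) ! k else k)" for k
    have ks: "set ks = A" "sorted_wrt (<) ks" "distinct ks"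
      using A by (auto simp: ks_def intro!: sorted_wrt_filter)
    then have lk: "length ks = a" using A distinct_card by metis
    have ls: "set ls = {..<a + b} - A" "sorted_wrt (<) ls" "distinct ls"
      by (auto simp: ls_def intro!: sorted_wrt_filter)
    have "card ({..<a + b} - A) = a + b - a"
      using A finite_subset[OF A(1)] by (subst card_Diff_subset) simp_all
    then have ll: "length ls = b" using ls distinct_card[of ls] by simp
    have dist: "distinct (ks @ ls)" using ks ls by auto
    have set: "set (ks @ ls) = {..<a + b}" using ks ls A by auto
    have "bij_betw (\<lambda>k. (ks @ ls) ! k) {..<a + b} {..<a + b}"
      using bij_betw_nth[OF dist, of "{..<a + b}" "{..<a + b}"] lk ll set by simp
    then have "bij_betw \<sigma> {..<a + b} {..<a + b}"
      using bij_betw_cong[of "{..<a + b}" "\<lambda>k. (ks @ ls) ! k" \<sigma> "{..<a + b}"]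
      by (simp add: \<sigma>_def)
    then have "\<sigma> permutes {..<a + b}"
      by (rule bij_imp_permutes) (simp add: \<sigma>_def)
    moreover have "strict_mono_on {0..<a} \<sigma>"
      by (rule strict_mono_onI)
        (use lk sorted_wrt_nth_less[OF ks(2)] in \<open>simp add: \<sigma>_def nth_append\<close>)
    moreover have "strict_mono_on {a..<a + b} \<sigma>"
      by (rule strict_mono_onI)
        (use lk ll sorted_wrt_nth_less[OF ls(2)] in \<open>simp add: \<sigma>_def nth_append\<close>)
    ultimately have "\<sigma> \<in> unshuffles [a, b]" by (simp add: unshuffles_pair)
    moreover have "\<sigma> ` {..<a} = A"
    proof -
      have "\<sigma> ` {..<a} = (!) ks ` {..<a}"
        using lk by (intro image_cong) (auto simp: \<sigma>_def nth_append)
      also have "\<dots> = A" using ks(1) lk nth_image[of a ks] by (simp add: lessThan_atLeast0)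
      finally show ?thesis .
    qed
    ultimately show "A \<in> (\<lambda>\<sigma>. \<sigma> ` {..<a}) ` unshuffles [a, b]"
      by (intro image_eqI[of A _ \<sigma>]) simp_all
  qed
qed

text \<open>Without such a gap the set is closed downwards, hence an initial segment. The gap
  supplies the adjacent transposition for the induction in \<open>sign_unshuffle\<close>.\<close>

lemma gap_below:
  fixes A :: "nat set"
  assumes "finite A" "A \<noteq> {..<card A}"
  obtains (gap) v where "Suc v \<in> A" "v \<notin> A"
proof (rule ccontr)
  assume "\<not> thesis"
  then have step: "v \<in> A" if "Suc v \<in> A" for v using that \<open>\<not> thesis\<close> gap by blast
  have down: "v \<in> A" if "w \<in> A" "v \<le> w" for v w
    using that(2,1) by (induction rule: dec_induct) (auto intro: step)
  have "{..<card A} \<subseteq> A"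
  proof
    fix v assume v: "v \<in> {..<card A}"
    show "v \<in> A"
    proof (rule ccontr)
      assume "v \<notin> A"
      then have "w < v" if "w \<in> A" for w using down[OF that, of v] by (cases "w < v") simp_all
      then have "A \<subseteq> {..<v}" by auto
      then have "card A \<le> v" using card_mono[of "{..<v}" A] by simp
      with v show False by simp
    qed
  qed
  then have "{..<card A} = A" using assms(1) by (intro card_subset_eq) auto
  with assms(2) show False by simp
qed

text \<open>Induction on the sum of the first block. Exchanging a value \<open>Suc v\<close> of the
  first block with a value v of the second flips the sign and lowers the sum by one; it ends at the
  identity, where the exponent is twice \<open>\<Sum>{..<a}\<close>.\<close>

lemma sign_unshuffle:
  "\<sigma> \<in> unshuffles [a, b] \<Longrightarrow> sign \<sigma> = (-1) ^ (\<Sum>(\<sigma> ` {..<a}) + \<Sum>{..<a})"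
proof (induction "\<Sum>(\<sigma> ` {..<a})" arbitrary: \<sigma> rule: less_induct)
  case less
  have p: "\<sigma> permutes {..<a + b}" and mono: "strict_mono_on {0..<a} \<sigma>" "strict_mono_on {a..<a + b} \<sigma>"
    using less.prems by (auto simp: unshuffles_pair)
  have inj: "inj \<sigma>" using p by (rule permutes_inj)
  then have card: "card (\<sigma> ` {..<a}) = a"
    using inj_on_subset[of \<sigma> UNIV "{..<a}"] by (simp add: card_image)
  show ?case
  proof (cases "\<sigma> ` {..<a} = {..<a}")
    case True
    have "id \<in> unshuffles [a, b]" by (simp add: unshuffles_pair permutes_id strict_mono_on_def)
    then have "\<sigma> = id"
      using inj_onD[OF bij_betw_imp_inj_on[OF bij_betw_unshuffles[of a b]], of \<sigma> id] less.prems True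
      by simp
    then show ?thesis by (simp flip: mult_2)
  next
    case False
    then obtain v where v: "Suc v \<in> \<sigma> ` {..<a}" "v \<notin> \<sigma> ` {..<a}"
      using gap_below[of "\<sigma> ` {..<a}"] card by auto
    define \<tau> where "\<tau> = transpose v (Suc v) \<circ> \<sigma>"
    have Suc_v: "Suc v < a + b"
    proof -
      obtain i where "i < a" "Suc v = \<sigma> i" using v(1) by auto
      then show ?thesis using permutes_in_image[OF p, of i] by simp
    qed
    have block2: "\<sigma> i \<noteq> Suc v" if "i \<ge> a" for i
    proof
      assume "\<sigma> i = Suc v"
      then obtain j where "j < a" "\<sigma> i = \<sigma> j" using v(1) by auto
      then show False using inj that by (simp add: inj_eq)
    qed
    have block1: "\<sigma> i \<noteq> v" if "i < a" for i
      using v(2) that by blast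
    have \<tau>1: "\<tau> i = (if \<sigma> i = Suc v then v else \<sigma> i)" if "i < a" for i
      using block1[OF that] by (simp add: \<tau>_def transpose_def)
    have \<tau>2: "\<tau> i = (if \<sigma> i = v then Suc v else \<sigma> i)" if "i \<ge> a" for i
      using block2[OF that] by (simp add: \<tau>_def transpose_def)
    \<comment> \<open>The exchange alters the order of v and \<open>Suc v\<close> only, and these
      lie in different blocks, so both blocks stay increasing.\<close>
    have "strict_mono_on {0..<a} \<tau>"
    proof (rule strict_mono_onI)
      fix i j assume ij: "i \<in> {0..<a}" "j \<in> {0..<a}" "i < j"
      then have "\<sigma> i < \<sigma> j" using strict_mono_onD[OF mono(1)] by blast
      then show "\<tau> i < \<tau> j" using ij block1[of i] by (simp add: \<tau>1)
    qed
    moreover have "strict_mono_on {a..<a + b} \<tau>"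
    proof (rule strict_mono_onI)
      fix i j assume ij: "i \<in> {a..<a + b}" "j \<in> {a..<a + b}" "i < j"
      then have "\<sigma> i < \<sigma> j" using strict_mono_onD[OF mono(2)] by blast
      then show "\<tau> i < \<tau> j" using ij block2[of j] by (simp add: \<tau>2)
    qed
    moreover have "\<tau> permutes {..<a + b}"
      unfolding \<tau>_def using Suc_v by (intro permutes_compose[OF p] permutes_swap_id) auto
    ultimately have \<tau>: "\<tau> \<in> unshuffles [a, b]" by (simp add: unshuffles_pair)
    have "\<tau> ` {..<a} = insert v (\<sigma> ` {..<a} - {Suc v})"
    proof -
      have "\<tau> ` {..<a} = (\<lambda>y. if y = Suc v then v else y) ` \<sigma> ` {..<a}"
        unfolding image_image by (intro image_cong) (auto simp: \<tau>1)
      then show ?thesis using v by (auto simp: image_iff)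
    qed
    then have "\<Sum>(\<tau> ` {..<a}) = v + \<Sum>(\<sigma> ` {..<a} - {Suc v})" using v by simp
    moreover have "\<Sum>(\<sigma> ` {..<a}) = Suc v + \<Sum>(\<sigma> ` {..<a} - {Suc v})"
      using v by (intro sum.remove) auto
    ultimately have sum: "\<Sum>(\<sigma> ` {..<a}) = Suc (\<Sum>(\<tau> ` {..<a}))" by simp
    have "sign \<tau> = - sign \<sigma>"
      using permutes_imp_permutation[OF _ p]
      by (simp add: \<tau>_def sign_compose permutation_swap_id sign_swap_id)
    then show ?thesis using less.hyps[OF _ \<tau>] sum by simp
  qed
qed

text \<open>\<open>H\<close> is left arbitrary, with the sign and the two blocks as inputs, so that
  one reindexing serves all the block shapes below.\<close>

lemma sum_unshuffles:
  assumes "length xs = a + b"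
  shows "(\<Sum>\<sigma>\<in>unshuffles [a, b]. H (sign \<sigma>) (map (\<lambda>k. xs ! \<sigma> k) [0..<a]) (map (\<lambda>k. xs ! \<sigma> k) [a..<a + b]))
    = (\<Sum>A | A \<subseteq> {..<a + b} \<and> card A = a. H ((-1) ^ (\<Sum>A + \<Sum>{..<a})) (nths xs A) (nths xs (- A)))"
proof -
  have "H (sign \<sigma>) (map (\<lambda>k. xs ! \<sigma> k) [0..<a]) (map (\<lambda>k. xs ! \<sigma> k) [a..<a + b])
      = H ((-1) ^ (\<Sum>(\<sigma> ` {..<a}) + \<Sum>{..<a})) (nths xs (\<sigma> ` {..<a})) (nths xs (- \<sigma> ` {..<a}))"
    if \<sigma>: "\<sigma> \<in> unshuffles [a, b]" for \<sigma>
  proof -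
    have "map (\<lambda>k. xs ! \<sigma> k) ks = map ((!) xs) (map \<sigma> ks)" for ks by simp
    then show ?thesis
      using sign_unshuffle[OF \<sigma>] assms
      by (simp only: unshuffle_map[OF \<sigma>] nths_eq_map_filter Compl_iff)
  qed
  then show ?thesis
    using sum.reindex_bij_betw[OF bij_betw_unshuffles, of
      "\<lambda>A. H ((-1) ^ (\<Sum>A + \<Sum>{..<a})) (nths xs A) (nths xs (- A))" a b]
    by (simp cong: sum.cong)
qed

lemma sum_unshuffles_1:
  assumes "length xs = Suc b"
  shows "(\<Sum>\<sigma>\<in>unshuffles [1, b]. H (sign \<sigma>) (map (\<lambda>k. xs ! \<sigma> k) [0..<1]) (map (\<lambda>k. xs ! \<sigma> k) [1..<1 + b]))
    = (\<Sum>i<Suc b. H ((-1) ^ i) [xs ! i] (nths xs (- {i})))"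
proof -
  have "{A. A \<subseteq> {..<1 + b} \<and> card A = 1} = (\<lambda>i. {i}) ` {..<Suc b}"
    by (auto simp: card_1_singleton_iff)
  moreover have "filter (\<lambda>j. j = i) [0..<Suc b] = [i]" if "i < Suc b" for i
    by (rule strict_sorted_equal) (use that in \<open>auto intro!: sorted_wrt_filter simp del: upt_Suc\<close>)
  then have "nths xs {i} = [xs ! i]" if "i < Suc b" for i
    using assms that by (simp add: nths_eq_map_filter del: upt_Suc)
  ultimately show ?thesis
    using assms sum_unshuffles[of xs 1 b H] by (simp add: sum.reindex lessThan_Suc[of 0] del: sum.lessThan_Suc)
qed

lemma sum_unshuffles_2:
  assumes "length xs = 2 + b"
  shows "(\<Sum>\<sigma>\<in>unshuffles [2, b]. H (sign \<sigma>) (map (\<lambda>k. xs ! \<sigma> k) [0..<2]) (map (\<lambda>k. xs ! \<sigma> k) [2..<2 + b]))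
    = (\<Sum>i<2 + b. \<Sum>j\<in>{i<..<2 + b}. H ((-1) ^ Suc (i + j)) [xs ! i, xs ! j] (nths xs (- {i, j})))"
proof -
  have "{A. A \<subseteq> {..<2 + b} \<and> card A = 2} = (\<lambda>(i, j). {i, j}) ` (SIGMA i:{..<2 + b}. {i<..<2 + b})"
  proof (intro equalityI subsetI; clarify?)
    fix A :: "nat set" assume A: "A \<subseteq> {..<2 + b}" "card A = 2"
    then obtain i j where "A = {i, j}" "i < j"
      by (metis card_2_iff insert_commute linorder_neqE_nat)
    then show "A \<in> (\<lambda>(i, j). {i, j}) ` (SIGMA i:{..<2 + b}. {i<..<2 + b})"
      using A by (intro image_eqI[of _ _ "(i, j)"]) auto
  qed auto
  moreover have "inj_on (\<lambda>(i, j). {i, j}) (SIGMA i:{..<2 + b}. {i<..<2 + b})"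
    by (auto simp: inj_on_def doubleton_eq_iff)
  moreover have "filter (\<lambda>k. k = i \<or> k = j) [0..<2 + b] = [i, j]" if "i < j" "j < 2 + b" for i j
    by (rule strict_sorted_equal) (use that in \<open>auto intro!: sorted_wrt_filter simp del: upt_Suc\<close>)
  then have "nths xs {i, j} = [xs ! i, xs ! j]" if "i < j" "j < 2 + b" for i j
    using assms that by (simp add: nths_eq_map_filter del: upt_Suc)
  moreover have "\<Sum>{..<2::nat} = 1" by (simp add: numeral_2_eq_2)
  ultimately show ?thesis
    unfolding sum_unshuffles[OF assms]
    by (auto simp: sum.reindex sum.Sigma case_prod_unfold simp del: upt_Suc sum.lessThan_Suc
        intro!: sum.cong)
qed

lemma sum_unshuffles_last:
  assumes "length xs = Suc a"
  shows "(\<Sum>\<sigma>\<in>unshuffles [a, 1]. H (sign \<sigma>) (map (\<lambda>k. xs ! \<sigma> k) [0..<a]) (map (\<lambda>k. xs ! \<sigma> k) [a..<a + 1]))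
    = (\<Sum>i<Suc a. H ((-1) ^ (a + i)) (nths xs (- {i})) [xs ! i])"
proof -
  have "{A. A \<subseteq> {..<a + 1} \<and> card A = a} = (\<lambda>i. {..<Suc a} - {i}) ` {..<Suc a}"
  proof (intro equalityI subsetI)
    fix A assume "A \<in> {A. A \<subseteq> {..<a + 1} \<and> card A = a}"
    then have A: "A \<subseteq> {..<Suc a}" "card A = a" by auto
    then have "card ({..<Suc a} - A) = 1"
      using finite_subset[OF A(1)] by (subst card_Diff_subset) simp_all
    then obtain i where "{..<Suc a} - A = {i}" by (auto simp: card_1_singleton_iff)
    then have "A = {..<Suc a} - {i}" "i < Suc a" using A by auto
    then show "A \<in> (\<lambda>i. {..<Suc a} - {i}) ` {..<Suc a}" by blast
  qed (auto simp: card_Diff_singleton)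
  moreover have "inj_on (\<lambda>i. {..<Suc a} - {i}) {..<Suc a}"
    by (auto simp: inj_on_def)
  moreover have single: "filter (\<lambda>j. j = i) [0..<Suc a] = [i]" if "i < Suc a" for i
    by (rule strict_sorted_equal) (use that in \<open>auto intro!: sorted_wrt_filter simp del: upt_Suc\<close>)
  have "nths xs (- ({..<Suc a} - {i})) = [xs ! i]" if "i < Suc a" for i
  proof -
    have "filter (\<lambda>j. j \<in> - ({..<Suc a} - {i})) [0..<Suc a] = filter (\<lambda>j. j = i) [0..<Suc a]"
      by (rule filter_cong) auto
    then show ?thesis
      using assms single[OF that]
      by (simp only: nths_eq_map_filter list.map)
  qed
  moreover have "nths xs ({..<Suc a} - {i}) = nths xs (- {i})" for i
    unfolding nths_eq_map_filter assms by (intro arg_cong[of _ _ "map _"] filter_cong) auto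
  \<comment> \<open>Leaving out i from the sum up to a gives a - i plus \<open>\<Sum>{..<a}\<close>;
    the latter then occurs twice, and a - i has the parity of a + i.\<close>
  moreover have "(-1) ^ (\<Sum>({..<Suc a} - {i}) + \<Sum>{..<a}) = ((-1) ^ (a + i) :: int)" if "i < Suc a" for i
  proof -
    have "\<Sum>{..<Suc a} = i + \<Sum>({..<Suc a} - {i})" using that by (intro sum.remove) auto
    then have "\<Sum>({..<Suc a} - {i}) + \<Sum>{..<a} + 2 * i = a + i + 2 * \<Sum>{..<a}" by simp
    then have "even (\<Sum>({..<Suc a} - {i}) + \<Sum>{..<a}) = even (a + i)" by presburger
    then show ?thesis by (simp add: minus_one_power_iff)
  qed
  ultimately show ?thesis
    using assms sum_unshuffles[of xs a 1 H]
    by (simp add: sum.reindex del: upt_Suc sum.lessThan_Suc)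
qed

lemma sum_unshuffles_all:
  assumes "length xs = a"
  shows "(\<Sum>\<sigma>\<in>unshuffles [a, 0]. H (sign \<sigma>) (map (\<lambda>k. xs ! \<sigma> k) [0..<a]) (map (\<lambda>k. xs ! \<sigma> k) [a..<a + 0]))
    = H 1 xs []"
proof -
  have "{A. A \<subseteq> {..<a + 0} \<and> card A = a} = {{..<a}}"
    by (auto dest: card_subset_eq[rotated])
  moreover have "nths xs {..<a} = xs" "nths xs (- {..<a}) = []"
    using assms by (auto simp: nths_all nths_eq_map_filter map_nth cong: filter_cong)
  ultimately show ?thesis
    using assms sum_unshuffles[of xs a 0 H] by (simp flip: mult_2)
qed

text \<open>With all blocks of size 1, the ordering condition on neighbouring blocks of equal size
  forces the permutation to be increasing.\<close>

lemma ordered_unshuffles_ones: "ordered_unshuffles (replicate n 1) = {id}"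
proof -
  have bs: "block_start (replicate n (Suc 0)) i = min i n" for i
    by (simp add: block_start_def sum_list_replicate)
  show ?thesis
  proof (intro equalityI subsetI)
    fix \<sigma> assume \<sigma>: "\<sigma> \<in> ordered_unshuffles (replicate n 1)"
    then have p: "\<sigma> permutes {..<n}"
      by (auto simp: ordered_unshuffles_def unshuffles_def sum_list_replicate)
    have step: "\<sigma> i < \<sigma> (Suc i)" if "Suc i < n" for i
    proof -
      have "\<sigma> (block_start (replicate n (Suc 0)) i) < \<sigma> (block_start (replicate n (Suc 0)) (Suc i))"
        using \<sigma> that by (simp add: ordered_unshuffles_def)
      then show ?thesis using that by (simp add: bs)
    qed
    have "\<sigma> i < \<sigma> j" if "i < j" "j < n" for i j
      using that by (induction j rule: less_Suc_induct) (auto intro: less_trans step)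
    then have "sorted_wrt (<) (map \<sigma> [0..<n])" by (auto simp: sorted_wrt_iff_nth_less)
    moreover have "set (map \<sigma> [0..<n]) = {..<n}"
      using permutes_image[OF p] by (simp add: lessThan_atLeast0)
    ultimately have "map \<sigma> [0..<n] = map id [0..<n]"
      by (intro strict_sorted_equal) (auto simp: lessThan_atLeast0)
    then show "\<sigma> \<in> {id}" using unshuffle_ext[OF p permutes_id] by simp
  qed (auto simp: ordered_unshuffles_def unshuffles_def permutes_id bs strict_mono_on_def)
qed

lemma ordered_unshuffles_distinct:
  assumes "a \<noteq> b"
  shows "ordered_unshuffles [a, b] = unshuffles [a, b]"
  using assms by (auto simp: ordered_unshuffles_def)

section \<open>Linear combinations of trees\<close>

text \<open>The linear extension of \<open>h\<close> from trees to formal combinations.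
  \<open>delta_Lie\<close> sums over the support of the boundary, where equal trees have been
  merged; additivity allows evaluation term by term as the boundary is written, without comparing
  trees.\<close>

definition lincomb :: "('k::field \<Rightarrow> 'm::ab_group_add \<Rightarrow> 'm) \<Rightarrow> ('b \<Rightarrow> 'm) \<Rightarrow> ('b \<Rightarrow>\<^sub>0 'k) \<Rightarrow> 'm" where
  "lincomb s h f = (\<Sum>t\<in>Poly_Mapping.keys f. s (Poly_Mapping.lookup f t) (h t))"

context vector_space
begin

lemma lincomb_superset:
  assumes "finite A" "Poly_Mapping.keys f \<subseteq> A"
  shows "lincomb scale h f = (\<Sum>t\<in>A. scale (Poly_Mapping.lookup f t) (h t))"
  unfolding lincomb_def using assms
  by (intro sum.mono_neutral_left) (auto simp: in_keys_iff)

lemma lincomb_single: "lincomb scale h (Poly_Mapping.single t c) = scale c (h t)"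
  by (cases "c = 0") (simp_all add: lincomb_def)

lemma lincomb_zero: "lincomb scale h 0 = 0"
  by (simp add: lincomb_def)

lemma lincomb_add: "lincomb scale h (f + f') = lincomb scale h f + lincomb scale h f'"
proof -
  let ?A = "Poly_Mapping.keys f \<union> Poly_Mapping.keys f'"
  \<comment> \<open>Cancellation can shrink the support of the sum, so all three combinations are
    summed over one common finite set.\<close>
  have "lincomb scale h (f + f') = (\<Sum>t\<in>?A. scale (Poly_Mapping.lookup (f + f') t) (h t))"
    by (intro lincomb_superset) (auto simp: Poly_Mapping.keys_add[THEN subsetD] dest!: Poly_Mapping.keys_add[THEN subsetD])
  then show ?thesis
    by (simp add: lincomb_superset[of ?A] lookup_add scale_left_distrib sum.distrib)
qed

lemma lincomb_diff: "lincomb scale h (f - f') = lincomb scale h f - lincomb scale h f'"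
  using lincomb_add[of h "f - f'" f'] by (simp add: algebra_simps)

lemma lincomb_sum: "lincomb scale h (sum f I) = (\<Sum>i\<in>I. lincomb scale h (f i))"
  by (induction I rule: infinite_finite_induct) (simp_all add: lincomb_zero lincomb_add)

end

text \<open>The common shape, after evaluation, of the boundaries of \<open>Mu\<close> and
  \<open>Nu\<close> and of the subtracted part for \<open>F\<close>. \<open>K i j ys zs\<close> is
  the value of one tree, with \<open>ys\<close> entering the inner vertex and \<open>zs\<close> the
  other inputs of the root; \<open>i0\<close> is the least arity of the root.\<close>

definition insertion_sum ::
  "('k::field \<Rightarrow> 'm::ab_group_add \<Rightarrow> 'm) \<Rightarrow> nat \<Rightarrow> (nat \<Rightarrow> nat \<Rightarrow> 'a list \<Rightarrow> 'a list \<Rightarrow> 'm)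
    \<Rightarrow> nat \<Rightarrow> 'a list \<Rightarrow> 'm" where
  "insertion_sum s i0 K n xs =
     (\<Sum>(i, j)\<in>{(i, j). i + j = n + 1 \<and> i \<ge> i0 \<and> j \<ge> 2}. \<Sum>\<sigma>\<in>unshuffles [j, i - 1].
        s ((-1) ^ (j * (i - 1)) * of_int (sign \<sigma>))
          (K i j (map (\<lambda>k. xs ! \<sigma> k) [0..<j]) (map (\<lambda>k. xs ! \<sigma> k) [j..<j + (i - 1)])))"

lemma finite_insertion_indices: "finite {(i, j). i + j = n + 1 \<and> i \<ge> i0 \<and> j \<ge> (2::nat)}"
  by (rule finite_subset[of _ "{..n + 1} \<times> {..n + 1}"]) auto

context vector_space
begin

lemma insertion_sum_add:
  "insertion_sum scale i0 (\<lambda>i j ys zs. K i j ys zs + K' i j ys zs) n xs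
    = insertion_sum scale i0 K n xs + insertion_sum scale i0 K' n xs"
  by (simp add: insertion_sum_def scale_right_distrib sum.distrib case_prod_unfold)

lemma insertion_sum_only:
  assumes "i1 \<ge> i0" "j1 \<ge> 2"
  shows "insertion_sum scale i0 (\<lambda>i j ys zs. if i = i1 \<and> j = j1 then K ys zs else 0) n xs =
    (if i1 + j1 = n + 1 then \<Sum>\<sigma>\<in>unshuffles [j1, i1 - 1].
        scale ((-1) ^ (j1 * (i1 - 1)) * of_int (sign \<sigma>))
          (K (map (\<lambda>k. xs ! \<sigma> k) [0..<j1]) (map (\<lambda>k. xs ! \<sigma> k) [j1..<j1 + (i1 - 1)]))
     else 0)"
proof -
  let ?S = "{(i, j). i + j = n + 1 \<and> i \<ge> i0 \<and> j \<ge> (2::nat)}"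
  let ?c = "\<Sum>\<sigma>\<in>unshuffles [j1, i1 - 1].
        scale ((-1) ^ (j1 * (i1 - 1)) * of_int (sign \<sigma>))
          (K (map (\<lambda>k. xs ! \<sigma> k) [0..<j1]) (map (\<lambda>k. xs ! \<sigma> k) [j1..<j1 + (i1 - 1)]))"
  have "insertion_sum scale i0 (\<lambda>i j ys zs. if i = i1 \<and> j = j1 then K ys zs else 0) n xs
      = (\<Sum>x\<in>?S. if x = (i1, j1) then ?c else 0)"
    unfolding insertion_sum_def
  proof (rule sum.cong[OF refl])
    fix x assume "x \<in> ?S"
    obtain i j where x: "x = (i, j)" by (cases x)
    show "(case x of (i, j) \<Rightarrow> \<Sum>\<sigma>\<in>unshuffles [j, i - 1].
        scale ((-1) ^ (j * (i - 1)) * of_int (sign \<sigma>))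
          (if i = i1 \<and> j = j1 then K (map (\<lambda>k. xs ! \<sigma> k) [0..<j]) (map (\<lambda>k. xs ! \<sigma> k) [j..<j + (i - 1)]) else 0))
      = (if x = (i1, j1) then ?c else 0)"
      unfolding x prod.case prod.inject by (cases "i = i1 \<and> j = j1") (auto simp del: upt_Suc)
  qed
  also have "\<dots> = (if i1 + j1 = n + 1 then ?c else 0)"
    using assms finite_insertion_indices[of n i0] by (simp add: sum.delta)
  finally show ?thesis .
qed

text \<open>With a binary bracket inside, the coefficient \<open>(-1) ^ (2 * (q - 1))\<close> is 1
  and the unshuffle signs are those of the bracket terms in \<open>CE\<close>.\<close>

lemma insertion_sum_binary_inner:
  assumes "q \<ge> 1" "q \<ge> i0" "length xs = n"
  shows "insertion_sum scale i0 (\<lambda>i j ys zs. if i = q \<and> j = 2 then K ys zs else 0) n xs =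
    (if n = q + 1 then \<Sum>i<n. \<Sum>j\<in>{i<..<n}.
        scale ((-1) ^ Suc (i + j)) (K [xs ! i, xs ! j] (nths xs (- {i, j}))) else 0)"
proof -
  have "even (2 * (q - 1))" by simp
  then show ?thesis
    using sum_unshuffles_2[of xs "q - 1" "\<lambda>e ys zs. scale ((-1) ^ (2 * (q - 1)) * of_int e) (K ys zs)"]
      assms by (auto simp: insertion_sum_only simp del: upt_Suc sum.lessThan_Suc)
qed

lemma insertion_sum_binary_outer:
  assumes "q \<ge> 2" "i0 \<le> 2" "length xs = n"
  shows "insertion_sum scale i0 (\<lambda>i j ys zs. if i = 2 \<and> j = q then K ys zs else 0) n xs =
    (if n = q + 1 then \<Sum>i<n. scale ((-1) ^ i) (K (nths xs (- {i})) [xs ! i]) else 0)"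
proof -
  \<comment> \<open>The coefficient of the boundary for j = q, i = 2 cancels the q in the sign of
    the unshuffle that sends position i to the end.\<close>
  have "(-1) ^ q * (-1) ^ (q + i) = ((-1) ^ i :: 'a)" for i
    by (simp add: minus_one_power_iff)
  then show ?thesis
    using sum_unshuffles_last[of xs q "\<lambda>e ys zs. scale ((-1) ^ q * of_int e) (K ys zs)"]
      assms by (auto simp: insertion_sum_only simp del: upt_Suc sum.lessThan_Suc)
qed

lemma insertion_sum_unary_outer:
  assumes "q \<ge> 2" "i0 \<le> 1" "length xs = n"
  shows "insertion_sum scale i0 (\<lambda>i j ys zs. if i = 1 \<and> j = q then K ys zs else 0) n xs =
    (if n = q then K xs [] else 0)"
  using sum_unshuffles_all[of xs q "\<lambda>e ys zs. scale (of_int e) (K ys zs)"] assms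
  by (auto simp: insertion_sum_only simp del: upt_Suc)

end

section \<open>Evaluation of the two kinds of trees, vertex by vertex\<close>

lemma map_composite_leaves:
  "map (\<lambda>i. composite (D i) (leaves \<sigma> a b ! i) xs) [0..<b - a] = map (\<lambda>k. xs ! \<sigma> k) [a..<b]"
  by (intro nth_equalityI) (simp_all add: leaves_def)

lemma length_leaves [simp]: "length (leaves \<sigma> a b) = b - a"
  by (simp add: leaves_def)

lemma vertices_leaves: "k < length (leaves \<sigma> a b) \<Longrightarrow> vertices (leaves \<sigma> a b ! k) = {}"
  by (simp add: leaves_def)

lemma vertices_Node_leaves: "vertices (Node \<zeta> (leaves \<sigma> a b)) = {[]}"
proof -
  have "(\<Union>i\<in>set [0..<b - a]. (#) i ` vertices (leaves \<sigma> a b ! i)) = {}"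
    by (simp add: vertices_leaves)
  then show ?thesis by (simp only: vertices.simps length_leaves)
qed

lemma vertices_insertion_tree: "vertices (insertion_tree \<xi> \<zeta> i j \<sigma>) = {[], [0]}"
proof -
  let ?ts = "Node \<zeta> (leaves \<sigma> 0 j) # leaves \<sigma> j (j + (i - 1))"
  have "(\<Union>k\<in>set [0..<length ?ts]. (#) k ` vertices (?ts ! k)) = {[0]}"
    by (auto simp: nth_Cons vertices_leaves vertices_Node_leaves simp del: vertices.simps
        split: nat.splits)
  then show ?thesis by (simp only: insertion_tree_def vertices.simps)
qed

lemma composite_Node_leaves:
  "composite D (Node \<zeta> (leaves \<sigma> a b)) xs = D [] \<zeta> (map (\<lambda>k. xs ! \<sigma> k) [a..<b])"
  by (simp only: composite.simps length_leaves map_composite_leaves)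

lemma composite_insertion_tree:
  "composite D (insertion_tree \<xi> \<zeta> i j \<sigma>) xs =
    D [] \<xi> (D [0] \<zeta> (map (\<lambda>k. xs ! \<sigma> k) [0..<j]) # map (\<lambda>k. xs ! \<sigma> k) [j..<j + (i - 1)])"
proof -
  have "map (\<lambda>k. composite (\<lambda>v. D (k # v)) ((Node \<zeta> (leaves \<sigma> 0 j) # leaves \<sigma> j (j + (i - 1))) ! k) xs)
        [0..<Suc (j + (i - 1) - j)]
      = composite (\<lambda>v. D (0 # v)) (Node \<zeta> (leaves \<sigma> 0 j)) xs #
        map (\<lambda>k. composite (\<lambda>v. D (Suc k # v)) (leaves \<sigma> j (j + (i - 1)) ! k) xs) [0..<j + (i - 1) - j]"
    by (simp add: upt_conv_Cons map_Suc_upt[symmetric] o_def del: upt_Suc composite.simps)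
  then show ?thesis
    by (simp only: insertion_tree_def composite.simps(2)[of D] list.size length_leaves add_0_right
        add_Suc_right composite_Node_leaves map_composite_leaves)
qed

definition vertex_sum ::
  "(gen \<Rightarrow> ('u::ab_group_add, 'v::ab_group_add) op) \<Rightarrow> (gen \<Rightarrow> ('u, 'v) op) \<Rightarrow> tree
    \<Rightarrow> ('u, 'v) op" where
  "vertex_sum \<theta> \<beta> t xs = (\<Sum>v\<in>vertices t. composite (\<lambda>w. if w = v then \<theta> else \<beta>) t xs)"

lemma vertex_sum_insertion_tree:
  "vertex_sum \<theta> \<beta> (insertion_tree \<xi> \<zeta> i j \<sigma>) xs =
    \<theta> \<xi> (\<beta> \<zeta> (map (\<lambda>k. xs ! \<sigma> k) [0..<j]) # map (\<lambda>k. xs ! \<sigma> k) [j..<j + (i - 1)]) +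
    \<beta> \<xi> (\<theta> \<zeta> (map (\<lambda>k. xs ! \<sigma> k) [0..<j]) # map (\<lambda>k. xs ! \<sigma> k) [j..<j + (i - 1)])"
  by (simp add: vertex_sum_def vertices_insertion_tree composite_insertion_tree)

lemma vertices_bloom_tree: "vertices (bloom_tree rs \<sigma>) = insert [] ((\<lambda>m. [m]) ` {..<length rs})"
proof -
  let ?ts = "map (\<lambda>m. Node (F (rs ! m)) (leaves \<sigma> (block_start rs m) (block_start rs (m + 1)))) [0..<length rs]"
  have "(\<Union>i\<in>set [0..<length ?ts]. (#) i ` vertices (?ts ! i)) = (\<lambda>m. [m]) ` {..<length rs}"
    by (auto simp: vertices_Node_leaves simp del: vertices.simps)
  then show ?thesis by (simp only: bloom_tree_def vertices.simps)
qed

lemma composite_bloom_tree: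
  "composite D (bloom_tree rs \<sigma>) xs = D [] (Nu (length rs))
    (map (\<lambda>m. D [m] (F (rs ! m)) (map (\<lambda>k. xs ! \<sigma> k) [block_start rs m..<block_start rs (m + 1)]))
      [0..<length rs])"
proof -
  let ?ts = "map (\<lambda>m. Node (F (rs ! m)) (leaves \<sigma> (block_start rs m) (block_start rs (m + 1)))) [0..<length rs]"
  have "map (\<lambda>i. composite (\<lambda>v. D (i # v)) (?ts ! i) xs) [0..<length ?ts] =
      map (\<lambda>m. D [m] (F (rs ! m)) (map (\<lambda>k. xs ! \<sigma> k) [block_start rs m..<block_start rs (m + 1)]))
        [0..<length rs]"
    by (intro nth_equalityI) (simp_all add: composite_Node_leaves del: composite.simps)
  then show ?thesis by (simp only: bloom_tree_def composite.simps)
qed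

lemma vertex_sum_bloom_tree:
  fixes rs \<sigma> xs
  defines "P \<equiv> \<lambda>m. map (\<lambda>k. xs ! \<sigma> k) [block_start rs m..<block_start rs (m + 1)]"
  shows "vertex_sum \<theta> \<beta> (bloom_tree rs \<sigma>) xs =
    \<theta> (Nu (length rs)) (map (\<lambda>m. \<beta> (F (rs ! m)) (P m)) [0..<length rs]) +
    (\<Sum>m<length rs. \<beta> (Nu (length rs))
      (map (\<lambda>m'. (if m' = m then \<theta> else \<beta>) (F (rs ! m')) (P m')) [0..<length rs]))"
proof -
  have "inj_on (\<lambda>m. [m]) {..<length rs}" by (simp add: inj_on_def)
  then show ?thesis
    unfolding vertex_sum_def vertices_bloom_tree P_def
    by (subst sum.insert) (auto simp: sum.reindex composite_bloom_tree cong: if_cong)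
qed

section \<open>The complex of Lie algebra morphisms\<close>

lemma finite_ordered_partitions: "finite (ordered_partitions n l)"
proof (rule finite_subset)
  show "ordered_partitions n l \<subseteq> {rs. set rs \<subseteq> {..n} \<and> length rs = l}"
    by (auto simp: ordered_partitions_def member_le_sum_list)
qed (simp add: finite_lists_length_eq)

lemma ordered_partitions_ones: "replicate l 1 \<in> ordered_partitions n l \<longleftrightarrow> l = n"
  by (auto simp: ordered_partitions_def sum_list_replicate)

text \<open>The numbers n - i add up to n(n - 1)/2 again, so the exponent is even. Hence \<theta> at
  the root with g on every input has coefficient 1.\<close>

lemma bloom_sign_ones:
  "(-1) ^ (n * (n - 1) div 2 + (\<Sum>i\<in>{1..n - 1}. replicate n 1 ! (i - 1) * (n - i))) = (1 :: 'a::comm_ring_1)"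
proof (cases n)
  case (Suc m)
  have "(\<Sum>i\<in>{1..m}. replicate n 1 ! (i - 1) * (n - i)) = (\<Sum>i\<in>{1..m}. Suc m - i)"
  proof (rule sum.cong[OF refl])
    fix i assume "i \<in> {1..m}"
    then have "i - 1 < n" using Suc by auto
    then show "replicate n 1 ! (i - 1) * (n - i) = Suc m - i" by (simp add: Suc del: replicate_Suc)
  qed
  also have "\<dots> = \<Sum>{1..m}"
    using sum.atLeastAtMost_rev[of "\<lambda>i. i" 1 m] by simp
  also have "\<dots> = Suc m * m div 2"
    using gauss_sum_nat[of m] by (simp add: sum.atLeast_Suc_atMost[of 0] mult.commute)
  finally show ?thesis by (simp add: Suc flip: mult_2)
qed simp

text \<open>The dichotomy for \<theta> at the root: a block of size other than 1 carries \<beta> = 0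
  and kills the tree.\<close>

lemma all_ones_or:
  assumes "rs \<in> ordered_partitions n l"
  obtains "rs = replicate l 1" "l = n" | m where "m < l" "rs ! m \<noteq> 1"
proof (cases "\<exists>m<l. rs ! m \<noteq> 1")
  case False
  then have "rs = replicate l 1"
    using assms by (auto simp: ordered_partitions_def list_eq_iff_nth_eq)
  then show ?thesis using assms that(1) ordered_partitions_ones[of l n] by simp
qed (use that in auto)

lemma ordered_partitions_2: "rs \<in> ordered_partitions n 2 \<longleftrightarrow> (\<exists>r s. rs = [r, s] \<and> 1 \<le> r \<and> r \<le> s \<and> r + s = n)"
  by (auto simp: ordered_partitions_def length_Suc_conv numeral_2_eq_2)

lemma adjoint_module:
  assumes "lie_algebra s br"
  shows "lie_module s br s br"
proof -
  interpret lie_algebra s br by fact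
  interpret two_vector_spaces s s ..
  have "br (br x y) m = br x (br y m) - br y (br x m)" for x y m
  proof -
    have "br (br x y) m = - br m (br x y)" by (rule bracket_swap)
    also have "\<dots> = br x (br y m) + br y (br m x)"
      using jacobi[of x y m] by (metis eq_neg_iff_add_eq_0)
    also have "br y (br m x) = - br y (br x m)"
      unfolding bracket_swap[of m x] by (rule linearD(4)[OF bracket_linear_right])
    finally show ?thesis by simp
  qed
  then show ?thesis
    by (intro lie_module.intro lie_module_axioms.intro lie_algebra_axioms two_vector_spaces_axioms
        bracket_linear_left bracket_linear_right)
qed

locale lie_algebra_morphism_0 = lie_algebra_morphism sU brU sV brV g
  for sU :: "'k::field_char_0 \<Rightarrow> 'u::ab_group_add \<Rightarrow> 'u" and brU
    and sV :: "'k \<Rightarrow> 'v::ab_group_add \<Rightarrow> 'v" and brV and g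
begin

sublocale Sp: U_V_spaces sU sV ..

sublocale adU: lie_module sU brU sU brU
  by (rule adjoint_module) unfold_locales

sublocale adV: lie_module sV brV sV brV
  by (rule adjoint_module) unfold_locales

lemmas g_simps = Sp.UV.linearD[OF g_linear]

sublocale modV: lie_module sU brU sV "\<lambda>u v. brV (g u) v"
proof (intro lie_module.intro lie_module_axioms.intro)
  show "lie_algebra sU brU" "two_vector_spaces sU sV" by unfold_locales
  show "Vector_Spaces.linear sU sV (\<lambda>u. brV (g u) v)" for v
    by (rule Sp.UV.linearI) (simp_all add: g_simps adV.act_simps)
  show "Vector_Spaces.linear sV sV (brV (g u))" for u
    by (rule V.bracket_linear_right)
  show "brV (g (brU x y)) m = brV (g x) (brV (g y) m) - brV (g y) (brV (g x) m)" for x y m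
    by (simp add: g_bracket adV.act_bracket)
qed

text \<open>Naturality of b in the arguments. With naturality in the coefficients,
  \<open>CE_comp_g\<close>, it cancels the mixed terms in the square of
  \<open>delta\<close>.\<close>

lemma CE_map:
  "CE sV brU (\<lambda>u v. brV (g u) v) (\<lambda>us. \<phi> (map g us)) us = CE sV brV brV \<phi> (map g us)"
proof -
  have "map g (nths us A) = nths (map g us) A" for A by (simp add: nths_map)
  then show ?thesis
    unfolding modV.CE_0_based adV.CE_0_based length_map
    by (intro arg_cong2[of _ _ _ _ "(+)"] sum.cong refl) (simp_all add: g_bracket)
qed

lemma CE_comp_g:
  "CE sV brU (\<lambda>u v. brV (g u) v) (\<lambda>us. g (\<phi> us)) us = g (CE sU brU brU \<phi> us)"
proof -
  have "g (sum f I) = (\<Sum>i\<in>I. g (f i))" for f :: "nat \<Rightarrow> 'u" and I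
    by (induction I rule: infinite_finite_induct) (simp_all add: g_simps)
  then show ?thesis
    by (simp add: modV.CE_0_based adU.CE_0_based g_simps g_bracket)
qed

section \<open>The complex with differential \<open>delta\<close>\<close>

abbreviation "\<delta> \<equiv> delta sU brU sV brV g"

lemma Lam_iff:
  "(xU, xV, xg) \<in> Lam sU sV n \<longleftrightarrow>
    Sp.UU.alt n xU \<and> Sp.VV.alt n xV \<and> Sp.UV.alt (n - 1) xg"
  by (simp add: Lam_def Sp.UU.Hom_wedge_iff_alt Sp.VV.Hom_wedge_iff_alt Sp.UV.Hom_wedge_iff_alt)

lemma alt_comp_g: "Sp.UU.alt n \<phi> \<Longrightarrow> Sp.UV.alt n (\<lambda>us. g (\<phi> us))"
proof (induction n arbitrary: \<phi>)
  case (Suc n)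
  have "Vector_Spaces.linear sU sV (\<lambda>u. g (\<phi> (u # us)))" for us
    by (rule Sp.UV.linearI)
      (simp_all add: g_simps Sp.UU.linearD[OF Sp.UU.alt_linear_hd[OF Suc.prems]])
  then show ?case using Suc by (simp add: g_simps)
qed (simp add: g_simps)

lemma alt_map_g: "Sp.VV.alt n \<phi> \<Longrightarrow> Sp.UV.alt n (\<lambda>us. \<phi> (map g us))"
proof (induction n arbitrary: \<phi>)
  case (Suc n)
  have "Vector_Spaces.linear sU sV (\<lambda>u. \<phi> (map g (u # us)))" for us
    by (rule Sp.UV.linearI)
      (simp_all add: g_simps Sp.VV.linearD[OF Sp.VV.alt_linear_hd[OF Suc.prems]])
  moreover have "Sp.UV.alt n (\<lambda>us. \<phi> (map g (u # us)))" for u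
    using Suc.IH[of "\<lambda>vs. \<phi> (g u # vs)"] Suc.prems by simp
  ultimately show ?case using Suc.prems by simp
qed simp

lemma delta_in_Lam:
  assumes "n \<ge> 1" "x \<in> Lam sU sV n"
  shows "\<delta> n x \<in> Lam sU sV (n + 1)"
proof -
  obtain xU xV xg where x: "x = (xU, xV, xg)" by (cases x)
  have alt: "Sp.UU.alt n xU" "Sp.VV.alt n xV" "Sp.UV.alt (n - 1) xg"
    using assms(2) by (auto simp: x Lam_iff)
  \<comment> \<open>Here n >= 1 matters: with truncated subtraction b would raise the arity of
    \<open>xg\<close> from 0 to 1 at n = 0, outside the third summand of \<Lambda> in degree
    1.\<close>
  have "Sp.UV.alt n (CE sV brU (\<lambda>u v. brV (g u) v) xg)"
    using modV.CE_alt[OF alt(3)] assms(1) by simp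
  then show ?thesis
    using adU.CE_alt[OF alt(1)] adV.CE_alt[OF alt(2)] alt_map_g[OF alt(2)] alt_comp_g[OF alt(1)]
    by (simp add: x delta_def Lam_iff Sp.UV.alt_add Sp.UV.alt_diff Sp.UV.alt_uminus
        del: alternating.simps)
qed

lemma delta_delta:
  assumes "x \<in> Lam sU sV n"
  shows "\<delta> (n + 1) (\<delta> n x) = 0"
proof -
  obtain xU xV xg where x: "x = (xU, xV, xg)" by (cases x)
  have alt: "Sp.UU.alt n xU" "Sp.VV.alt n xV" "Sp.UV.alt (n - 1) xg"
    using assms by (auto simp: x Lam_iff)
  show ?thesis
    by (simp add: x delta_def adU.CE_CE[OF alt(1)] adV.CE_CE[OF alt(2)] modV.CE_CE[OF alt(3)]
        modV.CE_add modV.CE_diff modV.CE_uminus CE_map CE_comp_g zero_prod_def fun_eq_iff)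
qed

lemma vector_space_scale_Lam: "vector_space (scale_Lam sU sV)"
  by unfold_locales
    (auto simp: scale_Lam_def fun_eq_iff U.scale_right_distrib V.scale_right_distrib
      U.scale_left_distrib V.scale_left_distrib)

lemma vector_space_scale_C: "vector_space (scale_C sU sV)"
  by unfold_locales
    (auto simp: scale_C_def scale_T_def fun_eq_iff U.scale_right_distrib V.scale_right_distrib
      U.scale_left_distrib V.scale_left_distrib split: prod.splits)

lemma Lam_add: "x \<in> Lam sU sV n \<Longrightarrow> y \<in> Lam sU sV n \<Longrightarrow> x + y \<in> Lam sU sV n"
  by (cases x; cases y) (auto simp: Lam_iff plus_fun_def Sp.UU.alt_add Sp.VV.alt_add Sp.UV.alt_add)

lemma Lam_scale: "x \<in> Lam sU sV n \<Longrightarrow> scale_Lam sU sV c x \<in> Lam sU sV n"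
  by (cases x) (auto simp: Lam_iff scale_Lam_def Sp.UU.alt_scale Sp.VV.alt_scale Sp.UV.alt_scale)

lemma Lam_zero: "0 \<in> Lam sU sV n"
  by (simp add: zero_prod_def Lam_iff zero_fun_def)

lemma subspace_Lam: "module.subspace (scale_Lam sU sV) (Lam sU sV n)"
proof -
  interpret vector_space "scale_Lam sU sV" by (rule vector_space_scale_Lam)
  show ?thesis by (auto simp: subspace_def Lam_add Lam_scale Lam_zero)
qed

lemma delta_add: "\<delta> n (x + y) = \<delta> n x + \<delta> n y"
  by (cases x; cases y)
    (simp add: delta_def fun_eq_iff plus_fun_def adU.CE_add adV.CE_add modV.CE_add g_simps)

lemma delta_scale: "\<delta> n (scale_Lam sU sV c x) = scale_Lam sU sV c (\<delta> n x)"
  by (cases x)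
    (simp add: delta_def scale_Lam_def fun_eq_iff adU.CE_scale adV.CE_scale modV.CE_scale g_simps
      V.scale_right_distrib V.scale_right_diff_distrib)

lemma cochain_complex_delta: "cochain_complex (scale_Lam sU sV) 1 (Lam sU sV) \<delta>"
proof -
  interpret vector_space "scale_Lam sU sV" by (rule vector_space_scale_Lam)
  show ?thesis
    by unfold_locales
      (simp_all add: subspace_Lam linear_between_def delta_in_Lam[unfolded One_nat_def Suc_eq_plus1[symmetric]]
        delta_in_Lam delta_add delta_scale delta_delta del: One_nat_def)
qed

end

text \<open>Only the target is assumed to be a complex. Each law of the source differential is
  checked after applying the injective \<phi>, where it becomes the corresponding law of the
  target.\<close>

lemma cochain_complex_iso_transport:
  fixes s :: "'k::field \<Rightarrow> 'a::ab_group_add \<Rightarrow> 'a"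
  assumes Y: "cochain_complex s' lo Y d'" and s: "vector_space s"
    and sub: "\<And>n. n \<ge> lo \<Longrightarrow> module.subspace s (X n)"
    and lin: "\<And>n. n \<ge> lo \<Longrightarrow> linear_between s (X n) s' (Y n) (\<phi> n)"
    and bij: "\<And>n. n \<ge> lo \<Longrightarrow> bij_betw (\<phi> n) (X n) (Y n)"
    and d_in: "\<And>n x. n \<ge> lo \<Longrightarrow> x \<in> X n \<Longrightarrow> d n x \<in> X (n + 1)"
    and commute: "\<And>n x. n \<ge> lo \<Longrightarrow> x \<in> X n \<Longrightarrow> \<phi> (n + 1) (d n x) = d' n (\<phi> n x)"
  shows "cochain_complex_iso lo s X d s' Y d' \<phi>"
proof -
  interpret Y: cochain_complex s' lo Y d' by fact
  interpret S: vector_space s by fact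
  have eqI: "x = y" if "n \<ge> lo" "x \<in> X n" "y \<in> X n" "\<phi> n x = \<phi> n y" for n x y
    using bij_betw_imp_inj_on[OF bij[OF that(1)]] that by (auto dest: inj_onD)
  have \<phi>_in: "\<phi> n x \<in> Y n" if "n \<ge> lo" "x \<in> X n" for n x
    using lin that by (auto simp: linear_between_def)
  have \<phi>_add: "\<phi> n (x + y) = \<phi> n x + \<phi> n y" if "n \<ge> lo" "x \<in> X n" "y \<in> X n" for n x y
    using lin that by (auto simp: linear_between_def)
  have \<phi>_scale: "\<phi> n (s c x) = s' c (\<phi> n x)" if "n \<ge> lo" "x \<in> X n" for n c x
    using lin that by (auto simp: linear_between_def)
  have \<phi>_0: "\<phi> n 0 = 0" if "n \<ge> lo" for n
    using \<phi>_add[of n 0 0] sub[OF that] that by (simp add: S.subspace_0)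
  have d'_add: "d' n (x + y) = d' n x + d' n y" if "n \<ge> lo" "x \<in> Y n" "y \<in> Y n" for n x y
    using Y.d_linear that by (auto simp: linear_between_def)
  have d'_scale: "d' n (s' c x) = s' c (d' n x)" if "n \<ge> lo" "x \<in> Y n" for n c x
    using Y.d_linear that by (auto simp: linear_between_def)
  have "d n (x + y) = d n x + d n y" if "n \<ge> lo" "x \<in> X n" "y \<in> X n" for n x y
  proof (rule eqI[of "n + 1"])
    have xy: "x + y \<in> X n" using sub that by (simp add: S.subspace_add)
    show "d n (x + y) \<in> X (n + 1)" "d n x + d n y \<in> X (n + 1)"
      using d_in that xy sub by (simp_all add: S.subspace_add)
    show "\<phi> (n + 1) (d n (x + y)) = \<phi> (n + 1) (d n x + d n y)"
      using that xy by (simp only: commute \<phi>_add[OF _ d_in d_in] trans_le_add1 \<phi>_add d'_add \<phi>_in)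
  qed (use that in simp)
  moreover have "d n (s c x) = s c (d n x)" if "n \<ge> lo" "x \<in> X n" for n c x
  proof (rule eqI[of "n + 1"])
    have cx: "s c x \<in> X n" using sub that by (simp add: S.subspace_scale)
    show "d n (s c x) \<in> X (n + 1)" "s c (d n x) \<in> X (n + 1)"
      using d_in that cx sub by (simp_all add: S.subspace_scale)
    show "\<phi> (n + 1) (d n (s c x)) = \<phi> (n + 1) (s c (d n x))"
      using that cx by (simp only: commute \<phi>_scale[OF _ d_in] trans_le_add1 \<phi>_scale d'_scale \<phi>_in)
  qed (use that in simp)
  moreover have "d (n + 1) (d n x) = 0" if "n \<ge> lo" "x \<in> X n" for n x
  proof (rule eqI[of "n + 1 + 1"])
    have n1: "lo \<le> n + 1" using that by simp
    have dx: "d n x \<in> X (n + 1)" using d_in that by blast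
    show "d (n + 1) (d n x) \<in> X (n + 1 + 1)" using d_in[OF n1 dx] .
    show "0 \<in> X (n + 1 + 1)" using sub[of "n + 1 + 1"] that by (simp add: S.subspace_0)
    have "\<phi> (n + 1 + 1) (d (n + 1) (d n x)) = d' (n + 1) (d' n (\<phi> n x))"
      using commute[OF n1 dx] commute[OF that] by simp
    also have "\<dots> = 0" using Y.d_squared[OF that(1) \<phi>_in[OF that]] .
    finally show "\<phi> (n + 1 + 1) (d (n + 1) (d n x)) = \<phi> (n + 1 + 1) 0"
      using \<phi>_0[of "n + 1 + 1"] that by simp
  qed (use that in simp)
  ultimately have "cochain_complex s lo X d"
    by unfold_locales (use sub d_in in \<open>auto simp: linear_between_def\<close>)
  then interpret X: cochain_complex s lo X d .
  show ?thesis
    by unfold_locales (use lin bij commute in auto)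
qed

lemma map_nth_permutes:
  assumes "\<sigma> permutes {..<length us}" "b \<le> length us"
  shows "map (\<lambda>k. map e us ! \<sigma> k) [a..<b] = map e (map (\<lambda>k. us ! \<sigma> k) [a..<b])"
proof -
  have "\<sigma> k < length us" if "k < b" for k
    using permutes_in_image[OF assms(1), of k] that assms(2) by simp
  then show ?thesis by simp
qed

lemma sum_list_take_le: "sum_list (take m rs) \<le> sum_list (rs :: nat list)"
  by (metis append_take_drop_id le_add1 sum_list_append)

lemma block_start_Suc: "m < length rs \<Longrightarrow> block_start rs (m + 1) = block_start rs m + rs ! m"
  by (simp add: block_start_def take_Suc_conv_app_nth)

lemma delta_Lie_eq:
  "delta_Lie sU brU sV brV g p \<theta> \<xi> xs = (if coloured (in_colours \<xi>) xs
    then lincomb (scale_T sU sV) (\<lambda>t. vertex_sum \<theta> (beta brU brV g) t xs) (boundary \<xi>) else 0)"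
  by (simp add: delta_Lie_def lincomb_def vertex_sum_def)

context chart
begin

interpretation T: vector_space "scale_T sU sV"
  by (rule vector_space_scale_T)

lemma emb_sum: "emb (sum f I) = (\<Sum>i\<in>I. emb (f i))"
  by (induction I rule: infinite_finite_induct) (simp_all add: emb_add)

lemma lincomb_insertion:
  assumes h: "\<And>i j \<sigma>. i + j = n + 1 \<Longrightarrow> i \<ge> i0 \<Longrightarrow> j \<ge> 2 \<Longrightarrow> \<sigma> permutes {..<n} \<Longrightarrow>
      h (insertion_tree (G i) (M j) i j \<sigma>)
        = emb (K i j (map (\<lambda>k. us ! \<sigma> k) [0..<j]) (map (\<lambda>k. us ! \<sigma> k) [j..<j + (i - 1)]))"
    and i0: "i0 \<ge> 1"
  shows "lincomb (scale_T sU sV) h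
     (\<Sum>(i, j)\<in>{(i, j). i + j = n + 1 \<and> i \<ge> i0 \<and> j \<ge> 2}. \<Sum>\<sigma>\<in>unshuffles [j, i - 1].
        Poly_Mapping.single (insertion_tree (G i) (M j) i j \<sigma>)
          ((-1) ^ (j * (i - 1)) * of_int (sign \<sigma>)))
    = emb (insertion_sum s i0 K n us)"
  unfolding insertion_sum_def T.lincomb_sum emb_sum
proof (rule sum.cong[OF refl])
  fix x assume "x \<in> {(i, j). i + j = n + 1 \<and> i \<ge> i0 \<and> j \<ge> 2}"
  then obtain i j where x: "x = (i, j)" and ij: "i + j = n + 1" "i \<ge> i0" "j \<ge> 2" by auto
  \<comment> \<open>The two blocks exhaust the inputs because i >= 1, so that the natural-number
    subtraction is exact.\<close>
  have "j + (i - 1) = n" using ij i0 by simp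
  then have "\<sigma> permutes {..<n}" if "\<sigma> \<in> unshuffles [j, i - 1]" for \<sigma>
    using that by (simp add: unshuffles_pair)
  then show "lincomb (scale_T sU sV) h (case x of (i, j) \<Rightarrow> \<Sum>\<sigma>\<in>unshuffles [j, i - 1].
        Poly_Mapping.single (insertion_tree (G i) (M j) i j \<sigma>) ((-1) ^ (j * (i - 1)) * of_int (sign \<sigma>)))
    = emb (case x of (i, j) \<Rightarrow> \<Sum>\<sigma>\<in>unshuffles [j, i - 1].
        s ((-1) ^ (j * (i - 1)) * of_int (sign \<sigma>))
          (K i j (map (\<lambda>k. us ! \<sigma> k) [0..<j]) (map (\<lambda>k. us ! \<sigma> k) [j..<j + (i - 1)])))"
    unfolding x prod.case T.lincomb_sum emb_sum T.lincomb_single emb_scale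
    by (intro sum.cong refl) (simp only: h[OF ij])
qed

lemma vertex_sum_insertion_map:
  assumes "length us = n" "i + j = n + 1" "i \<ge> 1" "\<sigma> permutes {..<n}"
    and "ys = map (\<lambda>k. us ! \<sigma> k) [0..<j]" "zs = map (\<lambda>k. us ! \<sigma> k) [j..<j + (i - 1)]"
  shows "vertex_sum \<theta> \<beta> (insertion_tree \<xi> \<zeta> i j \<sigma>) (map emb us) =
    \<theta> \<xi> (\<beta> \<zeta> (map emb ys) # map emb zs) + \<beta> \<xi> (\<theta> \<zeta> (map emb ys) # map emb zs)"
proof -
  have "\<sigma> permutes {..<length us}" "j \<le> length us" "j + (i - 1) \<le> length us" using assms by auto
  then show ?thesis
    by (simp only: vertex_sum_insertion_tree map_nth_permutes assms(5,6))
qed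

text \<open>The generators \<open>G\<close> stand for \<open>Mu\<close> or \<open>Nu\<close>: one
  computation gives both adjoint components of the differential.\<close>

lemma lincomb_adjoint:
  assumes "lie_algebra s br" and \<phi>: "alternating s s (p + 1) \<phi>" and p: "p \<ge> 1"
    and \<beta>: "\<And>us j. length us = j \<Longrightarrow> \<beta> (G j) (map emb us) = emb (if j = 2 then br (us ! 0) (us ! 1) else 0)"
    and \<theta>: "\<And>us j. length us = j \<Longrightarrow> \<theta> (G j) (map emb us) = emb (if j = p + 1 then \<phi> us else 0)"
    and n: "length us = n"
  shows "lincomb (scale_T sU sV) (\<lambda>t. vertex_sum \<theta> \<beta> t (map emb us))
     (\<Sum>(i, j)\<in>{(i, j). i + j = n + 1 \<and> i \<ge> 2 \<and> j \<ge> 2}. \<Sum>\<sigma>\<in>unshuffles [j, i - 1].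
        Poly_Mapping.single (insertion_tree (G i) (G j) i j \<sigma>)
          ((-1) ^ (j * (i - 1)) * of_int (sign \<sigma>)))
    = emb (CE s br br \<phi> us)"
proof -
  interpret lie_module s br s br by (rule adjoint_module) fact
  \<comment> \<open>Theta at the root forces a binary inner vertex, \<theta> at the inner vertex a
    binary root. The two cases are added rather than separated because for p = 1 both occur at i = j
    = 2.\<close>
  define K where "K i j ys zs = (if i = p + 1 \<and> j = 2 then \<phi> (br (ys ! 0) (ys ! 1) # zs) else 0)
      + (if i = 2 \<and> j = p + 1 then br (\<phi> ys) (zs ! 0) else 0)" for i j :: nat and ys zs
  have \<phi>0: "\<phi> (0 # zs) = 0" for zs
    using linearD(3)[OF alt_linear_hd[OF \<phi>]] .
  have "vertex_sum \<theta> \<beta> (insertion_tree (G i) (G j) i j \<sigma>) (map emb us)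
      = emb (K i j (map (\<lambda>k. us ! \<sigma> k) [0..<j]) (map (\<lambda>k. us ! \<sigma> k) [j..<j + (i - 1)]))"
    if ij: "i + j = n + 1" "i \<ge> 2" "j \<ge> 2" and \<sigma>: "\<sigma> permutes {..<n}" for i j \<sigma>
  proof -
    define ys zs where ys: "ys = map (\<lambda>k. us ! \<sigma> k) [0..<j]" and zs: "zs = map (\<lambda>k. us ! \<sigma> k) [j..<j + (i - 1)]"
    have len: "length ys = j" "\<And>y. length (y # zs) = i" using ij by (simp_all add: ys zs)
    have cons: "emb x # map emb zs = map emb (x # zs)" for x by simp
    have "i \<ge> 1" using ij by simp
    from vertex_sum_insertion_map[OF n ij(1) this \<sigma> ys zs]
    have "vertex_sum \<theta> \<beta> (insertion_tree (G i) (G j) i j \<sigma>) (map emb us) =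
        emb (if i = p + 1 then \<phi> ((if j = 2 then br (ys ! 0) (ys ! 1) else 0) # zs) else 0) +
        emb (if i = 2 then br (if j = p + 1 then \<phi> ys else 0) (zs ! 0) else 0)"
      by (simp only: \<beta>[OF len(1)] \<theta>[OF len(1)] cons \<beta>[OF len(2)] \<theta>[OF len(2)]
          nth_Cons_0 nth_Cons_Suc One_nat_def)
    also have "\<dots> = emb (K i j ys zs)"
      unfolding emb_add[symmetric] K_def
      by (cases "i = p + 1"; cases "j = 2"; cases "i = 2"; cases "j = p + 1") (simp_all add: \<phi>0 br_simps)
    finally show ?thesis by (simp only: ys zs)
  qed
  then have "lincomb (scale_T sU sV) (\<lambda>t. vertex_sum \<theta> \<beta> t (map emb us))
     (\<Sum>(i, j)\<in>{(i, j). i + j = n + 1 \<and> i \<ge> 2 \<and> j \<ge> 2}. \<Sum>\<sigma>\<in>unshuffles [j, i - 1].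
        Poly_Mapping.single (insertion_tree (G i) (G j) i j \<sigma>)
          ((-1) ^ (j * (i - 1)) * of_int (sign \<sigma>))) = emb (insertion_sum s 2 K n us)"
    by (intro lincomb_insertion) simp_all
  also have "insertion_sum s 2 K n us = CE s br br \<phi> us"
  proof (cases "n = p + 2")
    case True
    \<comment> \<open>The tree puts the omitted argument to the right of the bracket; moving it to
      the left supplies the missing sign of the action term.\<close>
    have "s ((-1) ^ i) (br (\<phi> ys) y) = s ((-1) ^ Suc i) (br y (\<phi> ys))" for i ys y
      unfolding bracket_swap[of "\<phi> ys" y] by simp
    moreover have q: "p + 1 \<ge> 1" "p + 1 \<ge> 2" "(2::nat) \<le> 2" using p by simp_all
    have "n = p + 1 + 1" using True by simp
    ultimately show ?thesis
      unfolding K_def S.insertion_sum_add CE_0_based n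
        S.insertion_sum_binary_inner[OF q(1,2) n] S.insertion_sum_binary_outer[OF q(2,3) n]
      by (simp add: add.commute del: sum.lessThan_Suc)
  next
    case False
    \<comment> \<open>For other arities no pair (i, j) survives, and the differential vanishes
      because the list has the wrong length.\<close>
    then have "CE s br br \<phi> us = 0"
      using CE_alt[OF \<phi>] n by (intro alt_length[of "Suc (p + 1)"]) simp_all
    then show ?thesis
      using n False p unfolding K_def S.insertion_sum_add
      by (simp add: S.insertion_sum_binary_inner S.insertion_sum_binary_outer)
  qed
  finally show ?thesis .
qed

end

section \<open>The differential of the deformation complex\<close>

context lie_algebra_morphism_0
begin

interpretation T: vector_space "scale_T sU sV"
  by (rule Sp.Bl.vector_space_scale_T)

abbreviation (input) "embU \<equiv> \<lambda>u :: 'u. (u, 0 :: 'v)"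
abbreviation (input) "embV \<equiv> \<lambda>v :: 'v. (0 :: 'u, v)"

section \<open>Values on generators of \<beta>, of lifted cochains and of their
  differentials\<close>

lemma beta_Mu:
  assumes "length us = j"
  shows "beta brU brV g (Mu j) (map embU us) = embU (if j = 2 then brU (us ! 0) (us ! 1) else 0)"
proof -
  have "coloured (replicate j Black) (map embU us)" using assms by (simp only: Sp.Bl.coloured_map_emb)
  then show ?thesis
    using assms by (cases "j = 2") (simp_all add: beta_def)
qed

lemma beta_Nu:
  assumes "length vs = j"
  shows "beta brU brV g (Nu j) (map embV vs) = embV (if j = 2 then brV (vs ! 0) (vs ! 1) else 0)"
proof -
  have "coloured (replicate j White) (map embV vs)" using assms by (simp only: Sp.Wh.coloured_map_emb)
  then show ?thesis
    using assms by (cases "j = 2") (simp_all add: beta_def)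
qed

lemma beta_F:
  assumes "length us = r"
  shows "beta brU brV g (F r) (map embU us) = embV (if r = 1 then g (us ! 0) else 0)"
proof -
  have "coloured (replicate r Black) (map embU us)" using assms by (simp only: Sp.Bl.coloured_map_emb)
  then show ?thesis
    using assms by (cases "r = 1") (simp_all add: beta_def)
qed

lemma lift_Mu:
  assumes "length us = j"
  shows "lift_cochain p (xU, xV, xg) (Mu j) (map embU us) = embU (if j = p + 1 then xU us else 0)"
  using assms Sp.UU.lift_op_map[of "p + 1" xU us]
  by (cases "j = p + 1") (simp_all add: lift_cochain_def del: replicate_Suc)

lemma lift_Nu:
  assumes "length vs = j"
  shows "lift_cochain p (xU, xV, xg) (Nu j) (map embV vs) = embV (if j = p + 1 then xV vs else 0)"
  using assms Sp.VV.lift_op_map[of "p + 1" xV vs]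
  by (cases "j = p + 1") (simp_all add: lift_cochain_def del: replicate_Suc)

lemma lift_F:
  assumes "length us = j"
  shows "lift_cochain p (xU, xV, xg) (F j) (map embU us) = embV (if j = p then xg us else 0)"
  using assms Sp.UV.lift_op_map[of p xg us]
  by (cases "j = p") (simp_all add: lift_cochain_def)

context
  fixes p :: nat and xU xV xg
  assumes p: "p \<ge> 1"
    and alt: "Sp.UU.alt (p + 1) xU" "Sp.VV.alt (p + 1) xV" "Sp.UV.alt p xg"
begin

private abbreviation "\<theta> \<equiv> lift_cochain p (xU, xV, xg)"
private abbreviation "\<beta> \<equiv> beta brU brV g"

lemma xg_0: "xg (0 # us) = 0"
  using Sp.UV.linearD(3)[OF Sp.UV.alt_linear_hd[OF alt(3)]] .

lemma delta_Lie_Mu: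
  assumes "length us = n"
  shows "delta_Lie sU brU sV brV g p \<theta> (Mu n) (map embU us) = embU (CE sU brU brU xU us)"
proof -
  have "coloured (in_colours (Mu n)) (map embU us)" using assms by simp
  then show ?thesis
    unfolding delta_Lie_eq boundary.simps
    using Sp.Bl.lincomb_adjoint[OF U.lie_algebra_axioms alt(1) p beta_Mu lift_Mu assms]
    by (simp only: if_True)
qed

lemma delta_Lie_Nu:
  assumes "length vs = n"
  shows "delta_Lie sU brU sV brV g p \<theta> (Nu n) (map embV vs) = embV (CE sV brV brV xV vs)"
proof -
  have "coloured (in_colours (Nu n)) (map embV vs)" using assms by simp
  then show ?thesis
    unfolding delta_Lie_eq boundary.simps
    using Sp.Wh.lincomb_adjoint[OF V.lie_algebra_axioms alt(2) p beta_Nu lift_Nu assms]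
    by (simp only: if_True)
qed

lemma lincomb_insertion_F:
  assumes "length us = n"
  shows "lincomb (scale_T sU sV) (\<lambda>t. vertex_sum \<theta> \<beta> t (map embU us))
     (\<Sum>(i, j)\<in>{(i, j). i + j = n + 1 \<and> i \<ge> 1 \<and> j \<ge> 2}. \<Sum>\<sigma>\<in>unshuffles [j, i - 1].
        Poly_Mapping.single (insertion_tree (F i) (Mu j) i j \<sigma>)
          ((-1) ^ (j * (i - 1)) * of_int (sign \<sigma>)))
    = embV (if n = p + 1 then (\<Sum>i<n. \<Sum>j\<in>{i<..<n}.
        sV ((-1) ^ Suc (i + j)) (xg (brU (us ! i) (us ! j) # nths us (- {i, j})))) + g (xU us) else 0)"
proof -
  \<comment> \<open>The first term has \<theta> on \<open>F p\<close> over a bracket and yields the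
    bracket half of b; the second has g as root over \<theta> on \<open>Mu (p + 1)\<close>.\<close>
  define K where "K i j ys zs = (if i = p \<and> j = 2 then xg (brU (ys ! 0) (ys ! 1) # zs) else 0)
      + (if i = 1 \<and> j = p + 1 then g (xU ys) else 0)" for i j :: nat and ys zs
  have "vertex_sum \<theta> \<beta> (insertion_tree (F i) (Mu j) i j \<sigma>) (map embU us)
      = embV (K i j (map (\<lambda>k. us ! \<sigma> k) [0..<j]) (map (\<lambda>k. us ! \<sigma> k) [j..<j + (i - 1)]))"
    if ij: "i + j = n + 1" "i \<ge> 1" "j \<ge> 2" and \<sigma>: "\<sigma> permutes {..<n}" for i j \<sigma>
  proof -
    define ys zs where ys: "ys = map (\<lambda>k. us ! \<sigma> k) [0..<j]" and zs: "zs = map (\<lambda>k. us ! \<sigma> k) [j..<j + (i - 1)]"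
    have len: "length ys = j" "\<And>y. length (y # zs) = i" using ij by (simp_all add: ys zs)
    have cons: "embU x # map embU zs = map embU (x # zs)" for x by simp
    from Sp.Bl.vertex_sum_insertion_map[OF assms ij(1,2) \<sigma> ys zs]
    have "vertex_sum \<theta> \<beta> (insertion_tree (F i) (Mu j) i j \<sigma>) (map embU us) =
        embV (if i = p then xg ((if j = 2 then brU (ys ! 0) (ys ! 1) else 0) # zs) else 0) +
        embV (if i = 1 then g (if j = p + 1 then xU ys else 0) else 0)"
      by (simp only: beta_Mu[OF len(1)] lift_Mu[OF len(1)] cons beta_F[OF len(2)]
          lift_F[OF len(2)] nth_Cons_0)
    also have "\<dots> = embV (K i j ys zs)"
      unfolding Sp.Wh.emb_add[symmetric] K_def
      by (cases "i = p"; cases "j = 2"; cases "i = 1"; cases "j = p + 1") (simp_all add: xg_0 g_simps)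
    finally show ?thesis by (simp only: ys zs)
  qed
  then have "lincomb (scale_T sU sV) (\<lambda>t. vertex_sum \<theta> \<beta> t (map embU us))
     (\<Sum>(i, j)\<in>{(i, j). i + j = n + 1 \<and> i \<ge> 1 \<and> j \<ge> 2}. \<Sum>\<sigma>\<in>unshuffles [j, i - 1].
        Poly_Mapping.single (insertion_tree (F i) (Mu j) i j \<sigma>)
          ((-1) ^ (j * (i - 1)) * of_int (sign \<sigma>))) = embV (insertion_sum sV 1 K n us)"
    by (intro Sp.Wh.lincomb_insertion) simp_all
  also have "insertion_sum sV 1 K n us = (if n = p + 1 then (\<Sum>i<n. \<Sum>j\<in>{i<..<n}.
        sV ((-1) ^ Suc (i + j)) (xg (brU (us ! i) (us ! j) # nths us (- {i, j})))) + g (xU us) else 0)"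
  proof -
    have q: "p + 1 \<ge> 2" "(1::nat) \<le> 1" using p by simp_all
    show ?thesis
      unfolding K_def V.insertion_sum_add V.insertion_sum_binary_inner[OF p p assms]
        V.insertion_sum_unary_outer[OF q assms]
      by (simp del: sum.lessThan_Suc)
  qed
  finally show ?thesis .
qed

text \<open>\<open>b m\<close> and \<open>t m\<close> are the values of \<beta> and \<theta> on
  child m. Theta on a child leaves \<beta> on the root, which forces l = 2 and gives one summand for
  each of the two children.\<close>

lemma vertex_sum_bloom:
  fixes \<sigma> :: "nat \<Rightarrow> nat" and us rs
  defines "Q \<equiv> \<lambda>m. map (\<lambda>k. us ! \<sigma> k) [block_start rs m..<block_start rs (m + 1)]"
  defines "b \<equiv> \<lambda>m. if rs ! m = 1 then g (us ! \<sigma> (block_start rs m)) else 0"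
    and "t \<equiv> \<lambda>m. if rs ! m = p then xg (Q m) else 0"
  assumes rs: "rs \<in> ordered_partitions n l" and \<sigma>: "\<sigma> permutes {..<n}" and n: "length us = n"
  shows "vertex_sum \<theta> \<beta> (bloom_tree rs \<sigma>) (map embU us) =
    embV ((if l = p + 1 then xV (map b [0..<l]) else 0) +
          (if l = 2 then brV (t 0) (b 1) + brV (b 0) (t 1) else 0))"
proof -
  have l: "length rs = l" and sum: "sum_list rs = n" using rs by (auto simp: ordered_partitions_def)
  define P where "P m = map (\<lambda>k. map embU us ! \<sigma> k) [block_start rs m..<block_start rs (m + 1)]" for m
  have P: "P m = map embU (Q m)" for m
  proof -
    have "block_start rs (m + 1) \<le> length us"
      unfolding block_start_def n sum[symmetric] by (rule sum_list_take_le)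
    then show ?thesis unfolding P_def Q_def using map_nth_permutes[of \<sigma> us] \<sigma> n by blast
  qed
  have len: "length (Q m) = rs ! m" if "m < l" for m
    using block_start_Suc[of m rs] that l by (simp add: Q_def)
  have \<beta>F: "\<beta> (F (rs ! m)) (P m) = embV (b m)" if "m < l" for m
  proof -
    have "Q m ! 0 = us ! \<sigma> (block_start rs m)" if "rs ! m = 1"
      using that block_start_Suc[of m rs] \<open>m < l\<close> l by (simp add: Q_def)
    then show ?thesis unfolding P beta_F[OF len[OF that]] b_def by simp
  qed
  have \<theta>F: "\<theta> (F (rs ! m)) (P m) = embV (t m)" if "m < l" for m
    unfolding P lift_F[OF len[OF that]] t_def by simp
  have "map (\<lambda>m. \<beta> (F (rs ! m)) (P m)) [0..<l] = map embV (map b [0..<l])"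
    using \<beta>F by (intro nth_equalityI) (simp_all only: length_map length_upt diff_zero nth_map nth_upt add_0)
  then have root: "\<theta> (Nu l) (map (\<lambda>m. \<beta> (F (rs ! m)) (P m)) [0..<l])
      = embV (if l = p + 1 then xV (map b [0..<l]) else 0)"
    by (simp only: lift_Nu length_map length_upt diff_zero)
  have child: "\<beta> (Nu l) (map (\<lambda>m'. (if m' = m then \<theta> else \<beta>) (F (rs ! m')) (P m')) [0..<l])
      = embV (if l = 2 then brV (if 0 = m then t 0 else b 0) (if 1 = m then t 1 else b 1) else 0)" for m
  proof -
    define c where "c m' = (if m' = m then t m' else b m')" for m'
    have "(if m' = m then \<theta> else \<beta>) (F (rs ! m')) (P m') = embV (c m')" if "m' < l" for m'
      using \<beta>F[OF that] \<theta>F[OF that] by (cases "m' = m") (simp_all add: c_def)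
    then have "map (\<lambda>m'. (if m' = m then \<theta> else \<beta>) (F (rs ! m')) (P m')) [0..<l] = map embV (map c [0..<l])"
      by (intro nth_equalityI) (simp_all only: length_map length_upt diff_zero nth_map nth_upt add_0)
    then have "\<beta> (Nu l) (map (\<lambda>m'. (if m' = m then \<theta> else \<beta>) (F (rs ! m')) (P m')) [0..<l])
        = embV (if l = 2 then brV (map c [0..<l] ! 0) (map c [0..<l] ! 1) else 0)"
      by (simp only: beta_Nu length_map length_upt diff_zero)
    also have "(if l = 2 then brV (map c [0..<l] ! 0) (map c [0..<l] ! 1) else 0)
        = (if l = 2 then brV (c 0) (c 1) else 0)"
      by (cases "l = 2") (simp_all add: upt_rec)
    finally show ?thesis by (simp only: c_def)
  qed
  have "vertex_sum \<theta> \<beta> (bloom_tree rs \<sigma>) (map embU us) =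
      embV (if l = p + 1 then xV (map b [0..<l]) else 0) +
      (\<Sum>m<l. embV (if l = 2 then brV (if 0 = m then t 0 else b 0) (if 1 = m then t 1 else b 1) else 0))"
    unfolding vertex_sum_bloom_tree l P_def[symmetric] root child by (rule refl)
  also have "(\<Sum>m<l. embV (if l = 2 then brV (if 0 = m then t 0 else b 0) (if 1 = m then t 1 else b 1) else 0))
      = embV (if l = 2 then brV (t 0) (b 1) + brV (b 0) (t 1) else 0)"
    by (cases "l = 2") (simp_all add: numeral_2_eq_2)
  finally show ?thesis by (simp only: Sp.Wh.emb_add)
qed

text \<open>The action terms carry \<open>(-1) ^ i\<close> for 0-based i, the opposite of the sign
  in \<open>CE\<close>.\<close>

lemma lincomb_bloom:
  assumes n: "length us = n"
  shows "lincomb (scale_T sU sV) (\<lambda>t. vertex_sum \<theta> \<beta> t (map embU us))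
      (\<Sum>l\<in>{2..n}. \<Sum>rs\<in>ordered_partitions n l. \<Sum>\<sigma>\<in>ordered_unshuffles rs.
        Poly_Mapping.single (bloom_tree rs \<sigma>)
          ((-1) ^ (l * (l - 1) div 2 + (\<Sum>i\<in>{1..l - 1}. rs ! (i - 1) * (l - i)))
            * of_int (sign \<sigma>)))
    = embV (if n = p + 1 then xV (map g us)
        + (\<Sum>i<n. sV ((-1) ^ i) (brV (g (us ! i)) (xg (nths us (- {i}))))) else 0)"
proof -
  let ?c = "\<lambda>l rs \<sigma>. (-1) ^ (l * (l - 1) div 2 + (\<Sum>i\<in>{1..l - 1}. rs ! (i - 1) * (l - i)))
      * of_int (sign \<sigma>) :: 'k"
  define b where "b rs \<sigma> m = (if rs ! m = 1 then g (us ! \<sigma> (block_start rs m)) else 0)"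
    for rs and \<sigma> :: "nat \<Rightarrow> nat" and m
  define t where "t rs \<sigma> m = (if rs ! m = p
      then xg (map (\<lambda>k. us ! \<sigma> k) [block_start rs m..<block_start rs (m + 1)]) else 0)"
    for rs and \<sigma> :: "nat \<Rightarrow> nat" and m
  \<comment> \<open>\<open>X\<close> is the contribution of \<theta> at the root, \<open>Y\<close>
    that of \<theta> at a child.\<close>
  define X where "X l rs \<sigma> = (if l = p + 1 then xV (map (b rs \<sigma>) [0..<l]) else 0)" for l rs \<sigma>
  define Y where "Y l rs \<sigma> = (if l = 2 then brV (t rs \<sigma> 0) (b rs \<sigma> 1) + brV (b rs \<sigma> 0) (t rs \<sigma> 1) else 0)"
    for l :: nat and rs \<sigma>
  have "lincomb (scale_T sU sV) (\<lambda>t. vertex_sum \<theta> \<beta> t (map embU us))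
      (\<Sum>l\<in>{2..n}. \<Sum>rs\<in>ordered_partitions n l. \<Sum>\<sigma>\<in>ordered_unshuffles rs.
        Poly_Mapping.single (bloom_tree rs \<sigma>) (?c l rs \<sigma>))
    = (\<Sum>l\<in>{2..n}. \<Sum>rs\<in>ordered_partitions n l. \<Sum>\<sigma>\<in>ordered_unshuffles rs.
        embV (sV (?c l rs \<sigma>) (X l rs \<sigma> + Y l rs \<sigma>)))"
    unfolding T.lincomb_sum T.lincomb_single
  proof (intro sum.cong refl)
    fix l rs \<sigma> assume rs: "rs \<in> ordered_partitions n l" and "\<sigma> \<in> ordered_unshuffles rs"
    then have "\<sigma> permutes {..<n}"
      by (simp add: ordered_unshuffles_def unshuffles_def ordered_partitions_def)
    from vertex_sum_bloom[OF rs this n]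
    have "vertex_sum \<theta> \<beta> (bloom_tree rs \<sigma>) (map embU us) = embV (X l rs \<sigma> + Y l rs \<sigma>)"
      unfolding X_def Y_def b_def t_def .
    then show "scale_T sU sV (?c l rs \<sigma>) (vertex_sum \<theta> \<beta> (bloom_tree rs \<sigma>) (map embU us))
        = embV (sV (?c l rs \<sigma>) (X l rs \<sigma> + Y l rs \<sigma>))"
      by (simp only: Sp.Wh.emb_scale)
  qed
  also have "\<dots> = embV ((\<Sum>l\<in>{2..n}. \<Sum>rs\<in>ordered_partitions n l. \<Sum>\<sigma>\<in>ordered_unshuffles rs.
        sV (?c l rs \<sigma>) (X l rs \<sigma>)) + (\<Sum>l\<in>{2..n}. \<Sum>rs\<in>ordered_partitions n l.
        \<Sum>\<sigma>\<in>ordered_unshuffles rs. sV (?c l rs \<sigma>) (Y l rs \<sigma>)))"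
    by (simp only: Sp.Wh.emb_sum[symmetric] V.scale_right_distrib sum.distrib)
  also have "(\<Sum>l\<in>{2..n}. \<Sum>rs\<in>ordered_partitions n l. \<Sum>\<sigma>\<in>ordered_unshuffles rs.
      sV (?c l rs \<sigma>) (X l rs \<sigma>)) = (if n = p + 1 then xV (map g us) else 0)"
  proof -
    have "(\<Sum>\<sigma>\<in>ordered_unshuffles rs. sV (?c l rs \<sigma>) (X l rs \<sigma>))
        = (if rs = replicate n 1 then if l = n \<and> n = p + 1 then xV (map g us) else 0 else 0)"
      if rs: "rs \<in> ordered_partitions n l" for l rs
      using rs
    proof (cases rule: all_ones_or)
      case 1
      have bs: "block_start (replicate n 1) m = m" if "m < n" for m
        using that by (simp add: block_start_def sum_list_replicate)
      have "map (b rs id) [0..<n] = map g us"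
        using n by (intro nth_equalityI) (simp_all add: b_def 1 bs[simplified])
      then have "X l rs id = (if n = p + 1 then xV (map g us) else 0)"
        by (simp only: X_def 1(2))
      moreover have "?c l rs id = 1"
        unfolding 1 sign_id by (simp only: bloom_sign_ones of_int_1 mult_1)
      moreover have "ordered_unshuffles rs = {id}" unfolding 1 by (rule ordered_unshuffles_ones)
      moreover have "rs = replicate n 1" "l = n" by (simp_all only: 1)
      ultimately show ?thesis by (simp del: upt_Suc replicate_Suc)
    next
      case (2 m)
      have "X l rs \<sigma> = 0" for \<sigma>
      proof (cases "l = p + 1")
        case True
        \<comment> \<open>The block of size other than 1 feeds 0 into slot m; written as an update
          by 0, the list falls under linearity in that slot.\<close>
        have "xV ((map (b rs \<sigma>) [0..<l])[m := 0]) = 0"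
          using Sp.VV.linearD(3)[OF Sp.VV.alt_linear_update[OF alt(2)]] 2 by simp
        moreover have "(map (b rs \<sigma>) [0..<l])[m := 0] = map (b rs \<sigma>) [0..<l]"
          using 2 by (simp add: list_update_same_conv b_def)
        ultimately show ?thesis by (simp only: X_def if_cancel)
      qed (simp add: X_def)
      moreover have "\<not> (rs = replicate n 1 \<and> l = n)" using 2 by auto
      ultimately show ?thesis by auto
    qed
    then have "(\<Sum>l\<in>{2..n}. \<Sum>rs\<in>ordered_partitions n l. \<Sum>\<sigma>\<in>ordered_unshuffles rs.
        sV (?c l rs \<sigma>) (X l rs \<sigma>))
      = (\<Sum>l\<in>{2..n}. \<Sum>rs\<in>ordered_partitions n l.
          if rs = replicate n 1 then if l = n \<and> n = p + 1 then xV (map g us) else 0 else 0)"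
      by (intro sum.cong refl)
    also have "\<dots> = (\<Sum>l\<in>{2..n}. if l = n then if n = p + 1 then xV (map g us) else 0 else 0)"
      by (intro sum.cong refl)
        (use ordered_partitions_ones[of n n] in \<open>auto simp: sum.delta[OF finite_ordered_partitions]\<close>)
    also have "\<dots> = (if n = p + 1 then xV (map g us) else 0)"
      using p by (simp add: sum.delta)
    finally show ?thesis .
  qed
  also have "(\<Sum>l\<in>{2..n}. \<Sum>rs\<in>ordered_partitions n l. \<Sum>\<sigma>\<in>ordered_unshuffles rs.
      sV (?c l rs \<sigma>) (Y l rs \<sigma>))
    = (if n = p + 1 then \<Sum>i<n. sV ((-1) ^ i) (brV (g (us ! i)) (xg (nths us (- {i})))) else 0)"
  proof -
    let ?S = "\<Sum>i<n. sV ((-1) ^ i) (brV (g (us ! i)) (xg (nths us (- {i}))))"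
    have "(\<Sum>rs\<in>ordered_partitions n l. \<Sum>\<sigma>\<in>ordered_unshuffles rs. sV (?c l rs \<sigma>) (Y l rs \<sigma>))
      = (if l = 2 then \<Sum>rs\<in>ordered_partitions n 2. if rs = [1, p] then ?S else 0 else 0)" for l
    proof (cases "l = 2")
      case True
      have "(\<Sum>\<sigma>\<in>ordered_unshuffles rs. sV (?c 2 rs \<sigma>) (Y 2 rs \<sigma>)) = (if rs = [1, p] then ?S else 0)"
        if rs2: "rs \<in> ordered_partitions n 2" for rs
      proof -
        obtain r s where rs: "rs = [r, s]" "1 \<le> r" "r \<le> s" "r + s = n"
          using rs2 by (auto simp: ordered_partitions_2)
        show ?thesis
        proof (cases "r = 1 \<and> s = p")
          case False
          \<comment> \<open>A surviving product needs a block of size 1 for \<beta> and one of size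
            p for \<theta>; since r <= s and p >= 1, this is \<open>[1, p]\<close> in either order
            of the factors.\<close>
          then have "Y 2 rs \<sigma> = 0" for \<sigma>
            using rs p by (auto simp: Y_def b_def t_def adV.br_simps)
          moreover have "rs \<noteq> [1, p]" using False rs(1) by auto
          ultimately show ?thesis by simp
        next
          case rp: True
          \<comment> \<open>For l = 2 and first block 1 the exponent is 1 + 1.\<close>
          have c: "?c 2 rs \<sigma> = of_int (sign \<sigma>)" for \<sigma>
            by (simp add: rs rp)
          have np: "n = Suc p" using rs rp by simp
          have bs: "block_start rs 0 = 0" "block_start rs 1 = 1" "block_start rs 2 = 1 + p"
            by (simp_all add: rs rp block_start_def numeral_2_eq_2)
          show ?thesis
          proof (cases "p = 1")
            case True
            \<comment> \<open>For p = 1 the equal blocks admit only the identity, but each child may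
              carry \<theta>. Antisymmetry of the bracket turns the two products into the two
              summands of the action term.\<close>
            have os: "ordered_unshuffles rs = {id}"
              using ordered_unshuffles_ones[of 2] by (simp add: rs rp True numeral_2_eq_2)
            obtain u v where us: "us = [u, v]"
              using n np True by (auto simp: length_Suc_conv numeral_2_eq_2)
            have del: "nths us (- {0}) = [v]" "nths us (- {Suc 0}) = [u]"
              by (simp_all only: us nths_Cons_delete)
            have Y: "Y 2 rs id = brV (xg [u]) (g v) + brV (g u) (xg [v])"
              using bs by (simp add: Y_def b_def t_def rs rp True us numeral_2_eq_2)
            have S: "?S = brV (g u) (xg [v]) - brV (g v) (xg [u])"
              using del by (simp add: np True us)
            have r: "rs = [1, p]" by (simp add: rs rp)
            show ?thesis
              unfolding os S using c[of id] Y r V.bracket_swap[of "xg [u]" "g v"] by simp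
          next
            case False
            have "ordered_unshuffles rs = unshuffles [1, p]"
              using False by (simp add: rs rp ordered_unshuffles_distinct)
            \<comment> \<open>For p > 1 the first block is too short for \<theta>, so only \<theta>
              on the second child remains.\<close>
            moreover have "Y 2 rs \<sigma> = brV (g (map (\<lambda>k. us ! \<sigma> k) [0..<1] ! 0)) (xg (map (\<lambda>k. us ! \<sigma> k) [1..<1 + p]))" for \<sigma>
              using False bs by (simp add: Y_def b_def t_def rs rp numeral_2_eq_2 adV.br_simps)
            ultimately show ?thesis
              using sum_unshuffles_1[of us p "\<lambda>e ys zs. sV (of_int e) (brV (g (ys ! 0)) (xg zs))"] n np rs rp c
              by (simp del: sum.lessThan_Suc upt_Suc)
          qed
        qed
      qed
      then show ?thesis using True by simp
    qed (simp add: Y_def)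
    then have "(\<Sum>l\<in>{2..n}. \<Sum>rs\<in>ordered_partitions n l. \<Sum>\<sigma>\<in>ordered_unshuffles rs.
        sV (?c l rs \<sigma>) (Y l rs \<sigma>))
      = (\<Sum>l\<in>{2..n}. if l = 2 then \<Sum>rs\<in>ordered_partitions n 2. if rs = [1, p] then ?S else 0 else 0)"
      by (intro sum.cong refl)
    also have "\<dots> = (if n \<ge> 2 then \<Sum>rs\<in>ordered_partitions n 2. if rs = [1, p] then ?S else 0 else 0)"
      by (simp add: sum.delta)
    also have "\<dots> = (if n = p + 1 then ?S else 0)"
      using p by (auto simp: sum.delta[OF finite_ordered_partitions] ordered_partitions_2 simp del: sum.lessThan_Suc)
    finally show ?thesis .
  qed
  finally show ?thesis by simp
qed

lemma delta_Lie_F: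
  assumes n: "length us = n"
  shows "delta_Lie sU brU sV brV g p \<theta> (F n) (map embU us) = embV (if n = p + 1
    then - CE sV brU (\<lambda>u v. brV (g u) v) xg us + xV (map g us) - g (xU us) else 0)"
proof -
  have "coloured (in_colours (F n)) (map embU us)" using n by simp
  then have "delta_Lie sU brU sV brV g p \<theta> (F n) (map embU us)
      = lincomb (scale_T sU sV) (\<lambda>t. vertex_sum \<theta> \<beta> t (map embU us)) (boundary (F n))"
    by (simp only: delta_Lie_eq if_True)
  also have "\<dots> = embV (if n = p + 1 then xV (map g us)
        + (\<Sum>i<n. sV ((-1) ^ i) (brV (g (us ! i)) (xg (nths us (- {i}))))) else 0)
      - embV (if n = p + 1 then (\<Sum>i<n. \<Sum>j\<in>{i<..<n}.
        sV ((-1) ^ Suc (i + j)) (xg (brU (us ! i) (us ! j) # nths us (- {i, j})))) + g (xU us) else 0)"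
    unfolding boundary.simps T.lincomb_diff lincomb_bloom[OF n] lincomb_insertion_F[OF n] ..
  also have "\<dots> = embV (if n = p + 1
    then - CE sV brU (\<lambda>u v. brV (g u) v) xg us + xV (map g us) - g (xU us) else 0)"
    by (simp add: modV.CE_0_based n sum_negf del: sum.lessThan_Suc)
  finally show ?thesis .
qed

end

end

context lie_algebra_morphism_0
begin

text \<open>Equality is checked on all symbols \<open>Mu n\<close>, \<open>Nu n\<close>,
  \<open>F n\<close>; in arities where the right side is 0 by definition, the left side vanishes by
  the length of its arguments or by \<open>delta_Lie_F\<close>.\<close>

lemma delta_Lie_lift:
  assumes p: "p \<ge> 1" and x: "x \<in> Lam sU sV (p + 1)"
  shows "delta_Lie sU brU sV brV g p (lift_cochain p x) = lift_cochain (p + 1) (\<delta> (p + 1) x)"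
proof -
  obtain xU xV xg where xs: "x = (xU, xV, xg)" by (cases x)
  have alt: "Sp.UU.alt (p + 1) xU" "Sp.VV.alt (p + 1) xV" "Sp.UV.alt p xg"
    using x by (simp_all add: xs Lam_iff del: alternating.simps)
  define yg where "yg = (\<lambda>us. - CE sV brU (\<lambda>u v. brV (g u) v) xg us + xV (map g us) - g (xU us))"
  have \<delta>: "\<delta> (p + 1) (xU, xV, xg) = (CE sU brU brU xU, CE sV brV brV xV, yg)"
    by (simp add: delta_def yg_def)
  have len: "CE sU brU brU xU us = 0" if "length us \<noteq> p + 1 + 1" for us
    using adU.CE_alt[OF alt(1)] that by (intro Sp.UU.alt_length[of "Suc (p + 1)"]) simp_all
  have len': "CE sV brV brV xV us = 0" if "length us \<noteq> p + 1 + 1" for us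
    using adV.CE_alt[OF alt(2)] that by (intro Sp.VV.alt_length[of "Suc (p + 1)"]) simp_all
  show ?thesis
  proof (intro ext)
    fix \<xi> and xs :: "('u \<times> 'v) list"
    have "delta_Lie sU brU sV brV g p (lift_cochain p (xU, xV, xg)) \<xi> xs
      = lift_cochain (p + 1) (CE sU brU brU xU, CE sV brV brV xV, yg) \<xi> xs"
    proof (cases "coloured (in_colours \<xi>) xs")
      case False
      then show ?thesis
        by (auto simp: delta_Lie_eq lift_cochain_def lift_op_def simp del: replicate_Suc)
    next
      case True
      show ?thesis
      proof (cases \<xi>)
        case (Mu n)
        then obtain us where us: "length us = n" "xs = map (\<lambda>u. (u, 0)) us"
          using True by (auto simp: Sp.Bl.coloured_iff)
        show ?thesis
          unfolding Mu us(2) delta_Lie_Mu[OF p alt us(1)] lift_Mu[OF us(1)]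
          using len[of us] us(1) by (cases "n = p + 1 + 1") simp_all
      next
        case (Nu n)
        then obtain vs where vs: "length vs = n" "xs = map (\<lambda>v. (0, v)) vs"
          using True by (auto simp: Sp.Wh.coloured_iff)
        show ?thesis
          unfolding Nu vs(2) delta_Lie_Nu[OF p alt vs(1)] lift_Nu[OF vs(1)]
          using len'[of vs] vs(1) by (cases "n = p + 1 + 1") simp_all
      next
        case (F n)
        then obtain us where us: "length us = n" "xs = map (\<lambda>u. (u, 0)) us"
          using True by (auto simp: Sp.Bl.coloured_iff)
        show ?thesis
          unfolding F us(2) delta_Lie_F[OF p alt us(1)] lift_F[OF us(1)] yg_def ..
      qed
    qed
    then show "delta_Lie sU brU sV brV g p (lift_cochain p x) \<xi> xs = lift_cochain (p + 1) (\<delta> (p + 1) x) \<xi> xs"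
      by (simp only: xs \<delta>)
  qed
qed

lemma lift_cochain_add:
  fixes x y :: "('u, 'v) cochain"
  shows "lift_cochain p (x + y) = lift_cochain p x + lift_cochain p y"
  by (cases x; cases y) (auto simp: lift_cochain_def lift_op_def fun_eq_iff)

lemma lift_cochain_scale: "lift_cochain p (scale_Lam sU sV c x) = scale_C sU sV c (lift_cochain p x)"
  by (cases x) (auto simp: lift_cochain_def lift_op_def scale_Lam_def scale_C_def scale_T_def fun_eq_iff
    zero_prod_def simp del: Sp.Bl.emb_0 Sp.Wh.emb_0)

text \<open>Reduces closure of the cochains under the linear operations to that of
  \<Lambda>.\<close>

lemma C_Lie_eq_lift:
  assumes "p \<ge> 1"
  shows "C_Lie sU sV p = lift_cochain p ` Lam sU sV (p + 1)"
proof (intro equalityI subsetI)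
  fix \<theta> assume "\<theta> \<in> C_Lie sU sV p"
  then show "\<theta> \<in> lift_cochain p ` Lam sU sV (p + 1)"
    using Sp.lift_identification Sp.identification_in_Lam by (metis imageI)
qed (use Sp.lift_in_C_Lie assms in auto)

lemma subspace_C_Lie:
  assumes "p \<ge> 1"
  shows "module.subspace (scale_C sU sV) (C_Lie sU sV p)"
proof -
  interpret C: vector_space "scale_C sU sV" by (rule vector_space_scale_C)
  have "lift_cochain p (0 :: ('u, 'v) cochain) = 0"
    using lift_cochain_add[of p 0 0] by (simp only: add_0_right add_cancel_right_right)
  then have "0 \<in> C_Lie sU sV p"
    unfolding C_Lie_eq_lift[OF assms] using Lam_zero by (metis imageI)
  then show ?thesis
    unfolding C.subspace_def C_Lie_eq_lift[OF assms]
    by (auto simp: Lam_add Lam_scale simp flip: lift_cochain_add lift_cochain_scale)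
qed

lemma identification_linear:
  "linear_between (scale_C sU sV) (C_Lie sU sV p) (scale_Lam sU sV) (Lam sU sV (p + 1)) (identification p)"
  unfolding linear_between_def
  using Sp.identification_in_Lam
  by (auto simp: identification_def scale_C_def scale_T_def scale_Lam_def fun_eq_iff split: prod.splits)

lemma identification_bij:
  assumes "p \<ge> 1"
  shows "bij_betw (identification p) (C_Lie sU sV p) (Lam sU sV (p + 1))"
  using assms
  by (intro bij_betw_byWitness[where f' = "lift_cochain p"])
    (auto simp: Sp.lift_identification Sp.identification_lift Sp.identification_in_Lam Sp.lift_in_C_Lie
      simp del: One_nat_def add_Suc_right)

lemma delta_Lie_in:
  assumes "p \<ge> 1" "\<theta> \<in> C_Lie sU sV p"
  shows "delta_Lie sU brU sV brV g p \<theta> \<in> C_Lie sU sV (p + 1)"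
    and "identification (p + 1) (delta_Lie sU brU sV brV g p \<theta>) = \<delta> (p + 1) (identification p \<theta>)"
proof -
  have x: "identification p \<theta> \<in> Lam sU sV (p + 1)"
    using assms by (simp only: Sp.identification_in_Lam)
  have "p + 1 \<ge> 1" by simp
  note \<delta>x = delta_in_Lam[OF this x]
  have eq: "delta_Lie sU brU sV brV g p \<theta> = lift_cochain (p + 1) (\<delta> (p + 1) (identification p \<theta>))"
    using delta_Lie_lift[OF assms(1) x] by (simp only: Sp.lift_identification[OF assms(2)])
  show "delta_Lie sU brU sV brV g p \<theta> \<in> C_Lie sU sV (p + 1)"
    unfolding eq by (rule Sp.lift_in_C_Lie[OF \<delta>x]) simp
  show "identification (p + 1) (delta_Lie sU brU sV brV g p \<theta>) = \<delta> (p + 1) (identification p \<theta>)"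
    unfolding eq by (rule Sp.identification_lift[OF \<delta>x])
qed

section \<open>Comparison of \<open>delta\<close> and \<open>Delta\<close>\<close>

abbreviation "\<Delta> \<equiv> Delta sU brU sV brV g"

lemma pi_pi: "pi_map sV n (pi_map sV n x) = x"
  by (cases x) (simp add: pi_map_def flip: power_mult_distrib)

lemma pi_in_Lam: "x \<in> Lam sU sV n \<Longrightarrow> pi_map sV n x \<in> Lam sU sV n"
  by (cases x) (simp add: pi_map_def Lam_iff Sp.UV.alt_scale)

lemma pi_linear: "linear_between (scale_Lam sU sV) (Lam sU sV n) (scale_Lam sU sV) (Lam sU sV n) (pi_map sV n)"
proof -
  have "pi_map sV n (x + y) = pi_map sV n x + pi_map sV n y"
    "pi_map sV n (scale_Lam sU sV c x) = scale_Lam sU sV c (pi_map sV n x)"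
    for c and x y :: "('u, 'v) cochain"
    by (cases x; cases y; simp add: pi_map_def scale_Lam_def fun_eq_iff V.scale_right_distrib mult.commute)+
  then show ?thesis by (simp add: linear_between_def pi_in_Lam)
qed

lemma pi_bij: "bij_betw (pi_map sV n) (Lam sU sV n) (Lam sU sV n)"
  by (intro bij_betw_byWitness[where f' = "pi_map sV n"]) (auto simp: pi_pi pi_in_Lam)

text \<open>The sign in degree n + 1 is minus the one in degree n. It therefore turns the -b of
  \<open>delta\<close> into b applied to the rescaled third component, and gives the other two terms
  exactly the signs in \<open>Delta\<close>.\<close>

lemma pi_delta:
  assumes "n \<ge> 1"
  shows "pi_map sV (n + 1) (\<delta> n x) = \<Delta> n (pi_map sV n x)"
proof -
  obtain m where n: "n = Suc m" using assms by (cases n) auto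
  show ?thesis
    by (cases x) (simp add: n pi_map_def delta_def Delta_def modV.CE_scale fun_eq_iff
      V.scale_right_diff_distrib V.scale_right_distrib)
qed

lemma pi_Delta:
  assumes "n \<ge> 1"
  shows "pi_map sV (n + 1) (\<Delta> n x) = \<delta> n (pi_map sV n x)"
  using pi_delta[OF assms, of "pi_map sV n x"] by (metis pi_pi)

text \<open>Transport needs a complex as its target, so \<pi>, which is its own inverse, is first
  used from \<open>Delta\<close> to \<open>delta\<close>. This makes \<open>Delta\<close> a complex
  and allows the opposite direction.\<close>

lemma Delta_iso: "cochain_complex_iso 1 (scale_Lam sU sV) (Lam sU sV) \<Delta>
    (scale_Lam sU sV) (Lam sU sV) \<delta> (pi_map sV)"
proof (rule cochain_complex_iso_transport[OF cochain_complex_delta vector_space_scale_Lam])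
  fix n x assume n: "1 \<le> n" and x: "x \<in> Lam sU sV n"
  have "\<Delta> n x = pi_map sV (n + 1) (\<delta> n (pi_map sV n x))"
    using pi_delta[OF n, of "pi_map sV n x"] by (simp only: pi_pi)
  then show "\<Delta> n x \<in> Lam sU sV (n + 1)"
    using pi_in_Lam[OF delta_in_Lam[OF n pi_in_Lam[OF x]]] by simp
qed (simp_all only: subspace_Lam pi_linear pi_bij pi_Delta)

lemma cochain_complex_Delta: "cochain_complex (scale_Lam sU sV) 1 (Lam sU sV) \<Delta>"
  using Delta_iso by (simp only: cochain_complex_iso_def)

lemma delta_iso: "cochain_complex_iso 1 (scale_Lam sU sV) (Lam sU sV) \<delta>
    (scale_Lam sU sV) (Lam sU sV) \<Delta> (pi_map sV)"
  by (rule cochain_complex_iso_transport[OF cochain_complex_Delta vector_space_scale_Lam])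
    (simp_all only: subspace_Lam pi_linear pi_bij pi_delta delta_in_Lam)

end

lemma cochain_complex_shift:
  assumes "cochain_complex s 1 X d"
  shows "cochain_complex s 1 (\<lambda>p. X (p + 1)) (\<lambda>p. d (p + 1))"
proof -
  interpret cochain_complex s 1 X d by fact
  show ?thesis
    by unfold_locales (use subspace d_linear d_squared in simp_all)
qed

theorem corollary7p6:
  fixes sU :: "'k::field_char_0 \<Rightarrow> 'u::ab_group_add \<Rightarrow> 'u"
    and sV :: "'k \<Rightarrow> 'v::ab_group_add \<Rightarrow> 'v"
    and brU :: "'u \<Rightarrow> 'u \<Rightarrow> 'u" and brV :: "'v \<Rightarrow> 'v \<Rightarrow> 'v" and g :: "'u \<Rightarrow> 'v"
  assumes "lie_algebra_morphism sU brU sV brV g"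
  shows "cochain_complex_iso 1
           (scale_Lam sU sV) (Lam sU sV) (delta sU brU sV brV g)
           (scale_Lam sU sV) (Lam sU sV) (Delta sU brU sV brV g)
           (pi_map sV)
       \<and> cochain_complex_iso 1
           (scale_C sU sV) (C_Lie sU sV) (delta_Lie sU brU sV brV g)
           (scale_Lam sU sV) (\<lambda>p. Lam sU sV (p + 1)) (\<lambda>p. delta sU brU sV brV g (p + 1))
           identification
       \<and> cochain_complex_iso 1
           (scale_C sU sV) (C_Lie sU sV) (delta_Lie sU brU sV brV g)
           (scale_Lam sU sV) (\<lambda>p. Lam sU sV (p + 1)) (\<lambda>p. Delta sU brU sV brV g (p + 1))
           (\<lambda>p \<theta>. pi_map sV (p + 1) (identification p \<theta>))"
proof -
  interpret lie_algebra_morphism_0 sU brU sV brV g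
    using assms by (rule lie_algebra_morphism_0.intro)
  have "cochain_complex_iso 1 (scale_C sU sV) (C_Lie sU sV) (delta_Lie sU brU sV brV g)
      (scale_Lam sU sV) (\<lambda>p. Lam sU sV (p + 1)) (\<lambda>p. \<delta> (p + 1)) identification"
    by (rule cochain_complex_iso_transport[OF cochain_complex_shift[OF cochain_complex_delta]
          vector_space_scale_C])
      (simp_all only: subspace_C_Lie identification_linear identification_bij delta_Lie_in)
  moreover have "cochain_complex_iso 1 (scale_C sU sV) (C_Lie sU sV) (delta_Lie sU brU sV brV g)
      (scale_Lam sU sV) (\<lambda>p. Lam sU sV (p + 1)) (\<lambda>p. \<Delta> (p + 1))
      (\<lambda>p \<theta>. pi_map sV (p + 1) (identification p \<theta>))"
  proof (rule cochain_complex_iso_transport[OF cochain_complex_shift[OF cochain_complex_Delta]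
          vector_space_scale_C])
    fix p :: nat assume p: "1 \<le> p"
    show "linear_between (scale_C sU sV) (C_Lie sU sV p) (scale_Lam sU sV) (Lam sU sV (p + 1))
        (\<lambda>\<theta>. pi_map sV (p + 1) (identification p \<theta>))"
      using identification_linear[of p] pi_linear[of "p + 1"] unfolding linear_between_def by metis
    show "bij_betw (\<lambda>\<theta>. pi_map sV (p + 1) (identification p \<theta>)) (C_Lie sU sV p) (Lam sU sV (p + 1))"
      using bij_betw_trans[OF identification_bij[OF p] pi_bij] by (simp only: comp_def)
    fix \<theta> assume \<theta>: "\<theta> \<in> C_Lie sU sV p"
    show "pi_map sV (p + 1 + 1) (identification (p + 1) (delta_Lie sU brU sV brV g p \<theta>))
        = \<Delta> (p + 1) (pi_map sV (p + 1) (identification p \<theta>))"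
      unfolding delta_Lie_in(2)[OF p \<theta>] by (rule pi_delta) simp
  qed (simp_all only: subspace_C_Lie delta_Lie_in)
  ultimately show ?thesis using delta_iso by blast
qed

end
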